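(* Let $\mu$ be a critical offspring distribution for which there exist $\beta\in(1,2]$ and a constant $c>0$ such that, with $S_n=\sum_{i=1}^n Z_i$, $Z_i$ i.i.d. with law $\mu$, one has $\frac{S_n-n}{c\,n^{1/\beta}}\to X$ in distribution as $n\to\infty$, where $X$ is the $\beta$-stable random variable with $\mathbb{E}[e^{-\lambda X}]=e^{\lambda^\beta}$ for all $\lambda>0$. Let $d=\frac{\beta}{\beta-1}$, $\alpha>d$, and let $U(t)$ be the total mass at time $t$ of the parabolic Anderson model started from the root $O$ on Kesten's tree $T_\infty$ with offspring distribution $\mu$ and i.i.d. Pareto($\alpha$) potential. Then $$\lim_{\lambda\to\infty}\liminf_{t\to\infty}P\big(\log U(t)\in[\lambda^{-1}t\,a(t),\ \lambda\, t\,a(t)]\big)=1 .$$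
   Context: Tree: a critical offspring distribution $\mu=(\mu_n)_{n\ge0}$ is a probability distribution on $\{0,1,2,\dots\}$ with $\sum_n n\mu_n=1$; its size-biased version is $\mu^*_n=n\mu_n$. Kesten's tree $T_\infty$ (the critical Galton-Watson tree conditioned to survive), with law $\mathbf{P}$, is the random rooted tree in which every individual is normal or special; the root $O$ is special; normal individuals produce normal children with offspring law $\mu$; a special individual produces children with offspring law $\mu^*$, one of which, chosen uniformly, is special and the others normal; all choices are independent. $V(T_\infty)$ is its vertex set. Potential: conditionally on $T_\infty$, $(\xi(v))_{v\in V(T_\infty)}$ are i.i.d. with $\mathcal{P}(\xi(v)\ge x)=x^{-\alpha}$ for $x\ge1$. $P$ is the joint law of $(T_\infty,\xi)$. Parabolic Anderson model (PAM): $u(t,v)$ solves $\partial_t u(t,v)=\sum_{y\sim v}[u(t,y)-u(t,v)]+\xi(v)u(t,v)$ for $t>0$, $v\in V(T_\infty)$, with $u(0,v)=\mathbf 1\{v=O\}$; it is given by the Feynman-Kac formula $u(t,v)=\mathbb{E}_O\big[\exp\{\int_0^t\xi(X_s)ds\}\mathbf 1\{X_t=v\}\big]$, where, given $(T_\infty,\xi)$, $X$ is the continuous-time random walk on $T_\infty$ jumping across each incident edge at rate $1$, started at $O$. The total mass is $U(t)=\sum_{v\in V(T_\infty)}u(t,v)$. Scales: $q=\frac{d}{\alpha-d}$, $a(t)=\left(\frac{t}{\log t}\right)^{q}$. *)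

theory Defs
  imports "HOL-Probability.Probability"
begin

section \<open>Offspring distributions\<close>

definition critical_offspring :: "nat pmf \<Rightarrow> bool" where
  "critical_offspring \<mu> \<longleftrightarrow> (\<lambda>n. real n * pmf \<mu> n) sums 1"

text \<open>A probability mass function only if \<open>\<mu>\<close> is critical.\<close>
definition size_biased :: "nat pmf \<Rightarrow> nat pmf" where
  "size_biased \<mu> = embed_pmf (\<lambda>n. real n * pmf \<mu> n)"

text \<open>
  The law of \<open>X\<close> with Laplace transform \<open>exp (\<lambda>\<^sup>\<beta>)\<close>, \<open>\<lambda> > 0\<close>, which determines the law and
  makes it strictly \<open>\<beta>\<close>-stable.
\<close>
definition stable_limit_law :: "real \<Rightarrow> real measure \<Rightarrow> bool" where
  "stable_limit_law \<beta> \<nu> \<longleftrightarrow> real_distribution \<nu> \<and>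
     (\<forall>l>0. has_bochner_integral \<nu> (\<lambda>x. exp (- l * x)) (exp (l powr \<beta>)))"

text \<open>The law of \<open>(S\<^sub>n - n) / (c n\<^bsup>1/\<beta>\<^esup>)\<close>, where \<open>S\<^sub>n\<close> is a sum of \<open>n\<close> i.i.d.\ variables with law \<open>\<mu>\<close>.\<close>
definition normalised_sum_law :: "nat pmf \<Rightarrow> real \<Rightarrow> real \<Rightarrow> nat \<Rightarrow> real measure" where
  "normalised_sum_law \<mu> \<beta> c n =
     distr (\<Pi>\<^sub>M i\<in>(UNIV :: nat set). measure_pmf \<mu>) borel
       (\<lambda>Z. (real (\<Sum>i=1..n. Z i) - real n) / (c * real n powr (1 / \<beta>)))"


section \<open>Kesten's tree\<close>

text \<open>
  Individuals are labelled by Ulam--Harris words read from right to left: the root is \<open>[]\<close> and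
  \<open>i # v\<close> is the \<open>i\<close>-th child of \<open>v\<close>. Every label \<open>v\<close> independently carries a mark
  \<open>(n, s, k)\<close>, where \<open>n\<close> (law \<open>\<mu>\<close>) is the number of children of \<open>v\<close> if \<open>v\<close> is normal, and
  \<open>s\<close> (size-biased law) is the number of children of \<open>v\<close> if \<open>v\<close> is special, in which case its
  special child is the one with index \<open>k\<close>, uniform on \<open>{..<s}\<close>.
\<close>

type_synonym label = "nat list"
type_synonym marks = "label \<Rightarrow> nat \<times> nat \<times> nat"

definition special_offspring :: "nat pmf \<Rightarrow> (nat \<times> nat) pmf" where
  "special_offspring \<mu> =
     bind_pmf (size_biased \<mu>) (\<lambda>s. map_pmf (\<lambda>k. (s, k)) (pmf_of_set {..<s}))"

definition kesten_measure :: "nat pmf \<Rightarrow> marks measure" where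
  "kesten_measure \<mu> =
     (\<Pi>\<^sub>M v\<in>(UNIV :: label set). measure_pmf (pair_pmf \<mu> (special_offspring \<mu>)))"

primrec special :: "marks \<Rightarrow> label \<Rightarrow> bool" where
  "special \<omega> [] \<longleftrightarrow> True"
| "special \<omega> (i # v) \<longleftrightarrow> special \<omega> v \<and> i = snd (snd (\<omega> v))"

definition num_children :: "marks \<Rightarrow> label \<Rightarrow> nat" where
  "num_children \<omega> v = (if special \<omega> v then fst (snd (\<omega> v)) else fst (\<omega> v))"

primrec in_tree :: "marks \<Rightarrow> label \<Rightarrow> bool" where
  "in_tree \<omega> [] \<longleftrightarrow> True"
| "in_tree \<omega> (i # v) \<longleftrightarrow> in_tree \<omega> v \<and> i < num_children \<omega> v"

definition kesten_tree :: "marks \<Rightarrow> label set" where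
  "kesten_tree \<omega> = {v. in_tree \<omega> v}"

definition neighbours :: "label set \<Rightarrow> label \<Rightarrow> label set" where
  "neighbours V v = {w \<in> V. \<exists>i. w = i # v \<or> v = i # w}"


section \<open>The random potential\<close>

definition pareto_law :: "real \<Rightarrow> real measure \<Rightarrow> bool" where
  "pareto_law \<alpha> \<rho> \<longleftrightarrow> real_distribution \<rho> \<and> (\<forall>x\<ge>1. measure \<rho> {x..} = x powr (- \<alpha>))"

text \<open>
  The joint law of the tree and the potential. The potential is attached to all labels,
  independently of the marks; only its values on the vertices of the tree are used, and
  conditionally on the tree these are i.i.d.
\<close>
definition joint_law :: "nat pmf \<Rightarrow> real measure \<Rightarrow> (marks \<times> (label \<Rightarrow> real)) measure" where
  "joint_law \<mu> \<rho> = kesten_measure \<mu> \<Otimes>\<^sub>M (\<Pi>\<^sub>M v\<in>(UNIV :: label set). \<rho>)"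


section \<open>The random walk and the parabolic Anderson model\<close>

text \<open>
  The continuous-time random walk on a locally finite tree with vertex set \<open>V\<close>, started at the
  root. All clocks \<open>E (n, w)\<close> are independent and exponential with rate 1. After its \<open>n\<close>-th jump the
  walk restarts the clocks \<open>E (n, w)\<close> of the edges to its neighbours \<open>w\<close>, and it crosses the edge
  whose clock rings first; by lack of memory, it crosses each incident edge at rate 1.
\<close>

type_synonym clocks = "nat \<times> label \<Rightarrow> real"

definition clock_measure :: "clocks measure" where
  "clock_measure = (\<Pi>\<^sub>M i\<in>(UNIV :: (nat \<times> label) set). density lborel (exponential_density 1))"

primrec jump_chain :: "label set \<Rightarrow> clocks \<Rightarrow> nat \<Rightarrow> label" where
  "jump_chain V E 0 = []"
| "jump_chain V E (Suc n) = arg_min_on (\<lambda>w. E (n, w)) (neighbours V (jump_chain V E n))"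

definition jump_time :: "label set \<Rightarrow> clocks \<Rightarrow> nat \<Rightarrow> real" where
  "jump_time V E n = (\<Sum>k<n. E (k, jump_chain V E (Suc k)))"

text \<open>\<open>None\<close> is the cemetery state, entered if infinitely many jumps occur in finite time.\<close>
definition walk :: "label set \<Rightarrow> clocks \<Rightarrow> real \<Rightarrow> label option" where
  "walk V E t =
     (if \<exists>n. t < jump_time V E (Suc n)
      then Some (jump_chain V E (LEAST n. t < jump_time V E (Suc n))) else None)"

text \<open>The Feynman--Kac formula. The value is a priori in \<open>[0, \<infinity>]\<close>.\<close>
definition pam :: "label set \<Rightarrow> (label \<Rightarrow> real) \<Rightarrow> real \<Rightarrow> label \<Rightarrow> ennreal" where
  "pam V \<xi> t v =
     (\<integral>\<^sup>+E. ennreal (exp (LINT s:{0..t}|lborel. \<xi> (the (walk V E s))))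
            * indicator {E. walk V E t = Some v} E \<partial>clock_measure)"

definition total_mass :: "label set \<Rightarrow> (label \<Rightarrow> real) \<Rightarrow> real \<Rightarrow> ennreal" where
  "total_mass V \<xi> t = (\<Sum>\<^sub>\<infinity>v\<in>V. pam V \<xi> t v)"

definition ext_log :: "ennreal \<Rightarrow> ereal" where
  "ext_log x =
     (if x = 0 then - \<infinity> else if x = \<infinity> then \<infinity> else ereal (ln (enn2real x)))"

definition scale_q :: "real \<Rightarrow> real \<Rightarrow> real" where
  "scale_q d \<alpha> = d / (\<alpha> - d)"

definition scale_a :: "real \<Rightarrow> real \<Rightarrow> real \<Rightarrow> real" where
  "scale_a d \<alpha> t = (t / ln t) powr scale_q d \<alpha>"

end

theory Submission
  imports Defs "HOL-Real_Asymp.Real_Asymp" "HOL-Library.Sublist"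
begin

text \<open>
  Let \<open>f x = \<phi> (1 - x) - (1 - x)\<close>, where \<open>\<phi>\<close> is the generating function of \<open>\<mu>\<close>. The limit theorem for
  \<open>S\<^sub>n\<close> is only used through \<open>c\<^sub>1 x\<^bsup>\<beta>\<^esup> \<le> f x \<le> c\<^sub>2 x\<^bsup>\<beta>\<^esup>\<close> for small \<open>x\<close>: the lower bound comes from the Laplace
  transform of the limit, the upper one from tightness and a second moment argument. The recursion
  for the Laplace transform of the volume of a ball of Kesten's tree then shows that
  \<open>\<bar>B\<^sub>R\<bar>\<close> is of order \<open>R\<^bsup>d\<^esup>\<close>, with a polynomial upper tail.

  On a tree, the walk can reach a vertex at distance \<open>R\<close> only by crossing each edge of the geodesic at
  rate one, so whatever the degrees are it does so by time \<open>t\<close> with probability at most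
  \<open>exp (- R ln (R / t) + R - t)\<close>. Together with the maxima of the potential on
  the balls of dyadic radii this bounds \<open>U\<close> from above. From below, a positive proportion of the
  vertices of a ball of radius \<open>R\<close> have a bounded number of children, so that one of them has potential of
  order \<open>R\<^bsup>d/\<alpha>\<^esup>\<close>; the walk goes straight there in a time less than \<open>t/2\<close> and stays, at a cost of order
  \<open>R ln R + t\<close>. Both estimates balance at \<open>R\<close> of order \<open>(t / ln t)\<^bsup>q+1\<^esup>\<close>.
\<close>

text \<open>The exponents come from one equation: a ball of radius R has about R^d vertices, so its
  largest potential is about R^(d/\<alpha>), and the gain t R^(d/\<alpha>) meets the travel cost R
  ln t at R = \<open>rad t\<close>, where both equal t a(t). Since \<alpha> > d, the gain grows more
  slowly than R while the cost is linear in R: distant dyadic shells are negligible in the upper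
  bound, and a small multiple of \<open>rad t\<close> is a good radius in the lower bound. The
  obstacle is the unbounded degree. For the upper bound the hitting time is discounted at rate b =
  exp a - 1. At most one neighbour is closer to the target and contributes a factor exp a = 1 + b,
  so the sum over the neighbours is at most deg + b, which is exactly the denominator of a
  discounted jump. For the lower bound, the degrees met on the way cost only their logarithm, so a
  bound by the volume is enough; staying at the target costs t times its degree, which is why the
  target must have few children.\<close>

lemma indep_vars_PiM_coordinates:
  assumes "prob_space P"
  shows "prob_space.indep_vars (PiM UNIV (\<lambda>_. P)) (\<lambda>_. P) (\<lambda>i \<omega>. \<omega> i) (UNIV :: 'a set)"
proof -
  interpret prob_space P by fact
  interpret product_prob_space "\<lambda>_. P" "UNIV :: 'a set" ..
  have "distr (PiM UNIV (\<lambda>_. P)) P (\<lambda>\<omega>. \<omega> i) = P" for i :: 'a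
    by (rule PiM_component) simp
  moreover have "distr (PiM UNIV (\<lambda>_. P)) (PiM UNIV (\<lambda>_. P)) (\<lambda>x. \<lambda>i\<in>UNIV. x i) = PiM (UNIV :: 'a set) (\<lambda>_. P)"
    by (simp add: restrict_def distr_id2)
  ultimately show ?thesis
    by (subst P.indep_vars_iff_distr_eq_PiM) (simp_all)
qed

text \<open>Independence in the form used throughout: each \<open>g i\<close> lives on the whole
  product space but reads only the coordinates in \<open>J i\<close>. It serves for i.i.d. sums, for
  the subtrees below the children of a vertex and for the clocks of successive jumps.\<close>

lemma nn_integral_prod_blocks:
  fixes P :: "'b measure" and J :: "'i \<Rightarrow> 'a set" and g :: "'i \<Rightarrow> ('a \<Rightarrow> 'b) \<Rightarrow> ennreal"
  assumes PS: "prob_space P" "space P = UNIV" and I: "finite I" "disjoint_family_on J I"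
    and meas: "\<And>i. i \<in> I \<Longrightarrow> g i \<in> borel_measurable (PiM UNIV (\<lambda>_. P))"
    and dep: "\<And>i x y. i \<in> I \<Longrightarrow> (\<And>j. j \<in> J i \<Longrightarrow> x j = y j) \<Longrightarrow> g i x = g i y"
  shows "(\<integral>\<^sup>+x. (\<Prod>i\<in>I. g i x) \<partial>PiM UNIV (\<lambda>_. P)) = (\<Prod>i\<in>I. \<integral>\<^sup>+x. g i x \<partial>PiM UNIV (\<lambda>_. P))"
proof -
  interpret prob_space P by fact
  interpret product_prob_space "\<lambda>_. P" "UNIV :: 'a set" ..
  obtain p0 :: 'b where True by auto
  \<comment> \<open>\<open>e i\<close> fills the coordinates outside \<open>J i\<close> with the
    fixed value \<open>p0\<close>. By \<open>dep\<close> this does not change \<open>g i\<close>,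
    and \<open>space P = UNIV\<close> makes the filling measurable.\<close>
  define e where "e i x = (\<lambda>j. if j \<in> J i then x j else p0)" for i and x :: "'a \<Rightarrow> 'b"
  have "P.indep_vars (\<lambda>i. PiM (J i) (\<lambda>_. P)) (\<lambda>i \<omega>. restrict (\<lambda>j. \<omega> j) (J i)) I"
    by (rule P.indep_vars_restrict[OF indep_vars_PiM_coordinates[OF PS(1)]]) (use I in auto)
  then have "P.indep_vars (\<lambda>_. borel) (\<lambda>i \<omega>. g i (e i (restrict (\<lambda>j. \<omega> j) (J i)))) I"
  proof (rule P.indep_vars_compose2)
    fix i assume "i \<in> I"
    have "e i \<in> PiM (J i) (\<lambda>_. P) \<rightarrow>\<^sub>M PiM UNIV (\<lambda>_. P)"
    proof (rule measurable_PiM_single')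
      fix j show "(\<lambda>x. e i x j) \<in> PiM (J i) (\<lambda>_. P) \<rightarrow>\<^sub>M P"
        by (cases "j \<in> J i") (auto simp: e_def PS(2) intro: measurable_component_singleton)
    qed (auto simp: PS(2))
    then show "(\<lambda>x. g i (e i x)) \<in> borel_measurable (PiM (J i) (\<lambda>_. P))"
      using meas[OF \<open>i \<in> I\<close>] by (rule measurable_compose)
  qed
  moreover have "g i (e i (restrict (\<lambda>j. \<omega> j) (J i))) = g i \<omega>" if "i \<in> I" for i \<omega>
    by (rule dep[OF that]) (simp add: e_def)
  ultimately have "P.indep_vars (\<lambda>_. borel) g I"
    by (subst P.indep_vars_cong[OF refl _ refl]) (auto simp: fun_eq_iff)
  then show ?thesis
    by (rule P.indep_vars_nn_integral[OF I(1)]) simp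
qed

lemma emeasure_PiM_cylinder:
  fixes P :: "'b measure" and A :: "'a \<Rightarrow> 'b set"
  assumes PS: "prob_space P" "space P = UNIV" and I: "finite I"
    and meas: "\<And>i. i \<in> I \<Longrightarrow> A i \<in> sets P"
  shows "emeasure (PiM UNIV (\<lambda>_. P)) {x. \<forall>i\<in>I. x i \<in> A i} = (\<Prod>i\<in>I. emeasure P (A i))"
proof -
  interpret prob_space P by fact
  interpret product_prob_space "\<lambda>_. P" "UNIV :: 'a set" ..
  have "{x. \<forall>i\<in>I. x i \<in> A i} = {x\<in>space (PiM UNIV (\<lambda>_. P)). \<forall>i\<in>I. x i \<in> A i}"
    by (auto simp: space_PiM PS)
  then show ?thesis
    using emeasure_PiM_Collect[of I A] I meas by auto
qed

section \<open>Offspring generating functions near one\<close>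

text \<open>The remainder in Bernoulli's inequality. Under a law of mean one its expectation is
  \<phi> (1 - x) - (1 - x); inequalities for that function are proved for each n and then
  averaged.\<close>

definition gap :: "nat \<Rightarrow> real \<Rightarrow> real" where
  "gap n x = (1 - x) ^ n - 1 + real n * x"

text \<open>The derivative of \<open>gap n\<close> in x. Its mean is 1 - \<phi>' (1 - x), the
  quantity that governs a special vertex, whose offspring law is size-biased.\<close>

definition dgap :: "nat \<Rightarrow> real \<Rightarrow> real" where
  "dgap n x = real n * (1 - (1 - x) ^ (n - 1))"

lemma gap_0 [simp]: "gap 0 x = 0" "gap n 0 = 0"
  by (simp_all add: gap_def)

lemma gap_Suc: "gap (Suc n) x = gap n x + x * (1 - (1 - x) ^ n)"
  by (simp add: gap_def algebra_simps)

lemma gap_nonneg: "x \<le> 1 \<Longrightarrow> 0 \<le> gap n x"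
  using Bernoulli_inequality[of "-x" n] by (simp add: gap_def)

lemma gap_mono: "0 \<le> x \<Longrightarrow> x \<le> y \<Longrightarrow> y \<le> 1 \<Longrightarrow> gap n x \<le> gap n y"
proof (induction n)
  case (Suc n)
  have "x * (1 - (1 - x) ^ n) \<le> y * (1 - (1 - y) ^ n)"
    using Suc.prems by (intro mult_mono) (auto intro!: power_mono power_le_one)
  then show ?case using Suc by (simp add: gap_Suc)
qed simp

lemma gap_diff_le: "x \<le> y \<Longrightarrow> y \<le> 1 \<Longrightarrow> gap n y - gap n x \<le> real n * (y - x)"
  using power_mono[of "1 - y" "1 - x" n] by (simp add: gap_def algebra_simps)

text \<open>By \<open>gap_Suc\<close> it is enough to compare increments, and that comparison is
  midpoint convexity of powers, 1 - x being the midpoint of 1 and 1 - 2 x. The factor 4 controls a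
  second moment in \<open>mgap_neq_two\<close>.\<close>

lemma gap_double: "0 \<le> x \<Longrightarrow> x \<le> 1 / 2 \<Longrightarrow> gap n (2 * x) \<le> 4 * gap n x"
proof (induction n)
  case (Suc n)
  have pw: "2 * (1 - x) ^ k \<le> 1 + (1 - 2 * x) ^ k" for k
  proof (induction k)
    case (Suc k)
    have "2 * (1 - x) ^ Suc k = (1 - x) * (2 * (1 - x) ^ k)" by simp
    also have "\<dots> \<le> (1 - x) * (1 + (1 - 2 * x) ^ k)"
      using Suc \<open>x \<le> 1 / 2\<close> by (intro mult_left_mono) auto
    also have "\<dots> = 1 + (1 - 2 * x) ^ Suc k - x * (1 - (1 - 2 * x) ^ k)"
      by (simp add: algebra_simps)
    also have "\<dots> \<le> 1 + (1 - 2 * x) ^ Suc k"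
      using Suc.prems \<open>0 \<le> x\<close> \<open>x \<le> 1 / 2\<close> by (simp add: power_le_one)
    finally show ?case .
  qed simp
  have "x * (2 * (1 - (1 - 2 * x) ^ n)) \<le> x * (4 * (1 - (1 - x) ^ n))"
    using Suc.prems pw[of n] by (intro mult_left_mono) auto
  then show ?case using Suc by (simp add: gap_Suc algebra_simps)
qed simp

lemma dgap_nonneg: "0 \<le> x \<Longrightarrow> x \<le> 1 \<Longrightarrow> 0 \<le> dgap n x"
  by (simp add: dgap_def power_le_one)

lemma dgap_mono: "0 \<le> x \<Longrightarrow> x \<le> y \<Longrightarrow> y \<le> 1 \<Longrightarrow> dgap n x \<le> dgap n y"
  unfolding dgap_def by (intro mult_left_mono) (auto intro!: power_mono)

lemma dgap_le: "0 \<le> x \<Longrightarrow> x \<le> 1 \<Longrightarrow> dgap n x \<le> real n"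
  unfolding dgap_def by (simp add: mult_left_le)

lemma gap_le_dgap: "0 \<le> x \<Longrightarrow> x \<le> 1 \<Longrightarrow> gap n x \<le> x * dgap n x"
proof (induction n)
  case (Suc n)
  have "(1 - x) ^ n \<le> (1 - x) ^ (n - 1)"
    using Suc.prems by (intro power_decreasing) auto
  then have "x * (real n * (1 - (1 - x) ^ (n - 1))) \<le> x * (real n * (1 - (1 - x) ^ n))"
    using Suc.prems by (intro mult_left_mono) auto
  then show ?case using Suc by (simp add: gap_Suc dgap_def algebra_simps)
qed (simp add: dgap_def)

text \<open>As a function of x, \<open>dgap n\<close> is concave and vanishes at 0, so its integral
  \<open>gap n x\<close> is at least half of \<open>x * dgap n x\<close>. The induction reduces this
  to (1 - x)^m (1 + m x) <= 1.\<close>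

lemma dgap_le_gap: "0 \<le> x \<Longrightarrow> x \<le> 1 \<Longrightarrow> x * dgap n x \<le> 2 * gap n x"
proof (induction n)
  case 0 then show ?case by (simp add: dgap_def)
next
  case (Suc n)
  show ?case
  proof (cases n)
    case 0 then show ?thesis by (simp add: dgap_def gap_def)
  next
    case (Suc m)
    have "(1 - x) ^ m * (1 + real m * x) \<le> (1 - x) ^ m * (1 + x) ^ m"
      using Suc.prems Bernoulli_inequality[of x m] by (intro mult_left_mono) auto
    also have "\<dots> = ((1 - x) * (1 + x)) ^ m" by (simp add: power_mult_distrib)
    also have "\<dots> \<le> 1"
      using Suc.prems mult_le_one[of x x] by (intro power_le_one) (auto simp: algebra_simps)
    finally have "(1 - x) ^ m * (1 + real m * x) \<le> 1" .
    then have "real m * (1 - (1 - x) ^ n) \<le> real n * (1 - (1 - x) ^ m)"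
      by (simp add: Suc algebra_simps)
    then have "x * (real m * (1 - (1 - x) ^ n)) \<le> x * (real n * (1 - (1 - x) ^ m))"
      using Suc.prems by (intro mult_left_mono) auto
    then show ?thesis using Suc.IH[OF Suc.prems] by (simp add: gap_Suc dgap_def Suc algebra_simps)
  qed
qed

section \<open>Expectations under a critical offspring law\<close>

definition gf :: "nat pmf \<Rightarrow> real \<Rightarrow> real" where
  "gf \<mu> s = measure_pmf.expectation \<mu> (\<lambda>n. s ^ n)"

definition mgap :: "nat pmf \<Rightarrow> real \<Rightarrow> real" where
  "mgap \<mu> x = measure_pmf.expectation \<mu> (\<lambda>n. gap n x)"

definition mdgap :: "nat pmf \<Rightarrow> real \<Rightarrow> real" where
  "mdgap \<mu> x = measure_pmf.expectation \<mu> (\<lambda>n. dgap n x)"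

locale critical =
  fixes \<mu> :: "nat pmf"
  assumes critical: "critical_offspring \<mu>"
begin

lemma mean_one: "has_bochner_integral (measure_pmf \<mu>) real 1"
proof (rule has_bochner_integral_nn_integral)
  have "(\<integral>\<^sup>+ x. ennreal (real x) \<partial>measure_pmf \<mu>) = (\<Sum>n. ennreal (real n * pmf \<mu> n))"
    by (simp add: nn_integral_measure_pmf nn_integral_count_space_nat ennreal_mult' mult.commute)
  also have "\<dots> = ennreal 1"
    using critical unfolding critical_offspring_def by (intro suminf_ennreal_eq) auto
  finally show "(\<integral>\<^sup>+ x. ennreal (real x) \<partial>measure_pmf \<mu>) = ennreal 1" .
qed auto

lemma integrable_real [simp]: "integrable (measure_pmf \<mu>) real"
  using mean_one by (rule integrable.intros)

lemma integrable_power [simp]: "0 \<le> (s::real) \<Longrightarrow> s \<le> 1 \<Longrightarrow> integrable (measure_pmf \<mu>) (\<lambda>n. s ^ n)"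
  by (intro measure_pmf.integrable_const_bound[where B=1] AE_I2) (auto intro!: power_le_one)

lemma integrable_gap [simp]: "0 \<le> x \<Longrightarrow> x \<le> 1 \<Longrightarrow> integrable (measure_pmf \<mu>) (\<lambda>n. gap n x)"
  unfolding gap_def by auto

lemma integrable_dgap [simp]: "0 \<le> x \<Longrightarrow> x \<le> 1 \<Longrightarrow> integrable (measure_pmf \<mu>) (\<lambda>n. dgap n x)"
  by (rule Bochner_Integration.integrable_bound[OF integrable_real])
     (auto simp: dgap_nonneg dgap_le)

lemma gf_eq: "0 \<le> x \<Longrightarrow> x \<le> 1 \<Longrightarrow> gf \<mu> (1 - x) = 1 - x + mgap \<mu> x"
  using mean_one by (simp add: gf_def mgap_def gap_def has_bochner_integral_iff)

lemma mgap_nonneg: "0 \<le> x \<Longrightarrow> x \<le> 1 \<Longrightarrow> 0 \<le> mgap \<mu> x"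
  unfolding mgap_def by (intro Bochner_Integration.integral_nonneg) (simp add: gap_nonneg)

lemma mgap_0 [simp]: "mgap \<mu> 0 = 0"
  by (simp add: mgap_def)

lemma mgap_mono: "0 \<le> x \<Longrightarrow> x \<le> y \<Longrightarrow> y \<le> 1 \<Longrightarrow> mgap \<mu> x \<le> mgap \<mu> y"
  unfolding mgap_def by (intro Bochner_Integration.integral_mono) (auto simp: gap_mono)

lemma mgap_double: "0 \<le> x \<Longrightarrow> x \<le> 1 / 2 \<Longrightarrow> mgap \<mu> (2 * x) \<le> 4 * mgap \<mu> x"
  unfolding mgap_def Bochner_Integration.integral_mult_right_zero[symmetric]
  by (intro Bochner_Integration.integral_mono) (auto simp: gap_double)

text \<open>With monotonicity this is a Lipschitz bound; the resulting continuity supports an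
  intermediate value argument in \<open>mgap_upper\<close>.\<close>

lemma mgap_diff_le:
  assumes "0 \<le> x" "x \<le> y" "y \<le> 1"
  shows "mgap \<mu> y - mgap \<mu> x \<le> y - x"
proof -
  have "mgap \<mu> y - mgap \<mu> x = measure_pmf.expectation \<mu> (\<lambda>n. gap n y - gap n x)"
    using assms by (simp add: mgap_def)
  also have "\<dots> \<le> measure_pmf.expectation \<mu> (\<lambda>n. real n * (y - x))"
    using assms by (intro Bochner_Integration.integral_mono) (auto simp: gap_diff_le)
  also have "\<dots> = y - x" using mean_one by (simp add: has_bochner_integral_iff)
  finally show ?thesis .
qed

lemma continuous_on_mgap: "continuous_on {0..1} (mgap \<mu>)"
proof (rule continuous_onI)
  fix x e :: real assume x: "x \<in> {0..1}" "0 < e"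
  have "dist (mgap \<mu> y) (mgap \<mu> x) \<le> dist y x" if "y \<in> {0..1}" for y
    using that x mgap_diff_le[of x y] mgap_diff_le[of y x] mgap_mono[of x y] mgap_mono[of y x]
    by (cases "x \<le> y") (auto simp: dist_real_def)
  then show "\<exists>d>0. \<forall>x'\<in>{0..1}. dist x' x < d \<longrightarrow> dist (mgap \<mu> x') (mgap \<mu> x) \<le> e"
    using x by (intro exI[of _ e]) (meson less_imp_le order_trans)
qed

lemma mdgap_nonneg: "0 \<le> x \<Longrightarrow> x \<le> 1 \<Longrightarrow> 0 \<le> mdgap \<mu> x"
  unfolding mdgap_def by (intro Bochner_Integration.integral_nonneg) (simp add: dgap_nonneg)

lemma mdgap_mono: "0 \<le> x \<Longrightarrow> x \<le> y \<Longrightarrow> y \<le> 1 \<Longrightarrow> mdgap \<mu> x \<le> mdgap \<mu> y"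
  unfolding mdgap_def by (intro Bochner_Integration.integral_mono) (auto simp: dgap_mono)

lemma mdgap_le_1: "0 \<le> x \<Longrightarrow> x \<le> 1 \<Longrightarrow> mdgap \<mu> x \<le> 1"
proof -
  assume "0 \<le> x" "x \<le> 1"
  then have "mdgap \<mu> x \<le> measure_pmf.expectation \<mu> real"
    unfolding mdgap_def by (intro Bochner_Integration.integral_mono) (auto simp: dgap_le)
  then show ?thesis using mean_one by (simp add: has_bochner_integral_iff)
qed

lemma mgap_le_mdgap: "0 \<le> x \<Longrightarrow> x \<le> 1 \<Longrightarrow> mgap \<mu> x \<le> x * mdgap \<mu> x"
  unfolding mgap_def mdgap_def Bochner_Integration.integral_mult_right_zero[symmetric]
  by (intro Bochner_Integration.integral_mono) (auto simp: gap_le_dgap)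

lemma mdgap_le_mgap: "0 \<le> x \<Longrightarrow> x \<le> 1 \<Longrightarrow> x * mdgap \<mu> x \<le> 2 * mgap \<mu> x"
  unfolding mgap_def mdgap_def Bochner_Integration.integral_mult_right_zero[symmetric]
  by (intro Bochner_Integration.integral_mono) (auto simp: dgap_le_gap)

lemma expectation_power_sum:
  assumes "0 \<le> s" "s \<le> 1"
  shows "integrable (PiM UNIV (\<lambda>_::nat. measure_pmf \<mu>)) (\<lambda>Z. s ^ (\<Sum>i=1..n. Z i))"
    and "(\<integral>Z. s ^ (\<Sum>i=1..n. Z i) \<partial>PiM UNIV (\<lambda>_::nat. measure_pmf \<mu>)) = gf \<mu> s ^ n"
proof -
  let ?M = "PiM UNIV (\<lambda>_::nat. measure_pmf \<mu>)"
  interpret product_prob_space "\<lambda>_::nat. measure_pmf \<mu>" UNIV ..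
  have [measurable]: "(\<lambda>Z. s ^ (\<Sum>i=1..n. Z i)) \<in> borel_measurable ?M" by measurable
  have comp: "(\<integral>\<^sup>+Z. ennreal (s ^ Z i) \<partial>?M) = ennreal (gf \<mu> s)" for i
  proof -
    have "(\<integral>\<^sup>+Z. ennreal (s ^ Z i) \<partial>?M) = (\<integral>\<^sup>+z. ennreal (s ^ z) \<partial>distr ?M (measure_pmf \<mu>) (\<lambda>Z. Z i))"
      by (subst nn_integral_distr) auto
    also have "\<dots> = ennreal (gf \<mu> s)"
      using assms by (subst PiM_component) (auto simp: gf_def intro!: nn_integral_eq_integral)
    finally show ?thesis .
  qed
  have gf0: "0 \<le> gf \<mu> s" unfolding gf_def using assms by (intro Bochner_Integration.integral_nonneg) auto
  have "(\<integral>\<^sup>+Z. ennreal (s ^ (\<Sum>i=1..n. Z i)) \<partial>?M) = (\<integral>\<^sup>+Z. (\<Prod>i=1..n. ennreal (s ^ Z i)) \<partial>?M)"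
    using assms by (simp add: power_sum prod_ennreal)
  also have "\<dots> = (\<Prod>i=1..n. \<integral>\<^sup>+Z. ennreal (s ^ Z i) \<partial>?M)"
    by (rule nn_integral_prod_blocks[where J="\<lambda>i. {i}"])
       (auto simp: disjoint_family_on_def measure_pmf.prob_space_axioms)
  also have "\<dots> = ennreal (gf \<mu> s ^ n)"
    using gf0 by (simp add: comp ennreal_power)
  finally have "has_bochner_integral ?M (\<lambda>Z. s ^ (\<Sum>i=1..n. Z i)) (gf \<mu> s ^ n)"
    using assms gf0 by (intro has_bochner_integral_nn_integral) auto
  then show "integrable ?M (\<lambda>Z. s ^ (\<Sum>i=1..n. Z i))" "(\<integral>Z. s ^ (\<Sum>i=1..n. Z i) \<partial>?M) = gf \<mu> s ^ n"
    by (auto simp: has_bochner_integral_iff)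
qed

end

text \<open>The Paley-Zygmund argument at half the mean: on the event Y is at most s/2 Y^2 + 1/(2
  s), off it at most m/2.\<close>

lemma second_moment_lower_bound:
  assumes M: "prob_space M" and Y: "integrable M Y" "integrable M (\<lambda>x. (Y x)\<^sup>2)" 
    and m: "m \<le> (\<integral>x. Y x \<partial>M)" "0 < m" and W: "(\<integral>x. (Y x)\<^sup>2 \<partial>M) \<le> W" "0 < W"
  shows "m\<^sup>2 / (4 * W) \<le> measure M {x \<in> space M. m / 2 < Y x}"
proof -
  interpret prob_space M by fact
  define p where "p = measure M {x \<in> space M. m / 2 < Y x}"
  \<comment> \<open>This s makes the second moment term s/2 * W equal to m/4, so that m/4 is left
    for the event.\<close>
  define s where "s = m / (2 * W)"
  have s: "0 < s" using m W by (simp add: s_def)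
  have [measurable]: "Y \<in> borel_measurable M" using Y by auto
  have "m \<le> (\<integral>x. Y x \<partial>M)" by fact
  also have "\<dots> \<le> (\<integral>x. m / 2 + (s / 2 * (Y x)\<^sup>2 + 1 / (2 * s) * indicator {x \<in> space M. m / 2 < Y x} x) \<partial>M)"
  proof (rule Bochner_Integration.integral_mono)
    fix x assume x: "x \<in> space M"
    show "Y x \<le> m / 2 + (s / 2 * (Y x)\<^sup>2 + 1 / (2 * s) * indicator {x \<in> space M. m / 2 < Y x} x)"
    proof (cases "m / 2 < Y x")
      case True
      have "0 \<le> (s * Y x - 1)\<^sup>2 / (2 * s)" using s by simp
      also have "\<dots> = s / 2 * (Y x)\<^sup>2 + 1 / (2 * s) - Y x"
        using s by (simp add: power2_eq_square field_simps)
      finally show ?thesis using True x m by simp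
    next
      case False
      moreover have "0 \<le> s * (Y x)\<^sup>2 / 2" using s by simp
      ultimately show ?thesis using m by simp
    qed
  qed (use Y in \<open>auto simp: less_top[symmetric]\<close>)
  also have "\<dots> = m / 2 + (s / 2 * (\<integral>x. (Y x)\<^sup>2 \<partial>M) + 1 / (2 * s) * p)"
    using Y by (simp add: p_def less_top[symmetric] prob_space)
  also have "\<dots> \<le> m / 2 + (s / 2 * W + 1 / (2 * s) * p)"
    using W s by (intro add_left_mono add_right_mono mult_left_mono) auto
  also have "\<dots> = m / 2 + m / 4 + p * W / m"
    using m W by (simp add: s_def field_simps)
  finally have "m / 4 \<le> p * W / m" by linarith
  then show ?thesis
    unfolding p_def[symmetric] using m(2) W(2) by (simp add: field_simps power2_eq_square)
qed

lemma ln_3_2_pos: "0 < ln (3 / 2 :: real)"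
  by simp

section \<open>Power bounds for \<open>mgap\<close> from the stable limit theorem\<close>

locale stable_critical = critical +
  fixes \<beta> c :: real and \<nu> :: "real measure"
  assumes beta: "1 < \<beta>" "\<beta> \<le> 2" and c: "0 < c"
    and nu: "stable_limit_law \<beta> \<nu>"
    and conv: "weak_conv_m (normalised_sum_law \<mu> \<beta> c) \<nu>"
begin

abbreviation "ZM \<equiv> PiM (UNIV :: nat set) (\<lambda>_. measure_pmf \<mu>)"

abbreviation deviation :: "nat \<Rightarrow> (nat \<Rightarrow> nat) \<Rightarrow> real" where
  "deviation n Z \<equiv> (real (\<Sum>i=1..n. Z i) - real n) / (c * real n powr (1 / \<beta>))"

sublocale Z: product_prob_space "\<lambda>_::nat. measure_pmf \<mu>" UNIV ..

lemma real_distribution_law: "real_distribution (normalised_sum_law \<mu> \<beta> c n)"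
  unfolding normalised_sum_law_def real_distribution_def real_distribution_axioms_def
  by (auto intro!: Z.P.prob_space_distr)

lemma real_distribution_nu: "real_distribution \<nu>"
  using nu by (simp add: stable_limit_law_def)

lemma integral_law:
  assumes [measurable]: "u \<in> borel_measurable borel"
  shows "(\<integral>x. u x \<partial>normalised_sum_law \<mu> \<beta> c n) =
    (\<integral>Z. u (deviation n Z) \<partial>ZM :: real)"
  unfolding normalised_sum_law_def by (subst integral_distr) auto

lemma conv_integral:
  fixes u :: "real \<Rightarrow> real"
  assumes "\<And>x. isCont u x" "\<And>x. \<bar>u x\<bar> \<le> B"
  shows "(\<lambda>n. \<integral>x. u x \<partial>normalised_sum_law \<mu> \<beta> c n) \<longlonglongrightarrow> (\<integral>x. u x \<partial>\<nu>)"
  using weak_conv_imp_integral_bdd_continuous_conv[OF real_distribution_law real_distribution_nu conv, of u B]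
    assms by simp

text \<open>With l = 1/(c n^(1/\<beta>)), the normalised sum has Laplace transform (1 + exp l *
  mgap)^n at 1, which is at most exp (n * exp l * mgap). The limit law has transform e at 1; the
  smaller value 3/2 leaves room for a truncation.\<close>

lemma mgap_lower_sequence:
  "eventually (\<lambda>n. ln (3 / 2) \<le> exp 1 * real n * mgap \<mu> (1 - exp (- 1 / (c * real n powr (1 / \<beta>))))) sequentially"
proof -
  interpret nu: real_distribution \<nu> by (rule real_distribution_nu)
  have I: "has_bochner_integral \<nu> (\<lambda>x. exp (- x)) (exp 1)"
    using nu by (auto simp: stable_limit_law_def dest: spec[of _ 1])
  \<comment> \<open>Weak convergence tests only bounded continuous functions, so exp (- x) is cut
    off at B; by dominated convergence some B keeps the integral above 3/2.\<close>
  define u where "u B x = min (exp (- x)) B" for B x :: real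
  have "(\<lambda>B. \<integral>x. u (real B) x \<partial>\<nu>) \<longlonglongrightarrow> (\<integral>x. exp (- x) \<partial>\<nu>)"
  proof (rule integral_dominated_convergence[where w="\<lambda>x. exp (- x)"])
    show "AE x in \<nu>. (\<lambda>B. u (real B) x) \<longlonglongrightarrow> exp (- x)"
    proof (rule AE_I2)
      fix x
      have "eventually (\<lambda>B. u (real B) x = exp (- x)) sequentially"
        using eventually_ge_at_top[of "nat \<lceil>exp (- x)\<rceil>"]
        by eventually_elim (simp add: u_def min_def nat_le_iff ceiling_le_iff)
      then show "(\<lambda>B. u (real B) x) \<longlonglongrightarrow> exp (- x)" by (rule tendsto_eventually)
    qed
    show "integrable \<nu> (\<lambda>x. exp (- x))" using I by (auto simp: has_bochner_integral_iff)
  qed (auto simp: u_def)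
  moreover have "3 / 2 < (\<integral>x. exp (- x) \<partial>\<nu>)"
    using I exp_ge_add_one_self[of "1::real"] by (simp add: has_bochner_integral_iff)
  ultimately have "eventually (\<lambda>B. 3 / 2 < (\<integral>x. u (real B) x \<partial>\<nu>)) sequentially"
    by (rule order_tendstoD)
  then obtain B where B: "3 / 2 < (\<integral>x. u (real B) x \<partial>\<nu>)"
    by (auto simp: eventually_sequentially)
  have bnd: "\<bar>u (real B) x\<bar> \<le> real B" for x
    by (simp add: u_def min_def)
  have cont: "isCont (u (real B)) x" for x
    unfolding u_def by (intro continuous_intros)
  have "(\<lambda>n. \<integral>x. u (real B) x \<partial>normalised_sum_law \<mu> \<beta> c n) \<longlonglongrightarrow> (\<integral>x. u (real B) x \<partial>\<nu>)"
    by (rule conv_integral[where B=B]) (use cont bnd in auto)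
  from order_tendstoD(1)[OF this B]
  have "eventually (\<lambda>n. 3 / 2 < (\<integral>x. u (real B) x \<partial>normalised_sum_law \<mu> \<beta> c n)) sequentially" .
  moreover have "eventually (\<lambda>n. 1 \<le> c * real n powr (1 / \<beta>)) sequentially"
    using c beta by real_asymp
  ultimately show ?thesis
    using eventually_gt_at_top[of 0]
  proof eventually_elim
    case (elim n)
    define l where "l = 1 / (c * real n powr (1 / \<beta>))"
    define x where "x = 1 - exp (- l)"
    have l: "0 < l" "l \<le> 1" using elim c by (auto simp: l_def)
    have x: "0 \<le> x" "x \<le> 1" using l by (auto simp: x_def)
    have int: "integrable ZM (\<lambda>Z. exp (- l) ^ (\<Sum>i=1..n. Z i))"
      using l by (intro expectation_power_sum) auto
    have [measurable]: "u (real B) \<in> borel_measurable borel" unfolding u_def by measurable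
    have eq: "exp (- (deviation n Z))
      = exp (real n * l) * exp (- l) ^ (\<Sum>i=1..n. Z i)" for Z :: "nat \<Rightarrow> nat"
      by (simp add: exp_of_nat_mult[symmetric] exp_add[symmetric] l_def diff_divide_distrib minus_divide_left[symmetric] del: of_nat_sum)
    have "3 / 2 < (\<integral>x. u (real B) x \<partial>normalised_sum_law \<mu> \<beta> c n)" by fact
    also have "\<dots> \<le> (\<integral>Z. exp (real n * l) * exp (- l) ^ (\<Sum>i=1..n. Z i) \<partial>ZM)"
      unfolding integral_law[OF \<open>u (real B) \<in> borel_measurable borel\<close>]
    proof (rule Bochner_Integration.integral_mono)
      show "integrable ZM (\<lambda>Z. u (real B) (deviation n Z))"
        by (rule Z.P.integrable_const_bound[where B=B], rule AE_I2)
           (use bnd in \<open>auto simp del: of_nat_sum\<close>)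
      show "integrable ZM (\<lambda>Z. exp (real n * l) * exp (- l) ^ (\<Sum>i=1..n. Z i))"
        using int by (rule integrable_mult_right)
      show "u (real B) (deviation n Z)
          \<le> exp (real n * l) * exp (- l) ^ (\<Sum>i=1..n. Z i)" for Z
        unfolding eq[symmetric] u_def by (rule min.cobounded1)
    qed
    also have "\<dots> = exp (real n * l) * gf \<mu> (exp (- l)) ^ n"
      using l expectation_power_sum(2)[of "exp (- l)" n] by simp
    also have "gf \<mu> (exp (- l)) = exp (- l) + mgap \<mu> x"
      using gf_eq[OF x] by (simp add: x_def)
    also have "exp (real n * l) * (exp (- l) + mgap \<mu> x) ^ n = (1 + exp l * mgap \<mu> x) ^ n"
      by (simp add: exp_of_nat_mult power_mult_distrib[symmetric] distrib_left mult_exp_exp)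
    also have "\<dots> \<le> exp (exp l * mgap \<mu> x) ^ n"
      using mgap_nonneg[OF x] by (intro power_mono) (auto intro: add_nonneg_nonneg)
    also have "\<dots> = exp (real n * (exp l * mgap \<mu> x))" by (simp add: exp_of_nat_mult)
    finally have "ln (3 / 2) \<le> real n * (exp l * mgap \<mu> x)"
      by (metis exp_ln exp_less_cancel_iff less_eq_real_def zero_less_divide_iff zero_less_numeral)
    also have "\<dots> \<le> real n * (exp 1 * mgap \<mu> x)"
      using mgap_nonneg[OF x] l by (intro mult_left_mono mult_right_mono) auto
    finally show ?case by (simp add: x_def l_def algebra_simps)
  qed
qed

text \<open>The bound along the sequence passes to all small x by monotonicity: n is taken just
  large enough for the point 1 - exp (- l) that belongs to n to lie below x.\<close>

lemma mgap_lower: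
  obtains c1 x0 where "0 < c1" "0 < x0" "x0 \<le> 1" "\<And>x. 0 \<le> x \<Longrightarrow> x \<le> x0 \<Longrightarrow> c1 * x powr \<beta> \<le> mgap \<mu> x"
proof -
  obtain N where N: "\<And>n. n \<ge> N \<Longrightarrow> ln (3 / 2) \<le> exp 1 * real n * mgap \<mu> (1 - exp (- 1 / (c * real n powr (1 / \<beta>))))"
    using mgap_lower_sequence by (auto simp: eventually_sequentially)
  define x0 where "x0 = min 1 (1 / (c * (real N + 1) powr (1 / \<beta>)))"
  define c1 where "c1 = ln (3 / 2) / (2 * exp 1) * c powr \<beta>"
  have x0: "0 < x0" "x0 \<le> 1" using c by (auto simp: x0_def)
  have "c1 * x powr \<beta> \<le> mgap \<mu> x" if "0 < x" "x \<le> x0" for x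
  proof -
    \<comment> \<open>The ideal real value of n, which solves 1/(c s^(1/\<beta>)) = x. Rounding up
      keeps l <= x; x0 is so small that s >= N + 1, hence rounding costs at most a factor 2.\<close>
    define s where "s = (1 / (c * x)) powr \<beta>"
    define n where "n = nat \<lceil>s\<rceil>"
    have "(real N + 1) powr (1 / \<beta>) * (c * x) \<le> 1"
    proof -
      have "x \<le> 1 / (c * (real N + 1) powr (1 / \<beta>))" using that by (simp add: x0_def)
      then have "x * (c * (real N + 1) powr (1 / \<beta>)) \<le> 1"
        using c by (subst (asm) pos_le_divide_eq) auto
      then show ?thesis by (simp add: mult_ac)
    qed
    then have "(real N + 1) powr (1 / \<beta>) \<le> 1 / (c * x)"
      using that c by (subst pos_le_divide_eq) auto
    then have "((real N + 1) powr (1 / \<beta>)) powr \<beta> \<le> s"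
      unfolding s_def using beta by (intro powr_mono2) auto
    then have s: "real N + 1 \<le> s" using beta by (simp add: powr_powr)
    have n: "s \<le> real n" "real n \<le> 2 * s" "n \<ge> N" "0 < n"
      using s unfolding n_def by linarith+
    define l where "l = 1 / (c * real n powr (1 / \<beta>))"
    have "1 / (c * x) = s powr (1 / \<beta>)" using that c beta by (simp add: s_def powr_powr)
    also have "\<dots> \<le> real n powr (1 / \<beta>)" using n s beta by (intro powr_mono2) auto
    finally have "1 / real n powr (1 / \<beta>) \<le> c * x"
      using that c n by (simp add: field_simps)
    then have l: "0 < l" "l \<le> x" using c n by (auto simp: l_def field_simps)
    have "1 - exp (- l) \<le> l" using exp_ge_add_one_self[of "-l"] by simp
    then have "mgap \<mu> (1 - exp (- l)) \<le> mgap \<mu> x"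
      using l that x0 by (intro mgap_mono) auto
    moreover have "ln (3 / 2) \<le> exp 1 * real n * mgap \<mu> (1 - exp (- l))"
      using N[OF n(3)] by (simp add: l_def)
    ultimately have "ln (3 / 2) \<le> exp 1 * real n * mgap \<mu> x"
      using n by (smt (verit, best) exp_gt_zero mult_left_mono mult_nonneg_nonneg of_nat_0_le_iff)
    also have "\<dots> \<le> exp 1 * (2 * s) * mgap \<mu> x"
      using n mgap_nonneg[of x] that x0 by (intro mult_right_mono mult_left_mono) auto
    finally have "ln (3 / 2) / (2 * exp 1) / s \<le> mgap \<mu> x"
      using s by (simp add: field_simps)
    moreover have s_inv: "1 / s = c powr \<beta> * x powr \<beta>"
      using that c by (simp add: s_def powr_divide powr_mult)
    have "c1 * x powr \<beta> = ln (3 / 2) / (2 * exp 1) * (1 / s)"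
      unfolding s_inv c1_def by (simp only: mult.assoc)
    ultimately show ?thesis by simp
  qed
  moreover have "c1 * 0 powr \<beta> \<le> mgap \<mu> 0" by simp
  ultimately show ?thesis using x0 c ln_3_2_pos
    by (intro that[of c1 x0]) (auto simp: c1_def le_less)
qed

lemma lower_tail_tight:
  assumes "0 < e"
  obtains A where "0 < A" "eventually (\<lambda>n. measure ZM {Z \<in> space ZM.
    deviation n Z \<le> - A} < e) sequentially"
proof -
  interpret nu: real_distribution \<nu> by (rule real_distribution_nu)
  \<comment> \<open>A continuous cutoff that vanishes on [- A, \<infinity>) and equals 1 below - A -
    1; hence the level A + 1 in the end.\<close>
  define u where "u A x = max 0 (min 1 (- x - A))" for A x :: real
  have "(\<lambda>A. \<integral>x. u (real A) x \<partial>\<nu>) \<longlonglongrightarrow> (\<integral>x. 0 \<partial>\<nu>)"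
  proof (rule integral_dominated_convergence[where w="\<lambda>x. 1"])
    show "AE x in \<nu>. (\<lambda>A. u (real A) x) \<longlonglongrightarrow> 0"
    proof (rule AE_I2)
      fix x
      have "eventually (\<lambda>A. u (real A) x = 0) sequentially"
        using eventually_ge_at_top[of "nat \<lceil>- x\<rceil>"]
        by eventually_elim (auto simp: u_def nat_le_iff ceiling_le_iff)
      then show "(\<lambda>A. u (real A) x) \<longlonglongrightarrow> 0" by (rule tendsto_eventually)
    qed
  qed (auto simp: u_def)
  then have "eventually (\<lambda>A. (\<integral>x. u (real A) x \<partial>\<nu>) < e) sequentially"
    using assms by (intro order_tendstoD) auto
  then obtain A where A: "(\<integral>x. u (real A) x \<partial>\<nu>) < e"
    by (auto simp: eventually_sequentially)
  have "isCont (u (real A)) x" for x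
    unfolding u_def by (intro continuous_intros)
  then have "(\<lambda>n. \<integral>x. u (real A) x \<partial>normalised_sum_law \<mu> \<beta> c n) \<longlonglongrightarrow> (\<integral>x. u (real A) x \<partial>\<nu>)"
    by (rule conv_integral[where B=1]) (auto simp: u_def)
  from order_tendstoD(2)[OF this A]
  have "eventually (\<lambda>n. measure ZM {Z \<in> space ZM.
    deviation n Z \<le> - (real A + 1)} < e) sequentially"
  proof eventually_elim
    case (elim n)
    let ?S = "\<lambda>Z. deviation n Z"
    have [measurable]: "u (real A) \<in> borel_measurable borel" unfolding u_def by measurable
    have "measure ZM {Z \<in> space ZM. ?S Z \<le> - (real A + 1)} = (\<integral>Z. indicator {Z \<in> space ZM. ?S Z \<le> - (real A + 1)} Z \<partial>ZM)"
      by simp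
    also have "\<dots> \<le> (\<integral>Z. u (real A) (?S Z) \<partial>ZM)"
    proof (rule Bochner_Integration.integral_mono)
      show "integrable ZM (\<lambda>Z. u (real A) (?S Z))"
        by (rule Z.P.integrable_const_bound[where B=1], rule AE_I2) (auto simp: u_def)
      show "integrable ZM (indicat_real {Z \<in> space ZM. ?S Z \<le> - (real A + 1)})"
        by (rule integrable_real_indicator) (auto simp: less_top[symmetric] Z.P.emeasure_eq_measure)
    qed (auto simp: u_def indicator_def simp del: of_nat_sum)
    also have "\<dots> < e" using elim integral_law[of "u (real A)" n] by simp
    finally show ?case .
  qed
  then show ?thesis by (intro that[of "real A + 1"]) auto
qed

text \<open>If \<open>n * mgap \<mu> x = 2\<close> with \<open>x\<close> much smaller than \<open>n\<^bsup>-1/\<beta>\<^esup>\<close>, then the second moment method, applied to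
  \<open>(1 - x)\<close> to the power \<open>S\<^sub>n - n\<close>, gives \<open>S\<^sub>n - n < - 1 / (5 x)\<close> a fixed probability, which is impossible
  by tightness.\<close>

lemma mgap_neq_two:
  assumes "0 < n" "0 \<le> x" "x \<le> 1 / 2" and A: "0 < A"
    and tail: "measure ZM {Z \<in> space ZM.
      deviation n Z \<le> - A} < exp (- 32)"
    and x: "x * real n powr (1 / \<beta>) \<le> ln (3 / 2) / (2 * A * c)"
  shows "real n * mgap \<mu> x \<noteq> 2"
proof
  assume eq: "real n * mgap \<mu> x = 2"
  then have "x \<noteq> 0" by auto
  then have x0: "0 < x" using assms by simp
  define S where "S Z = (\<Sum>i=1..n. Z i)" for Z :: "nat \<Rightarrow> nat"
  \<comment> \<open>Y is (1 - x)^(S - n), which is large when S falls well below n. By Bernoulli its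
    mean is at least 1 + n * mgap = 3.\<close>
  define Y where "Y Z = (1 - x) ^ S Z / (1 - x) ^ n" for Z
  have Ysq: "(Y Z)\<^sup>2 = ((1 - x)\<^sup>2) ^ S Z / ((1 - x)\<^sup>2) ^ n" for Z
    by (simp add: Y_def power_divide power_mult[symmetric] mult.commute)
  have x2: "0 \<le> (1 - x)\<^sup>2" "(1 - x)\<^sup>2 \<le> 1" using assms by (auto intro!: power_le_one)
  have "integrable ZM Y" "integrable ZM (\<lambda>Z. (Y Z)\<^sup>2)"
    unfolding Ysq unfolding Y_def S_def using assms x2
    by (intro integrable_divide expectation_power_sum; simp)+
  moreover have "3 \<le> (\<integral>Z. Y Z \<partial>ZM)"
  proof -
    have "(\<integral>Z. Y Z \<partial>ZM) = (gf \<mu> (1 - x) / (1 - x)) ^ n"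
      unfolding Y_def S_def using expectation_power_sum(2)[of "1 - x" n] assms by (simp add: power_divide)
    also have "gf \<mu> (1 - x) / (1 - x) = 1 + mgap \<mu> x / (1 - x)"
      using gf_eq[of x] assms by (simp add: add_divide_distrib)
    also have "(1 + mgap \<mu> x) ^ n \<le> (1 + mgap \<mu> x / (1 - x)) ^ n"
    proof (intro power_mono add_left_mono)
      have "mgap \<mu> x * (1 - x) \<le> mgap \<mu> x * 1"
        using mgap_nonneg[of x] assms by (intro mult_left_mono) auto
      then show "mgap \<mu> x \<le> mgap \<mu> x / (1 - x)" using assms by (subst pos_le_divide_eq) auto
    qed (use mgap_nonneg[of x] assms in auto)
    moreover have "1 + real n * mgap \<mu> x \<le> (1 + mgap \<mu> x) ^ n"
      using mgap_nonneg[of x] assms by (intro Bernoulli_inequality) auto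
    ultimately show ?thesis using eq by linarith
  qed
  \<comment> \<open>Squaring moves the argument of the gap from x to 2 x - x^2. Doubling costs a
    factor 4 and the division by (1 - x)^2 >= 1/4 another 4, which gives 16 * n * mgap = 32 in the
    exponent.\<close>
  moreover have "(\<integral>Z. (Y Z)\<^sup>2 \<partial>ZM) \<le> exp 32"
  proof -
    have "(\<integral>Z. (Y Z)\<^sup>2 \<partial>ZM) = (gf \<mu> ((1 - x)\<^sup>2) / (1 - x)\<^sup>2) ^ n"
      unfolding Ysq S_def using expectation_power_sum(2)[of "(1 - x)\<^sup>2" n] x2 by (simp add: power_divide)
    also have "\<dots> \<le> (1 + 16 * mgap \<mu> x) ^ n"
    proof (rule power_mono)
      define y where "y = 2 * x - x\<^sup>2"
      have y: "(1 - x)\<^sup>2 = 1 - y" by (simp add: y_def power2_eq_square algebra_simps)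
      have yb: "0 \<le> y" "y \<le> 1" using x2 by (auto simp: y)
      have "gf \<mu> ((1 - x)\<^sup>2) = (1 - x)\<^sup>2 + mgap \<mu> y" using gf_eq[OF yb] by (simp add: y)
      also have "mgap \<mu> y \<le> mgap \<mu> (2 * x)" using yb assms by (intro mgap_mono) (auto simp: y_def)
      also have "\<dots> \<le> 4 * mgap \<mu> x" using assms by (intro mgap_double) auto
      also have "\<dots> \<le> 16 * mgap \<mu> x * (1 - x)\<^sup>2"
      proof -
        have "(1 / 2)\<^sup>2 \<le> (1 - x)\<^sup>2" using assms by (intro power_mono) auto
        then have "16 * mgap \<mu> x * (1 / 2)\<^sup>2 \<le> 16 * mgap \<mu> x * (1 - x)\<^sup>2"
          using mgap_nonneg[of x] assms by (intro mult_left_mono) auto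
        then show ?thesis by (simp add: power2_eq_square)
      qed
      finally have "gf \<mu> ((1 - x)\<^sup>2) \<le> (1 + 16 * mgap \<mu> x) * (1 - x)\<^sup>2" by (simp add: algebra_simps)
      then show "gf \<mu> ((1 - x)\<^sup>2) / (1 - x)\<^sup>2 \<le> 1 + 16 * mgap \<mu> x"
        using assms by (subst pos_divide_le_eq) auto
      show "0 \<le> gf \<mu> ((1 - x)\<^sup>2) / (1 - x)\<^sup>2"
        unfolding gf_def by (intro divide_nonneg_nonneg Bochner_Integration.integral_nonneg) auto
    qed
    also have "\<dots> \<le> exp (16 * mgap \<mu> x) ^ n"
      using mgap_nonneg[of x] assms by (intro power_mono exp_ge_add_one_self) auto
    also have "\<dots> = exp (16 * (real n * mgap \<mu> x))" by (simp add: exp_of_nat_mult[symmetric] mult_ac)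
    also have "\<dots> = exp 32" by (simp add: eq)
    finally show ?thesis .
  qed
  \<comment> \<open>The constant 9/4 exceeds 1, so this probability is larger than the exp (- 32)
    allowed by \<open>tail\<close>, while Y > 3/2 forces a deviation of at most - A.\<close>
  ultimately have "3\<^sup>2 / (4 * exp 32) \<le> measure ZM {Z \<in> space ZM. 3 / 2 < Y Z}"
    by (intro second_moment_lower_bound Z.P.prob_space_axioms) auto
  also have "\<dots> \<le> measure ZM {Z \<in> space ZM. deviation n Z \<le> - A}"
  proof (rule Z.P.finite_measure_mono, safe)
    fix Z assume "3 / 2 < Y Z"
    then have "ln (3 / 2) < ln (Y Z)" by (subst ln_less_cancel_iff) auto
    also have "ln (Y Z) = (real n - real (S Z)) * (- ln (1 - x))"
      using assms by (simp add: Y_def ln_div ln_realpow algebra_simps)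
    finally have *: "ln (3 / 2) < (real n - real (S Z)) * (- ln (1 - x))" .
    have l: "0 < - ln (1 - x)" using x0 assms by simp
    have "- ln (1 - x) \<le> 2 * x"
    proof -
      have "1 - x \<ge> exp (- (2 * x))"
      proof -
        have "(1 - x) * exp (2 * x) \<ge> (1 - x) * (1 + 2 * x)"
          using assms exp_ge_add_one_self[of "2 * x"] by (intro mult_left_mono) auto
        moreover have "(1 - x) * (1 + 2 * x) \<ge> 1"
          using assms mult_left_mono[of x "1/2" x] by (simp add: algebra_simps)
        ultimately show ?thesis by (simp add: exp_minus field_simps)
      qed
      then show ?thesis using assms ln_ge_iff[of "1 - x" "- (2 * x)"] by simp
    qed
    moreover have pos: "0 < real n - real (S Z)"
      using * l ln_3_2_pos by (smt (verit) mult_nonpos_nonneg)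
    ultimately have "(real n - real (S Z)) * (- ln (1 - x)) \<le> (real n - real (S Z)) * (2 * x)"
      by (intro mult_left_mono) auto
    then have **: "ln (3 / 2) \<le> 2 * x * (real n - real (S Z))" using * by (simp add: mult_ac)
    have np: "0 < real n powr (1 / \<beta>)" using assms by simp
    have "2 * x * (A * c * real n powr (1 / \<beta>)) \<le> ln (3 / 2)"
      using x A c by (simp add: field_simps)
    then have "2 * x * (A * c * real n powr (1 / \<beta>)) \<le> 2 * x * (real n - real (S Z))" using ** by linarith
    then have "A * c * real n powr (1 / \<beta>) \<le> real n - real (S Z)" using x0 by simp
    then show "deviation n Z \<le> - A"
      using np c unfolding S_def by (subst pos_divide_le_eq) (auto simp: algebra_simps)
  qed measurable
  finally have "3\<^sup>2 / (4 * exp 32) < exp (- 32 :: real)" using tail by simp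
  then show False by (simp add: exp_minus field_simps)
qed

text \<open>The function n * mgap starts at 0 and, by \<open>mgap_neq_two\<close>, never takes the
  value 2 in the range x n^(1/\<beta>) <= h; by continuity it stays below 2 there. Taking n nearly
  as large as the range allows gives the power bound.\<close>

lemma mgap_upper:
  obtains c2 x0 where "0 < c2" "0 < x0" "x0 \<le> 1" "\<And>x. 0 \<le> x \<Longrightarrow> x \<le> x0 \<Longrightarrow> mgap \<mu> x \<le> c2 * x powr \<beta>"
proof -
  obtain A where A: "0 < A" and ev: "eventually (\<lambda>n. measure ZM {Z \<in> space ZM.
    deviation n Z \<le> - A} < exp (- 32)) sequentially"
    by (rule lower_tail_tight[of "exp (- 32)"]) auto
  obtain N where N: "\<And>n. n \<ge> N \<Longrightarrow> measure ZM {Z \<in> space ZM.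
    deviation n Z \<le> - A} < exp (- 32)"
    using ev by (auto simp: eventually_sequentially)
  define h where "h = ln (3 / 2) / (2 * A * c)"
  have h: "0 < h" using A c by (simp add: h_def)
  have small: "real n * mgap \<mu> x < 2"
    if n: "n \<ge> N" "0 < n" and x: "0 \<le> x" "x \<le> 1 / 2" "x * real n powr (1 / \<beta>) \<le> h" for n x
  proof (rule ccontr)
    assume "\<not> ?thesis"
    moreover have "continuous_on {0..x} (\<lambda>y. real n * mgap \<mu> y)"
      using x by (intro continuous_intros continuous_on_subset[OF continuous_on_mgap]) auto
    ultimately obtain y where y: "0 \<le> y" "y \<le> x" "real n * mgap \<mu> y = 2"
      using IVT'[of "\<lambda>y. real n * mgap \<mu> y" 0 2 x] x by auto
    have "y * real n powr (1 / \<beta>) \<le> x * real n powr (1 / \<beta>)" using y by (intro mult_right_mono) auto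
    then show False
      using mgap_neq_two[OF n(2) y(1) _ A N[OF n(1)]] x y by (auto simp: h_def)
  qed
  define x0 where "x0 = min (1 / 2) (h / (real N + 1) powr (1 / \<beta>))"
  have x0: "0 < x0" "x0 \<le> 1 / 2" using h unfolding x0_def by (simp, intro min.cobounded1)
  have "mgap \<mu> x \<le> 4 / h powr \<beta> * x powr \<beta>" if "0 < x" "x \<le> x0" for x
  proof -
    \<comment> \<open>Here n is s rounded down, because x n^(1/\<beta>) must not exceed h; s >= N +
      1 again limits the loss to a factor 2.\<close>
    define s where "s = (h / x) powr \<beta>"
    define n where "n = nat \<lfloor>s\<rfloor>"
    have "x \<le> h / (real N + 1) powr (1 / \<beta>)" using that by (simp add: x0_def)
    then have "(real N + 1) powr (1 / \<beta>) \<le> h / x" using that by (simp add: field_simps)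
    then have "((real N + 1) powr (1 / \<beta>)) powr \<beta> \<le> s"
      unfolding s_def using beta by (intro powr_mono2) auto
    then have s: "real N + 1 \<le> s" using beta by (simp add: powr_powr)
    have rn: "real n = of_int \<lfloor>s\<rfloor>" using s by (simp add: n_def)
    have n: "real n \<le> s" "s \<le> 2 * real n" "n \<ge> N" "0 < n"
    proof -
      have "int N + 1 \<le> \<lfloor>s\<rfloor>" using s by (simp add: le_floor_iff)
      then have "real_of_int (int N + 1) \<le> real n" unfolding rn of_int_le_iff .
      then have "real N + 1 \<le> real n" by simp
      moreover have "real n \<le> s" "s < real n + 1" unfolding rn by linarith+
      ultimately show "real n \<le> s" "s \<le> 2 * real n" "n \<ge> N" "0 < n" by linarith+
    qed
    have "real n powr (1 / \<beta>) \<le> s powr (1 / \<beta>)" using n beta by (intro powr_mono2) auto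
    also have "\<dots> = h / x" using that h beta by (simp add: s_def powr_powr)
    finally have "x * real n powr (1 / \<beta>) \<le> h" using that by (simp add: field_simps)
    then have "real n * mgap \<mu> x < 2" using n that x0 by (intro small) auto
    moreover have "s * mgap \<mu> x \<le> 2 * real n * mgap \<mu> x"
      using n mgap_nonneg[of x] that x0 by (intro mult_right_mono) auto
    ultimately have "s * mgap \<mu> x \<le> 4" by linarith
    then have "mgap \<mu> x \<le> 4 / s" using s by (simp add: field_simps)
    also have "\<dots> = 4 / h powr \<beta> * x powr \<beta>" using that h by (simp add: s_def powr_divide)
    finally show ?thesis .
  qed
  then show ?thesis using x0 h by (intro that[of "4 / h powr \<beta>" x0]) (auto simp: le_less)
qed

end

section \<open>Volumes of balls in the tree\<close>

text \<open>The flag says whether \<open>v\<close> counts as special, irrespective of its actual status in the tree.\<close>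
primrec vol :: "marks \<Rightarrow> bool \<Rightarrow> nat \<Rightarrow> label \<Rightarrow> nat" where
  "vol \<omega> b 0 v = 1"
| "vol \<omega> b (Suc m) v =
     1 + (\<Sum>i<(if b then fst (snd (\<omega> v)) else fst (\<omega> v)). vol \<omega> (b \<and> i = snd (snd (\<omega> v))) m (i # v))"

definition tree_ball :: "marks \<Rightarrow> nat \<Rightarrow> label set" where
  "tree_ball \<omega> R = {v \<in> kesten_tree \<omega>. length v \<le> R}"

abbreviation volume :: "marks \<Rightarrow> nat \<Rightarrow> real" where
  "volume \<omega> R \<equiv> real (card (tree_ball \<omega> R))"

lemma in_tree_appendD: "in_tree \<omega> (u @ v) \<Longrightarrow> in_tree \<omega> v"
  by (induction u) auto

lemma vol_eq_card:
  "in_tree \<omega> v \<Longrightarrow> finite {w. in_tree \<omega> w \<and> (\<exists>u. w = u @ v \<and> length u \<le> m)} \<and>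
     card {w. in_tree \<omega> w \<and> (\<exists>u. w = u @ v \<and> length u \<le> m)} = vol \<omega> (special \<omega> v) m v"
proof (induction m arbitrary: v)
  case 0
  then have "{w. in_tree \<omega> w \<and> (\<exists>u. w = u @ v \<and> length u \<le> 0)} = {v}" by auto
  then show ?case by simp
next
  case (Suc m)
  let ?D = "\<lambda>m v. {w. in_tree \<omega> w \<and> (\<exists>u. w = u @ v \<and> length u \<le> m)}"
  have eq: "?D (Suc m) v = insert v (\<Union>i<num_children \<omega> v. ?D m (i # v))"
  proof (intro set_eqI iffI)
    fix w assume "w \<in> ?D (Suc m) v"
    then obtain u where u: "in_tree \<omega> w" "w = u @ v" "length u \<le> Suc m" by auto
    \<comment> \<open>Labels are read from right to left, so the step from v to its child is the
      last letter of u.\<close>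
    show "w \<in> insert v (\<Union>i<num_children \<omega> v. ?D m (i # v))"
    proof (cases u rule: rev_cases)
      case Nil then show ?thesis using u by simp
    next
      case (snoc u' i)
      then have w: "w = u' @ i # v" using u by simp
      then have "in_tree \<omega> (i # v)" using u in_tree_appendD by blast
      then show ?thesis using u snoc w by auto
    qed
  next
    fix w assume "w \<in> insert v (\<Union>i<num_children \<omega> v. ?D m (i # v))"
    then show "w \<in> ?D (Suc m) v"
    proof
      assume "w \<in> (\<Union>i<num_children \<omega> v. ?D m (i # v))"
      then obtain i u where "in_tree \<omega> w" "w = u @ i # v" "length u \<le> m" by auto
      then show ?thesis by (auto intro!: exI[of _ "u @ [i]"])
    qed (use Suc.prems in auto)
  qed
  have ch: "in_tree \<omega> (i # v)" if "i < num_children \<omega> v" for i using Suc.prems that by simp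
  have fin: "finite (?D m (i # v))" "card (?D m (i # v)) = vol \<omega> (special \<omega> (i # v)) m (i # v)"
    if "i < num_children \<omega> v" for i
    using Suc.IH[OF ch[OF that]] by blast+
  have "card (\<Union>i\<in>{..<num_children \<omega> v}. ?D m (i # v)) = (\<Sum>i\<in>{..<num_children \<omega> v}. card (?D m (i # v)))"
    using fin by (intro card_UN_disjoint) auto
  also have "\<dots> = (\<Sum>i<num_children \<omega> v. vol \<omega> (special \<omega> v \<and> i = snd (snd (\<omega> v))) m (i # v))"
    using fin by (intro sum.cong) auto
  finally have "card (\<Union>i<num_children \<omega> v. ?D m (i # v)) = \<dots>" .
  moreover have "v \<notin> (\<Union>i<num_children \<omega> v. ?D m (i # v))" by auto
  moreover have "finite (\<Union>i<num_children \<omega> v. ?D m (i # v))" using fin by auto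
  ultimately show ?case unfolding eq by (simp add: num_children_def)
qed

lemma finite_tree_ball: "finite (tree_ball \<omega> R)"
  and card_tree_ball: "card (tree_ball \<omega> R) = vol \<omega> True R []"
  using vol_eq_card[of \<omega> "[]" R] by (simp_all add: tree_ball_def kesten_tree_def)

text \<open>Subtrees of distinct children read disjoint sets of marks; this is where their
  independence comes from.\<close>

lemma vol_cong: "(\<And>u. \<omega> (u @ v) = \<omega>' (u @ v)) \<Longrightarrow> vol \<omega> b m v = vol \<omega>' b m v"
proof (induction m arbitrary: b v)
  case (Suc m)
  have "\<omega> v = \<omega>' v" using Suc.prems[of "[]"] by simp
  moreover have "vol \<omega> c m (i # v) = vol \<omega>' c m (i # v)" for c i
    using Suc.prems[of "_ @ [i]"] by (intro Suc.IH) simp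
  ultimately show ?case by simp
qed simp

lemma space_kesten [simp]: "space (kesten_measure \<mu>) = UNIV"
  by (simp add: kesten_measure_def space_PiM)

lemma measurable_mark [measurable]: "(\<lambda>\<omega>. \<omega> v) \<in> kesten_measure \<mu> \<rightarrow>\<^sub>M count_space UNIV"
  unfolding kesten_measure_def
  by (rule measurable_compose[OF measurable_component_singleton]) auto

lemma measurable_vol [measurable]: "(\<lambda>\<omega>. vol \<omega> b m v) \<in> kesten_measure \<mu> \<rightarrow>\<^sub>M count_space UNIV"
proof (induction m arbitrary: b v)
  case (Suc m)
  have [measurable]: "(\<lambda>\<omega>. vol \<omega> c m w) \<in> kesten_measure \<mu> \<rightarrow>\<^sub>M count_space UNIV" for c w by (rule Suc)
  show ?case unfolding vol.simps
    by (rule measurable_compose_countable[where g="\<lambda>\<omega>. \<omega> v" and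
      f="\<lambda>x \<omega>. 1 + (\<Sum>i<(if b then fst (snd x) else fst x). vol \<omega> (b \<and> i = snd (snd x)) m (i # v))"]) measurable
qed simp

lemma prob_space_kesten: "prob_space (kesten_measure \<mu>)"
  unfolding kesten_measure_def by (intro prob_space_PiM measure_pmf.prob_space_axioms)

text \<open>Conditioning on the mark at v. The mark takes countably many values, so the integral
  splits into a sum over them and each \<open>h x\<close> has to be measurable only by
  itself.\<close>

lemma nn_integral_coordinate_split:
  fixes p :: "'b::countable pmf" and h :: "'b \<Rightarrow> ('a \<Rightarrow> 'b) \<Rightarrow> ennreal"
  assumes [measurable]: "\<And>x. h x \<in> borel_measurable (PiM UNIV (\<lambda>_. measure_pmf p))"
    and dep: "\<And>x \<omega> \<omega>'. (\<And>j. j \<noteq> v \<Longrightarrow> \<omega> j = \<omega>' j) \<Longrightarrow> h x \<omega> = h x \<omega>'"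
  shows "(\<integral>\<^sup>+\<omega>. h (\<omega> v) \<omega> \<partial>PiM UNIV (\<lambda>_. measure_pmf p)) =
    (\<integral>\<^sup>+x. (\<integral>\<^sup>+\<omega>. h x \<omega> \<partial>PiM UNIV (\<lambda>_. measure_pmf p)) \<partial>measure_pmf p)"
proof -
  let ?M = "PiM (UNIV :: 'a set) (\<lambda>_. measure_pmf p)"
  have comp[measurable]: "(\<lambda>\<omega>. \<omega> v) \<in> ?M \<rightarrow>\<^sub>M count_space UNIV"
    by (rule measurable_compose[OF measurable_component_singleton]) auto
  have ind[measurable]: "(\<lambda>\<omega>. indicator {x} (\<omega> v) :: ennreal) \<in> borel_measurable ?M" for x
    by (rule measurable_compose[OF comp]) simp
  have "h (\<omega> v) \<omega> = (\<integral>\<^sup>+x. indicator {x} (\<omega> v) * h x \<omega> \<partial>count_space UNIV)" for \<omega>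
  proof -
    have "(\<integral>\<^sup>+x. indicator {x} (\<omega> v) * h x \<omega> \<partial>count_space UNIV) =
      (\<integral>\<^sup>+x. h x \<omega> * indicator {\<omega> v} x \<partial>count_space UNIV)"
      by (intro nn_integral_cong) (auto simp: indicator_def)
    also have "\<dots> = h (\<omega> v) \<omega>"
      by (subst nn_integral_indicator_singleton) auto
    finally show ?thesis ..
  qed
  then have "(\<integral>\<^sup>+\<omega>. h (\<omega> v) \<omega> \<partial>?M) = (\<integral>\<^sup>+\<omega>. (\<integral>\<^sup>+x. indicator {x} (\<omega> v) * h x \<omega> \<partial>count_space UNIV) \<partial>?M)"
    by simp
  also have "\<dots> = (\<integral>\<^sup>+x. (\<integral>\<^sup>+\<omega>. indicator {x} (\<omega> v) * h x \<omega> \<partial>?M) \<partial>count_space UNIV)"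
    by (rule nn_integral_count_space_nn_integral) auto
  also have "\<dots> = (\<integral>\<^sup>+x. ennreal (pmf p x) * (\<integral>\<^sup>+\<omega>. h x \<omega> \<partial>?M) \<partial>count_space UNIV)"
  proof (rule nn_integral_cong)
    fix x
    \<comment> \<open>The two independent factors are indexed by a Boolean, with blocks {v} and its
      complement, so that \<open>nn_integral_prod_blocks\<close> applies.\<close>
    let ?g = "\<lambda>b. if b then (\<lambda>\<omega>. indicator {x} (\<omega> v)) else h x"
    have "(\<integral>\<^sup>+\<omega>. (\<Prod>b\<in>UNIV. ?g b \<omega>) \<partial>?M) = (\<Prod>b\<in>UNIV. \<integral>\<^sup>+\<omega>. ?g b \<omega> \<partial>?M)"
    proof (rule nn_integral_prod_blocks[where J="\<lambda>b. if b then {v} else - {v}"])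
      show "?g b \<in> borel_measurable ?M" for b by (cases b) auto
      show "?g b \<omega> = ?g b \<omega>'" if "\<And>j. j \<in> (if b then {v} else - {v}) \<Longrightarrow> \<omega> j = \<omega>' j" for b \<omega> \<omega>'
        using that dep[of \<omega> \<omega>' x] by (cases b) auto
    qed (auto simp: disjoint_family_on_def measure_pmf.prob_space_axioms)
    moreover have "(\<integral>\<^sup>+\<omega>. indicator {x} (\<omega> v) \<partial>?M) = ennreal (pmf p x)"
    proof -
      interpret product_prob_space "\<lambda>_::'a. measure_pmf p" UNIV ..
      have "(\<integral>\<^sup>+\<omega>. indicator {x} (\<omega> v) \<partial>?M) = (\<integral>\<^sup>+z. indicator {x} z \<partial>distr ?M (measure_pmf p) (\<lambda>\<omega>. \<omega> v))"
        by (subst nn_integral_distr) auto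
      then show ?thesis by (subst (asm) PiM_component) (auto simp: emeasure_pmf_single)
    qed
    ultimately show "(\<integral>\<^sup>+\<omega>. indicator {x} (\<omega> v) * h x \<omega> \<partial>?M) = ennreal (pmf p x) * (\<integral>\<^sup>+\<omega>. h x \<omega> \<partial>?M)"
      by (simp add: UNIV_bool mult.commute)
  qed
  also have "\<dots> = (\<integral>\<^sup>+x. (\<integral>\<^sup>+\<omega>. h x \<omega> \<partial>?M) \<partial>measure_pmf p)"
    by (simp add: nn_integral_measure_pmf)
  finally show ?thesis .
qed

section \<open>Laplace transforms of ball volumes\<close>

primrec lap_normal :: "nat pmf \<Rightarrow> real \<Rightarrow> nat \<Rightarrow> real" where
  "lap_normal \<mu> s 0 = s"
| "lap_normal \<mu> s (Suc m) = s * gf \<mu> (lap_normal \<mu> s m)"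

text \<open>Here 1 - mdgap \<mu> (1 - q) is \<phi>' (q), the transform of n - 1 under the
  size-biased law: one child of a special vertex is special and the other n - 1 are normal.\<close>

primrec lap_special :: "nat pmf \<Rightarrow> real \<Rightarrow> nat \<Rightarrow> real" where
  "lap_special \<mu> s 0 = s"
| "lap_special \<mu> s (Suc m) = s * lap_special \<mu> s m * (1 - mdgap \<mu> (1 - lap_normal \<mu> s m))"

context critical
begin

lemma pmf_size_biased: "pmf (size_biased \<mu>) n = real n * pmf \<mu> n"
  unfolding size_biased_def
proof (rule pmf_embed_pmf)
  have "(\<integral>\<^sup>+ x. ennreal (real x * pmf \<mu> x) \<partial>count_space UNIV) = (\<Sum>n. ennreal (real n * pmf \<mu> n))"
    by (simp add: nn_integral_count_space_nat)
  also have "\<dots> = ennreal 1"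
    using critical unfolding critical_offspring_def by (intro suminf_ennreal_eq) auto
  finally show "(\<integral>\<^sup>+ x. ennreal (real x * pmf \<mu> x) \<partial>count_space UNIV) = 1" by simp
qed simp

lemma gf_bounds: "0 \<le> s \<Longrightarrow> s \<le> 1 \<Longrightarrow> 0 \<le> gf \<mu> s" "0 \<le> s \<Longrightarrow> s \<le> 1 \<Longrightarrow> gf \<mu> s \<le> 1"
  unfolding gf_def
   apply (rule Bochner_Integration.integral_nonneg, simp)
  apply (rule measure_pmf.integral_le_const)
   apply (auto intro: power_le_one)
  done

lemma lap_normal_bounds: "0 \<le> s \<Longrightarrow> s \<le> 1 \<Longrightarrow> 0 \<le> lap_normal \<mu> s m \<and> lap_normal \<mu> s m \<le> s"
  by (induction m) (auto simp: gf_bounds mult_left_le)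

lemma lap_special_bounds: "0 \<le> s \<Longrightarrow> s \<le> 1 \<Longrightarrow> 0 \<le> lap_special \<mu> s m \<and> lap_special \<mu> s m \<le> 1"
proof (induction m)
  case (Suc m)
  have "0 \<le> 1 - lap_normal \<mu> s m" "1 - lap_normal \<mu> s m \<le> 1"
    using lap_normal_bounds[OF Suc.prems, of m] Suc.prems by auto
  then have "0 \<le> mdgap \<mu> (1 - lap_normal \<mu> s m)" "mdgap \<mu> (1 - lap_normal \<mu> s m) \<le> 1"
    using mdgap_nonneg mdgap_le_1 by auto
  then show ?case using Suc by (auto intro!: mult_le_one)
qed auto

lemma nn_integral_gf: "0 \<le> s \<Longrightarrow> s \<le> 1 \<Longrightarrow> (\<integral>\<^sup>+n. ennreal s ^ n \<partial>measure_pmf \<mu>) = ennreal (gf \<mu> s)"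
proof -
  assume s: "0 \<le> s" "s \<le> 1"
  have "(\<integral>\<^sup>+n. ennreal s ^ n \<partial>measure_pmf \<mu>) = (\<integral>\<^sup>+n. ennreal (s ^ n) \<partial>measure_pmf \<mu>)"
    using s by (intro nn_integral_cong) (simp add: ennreal_power)
  also have "\<dots> = ennreal (gf \<mu> s)"
    unfolding gf_def using s by (intro nn_integral_eq_integral) auto
  finally show ?thesis .
qed

lemma nn_integral_size_biased:
  assumes "0 \<le> s" "s \<le> 1"
  shows "(\<integral>\<^sup>+n. ennreal s ^ (n - 1) \<partial>measure_pmf (size_biased \<mu>)) = ennreal (1 - mdgap \<mu> (1 - s))"
proof -
  have "(\<integral>\<^sup>+n. ennreal s ^ (n - 1) \<partial>measure_pmf (size_biased \<mu>)) =
     (\<integral>\<^sup>+n. ennreal (pmf \<mu> n) * ennreal (real n * s ^ (n - 1)) \<partial>count_space UNIV)"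
    using assms by (simp add: nn_integral_measure_pmf pmf_size_biased ennreal_power ennreal_mult''[symmetric] mult_ac)
  also have "\<dots> = (\<integral>\<^sup>+n. ennreal (real n - dgap n (1 - s)) \<partial>measure_pmf \<mu>)"
    by (simp add: nn_integral_measure_pmf dgap_def algebra_simps)
  also have "\<dots> = ennreal (measure_pmf.expectation \<mu> (\<lambda>n. real n - dgap n (1 - s)))"
    using assms dgap_le[of "1 - s"] by (intro nn_integral_eq_integral) auto
  also have "measure_pmf.expectation \<mu> (\<lambda>n. real n - dgap n (1 - s)) = 1 - mdgap \<mu> (1 - s)"
    using assms mean_one by (simp add: mdgap_def has_bochner_integral_iff)
  finally show ?thesis .
qed

text \<open>Given the mark of v, the product over the children factorises by independence. The claim
  covers every label and both values of the flag, whether or not v is in the tree, so that the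
  induction passes to the children. For a special vertex the product does not depend on which child
  is special, so the uniform index drops out.\<close>

lemma laplace_vol:
  assumes s: "0 \<le> s" "s \<le> 1"
  shows "(\<integral>\<^sup>+\<omega>. ennreal s ^ vol \<omega> b m v \<partial>kesten_measure \<mu>) =
    ennreal ((if b then lap_special else lap_normal) \<mu> s m)"
proof (induction m arbitrary: b v)
  case 0
  interpret prob_space "kesten_measure \<mu>" by (rule prob_space_kesten)
  show ?case by (simp add: emeasure_space_1[simplified])
next
  case (Suc m)
  let ?M = "kesten_measure \<mu>"
  define G where "G c = ennreal ((if c then lap_special else lap_normal) \<mu> s m)" for c
  define N where "N x = (if b then fst (snd x) else fst x)" for x :: "nat \<times> nat \<times> nat"
  define h where "h x \<omega> = (\<Prod>i<N x. ennreal s ^ vol \<omega> (b \<and> i = snd (snd x)) m (i # v))" for x \<omega>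
  have h_meas[measurable]: "h x \<in> borel_measurable ?M" for x
    unfolding h_def by measurable
  have vol_dep: "vol \<omega> c m (i # v) = vol \<omega>' c m (i # v)" if "\<And>j. j \<in> {w. \<exists>u. w = u @ i # v} \<Longrightarrow> \<omega> j = \<omega>' j" for \<omega> \<omega>' c i
    by (rule vol_cong) (use that in auto)
  have hint: "(\<integral>\<^sup>+\<omega>. h x \<omega> \<partial>?M) = (\<Prod>i<N x. G (b \<and> i = snd (snd x)))" for x
  proof -
    have "(\<integral>\<^sup>+\<omega>. h x \<omega> \<partial>?M) = (\<Prod>i<N x. \<integral>\<^sup>+\<omega>. ennreal s ^ vol \<omega> (b \<and> i = snd (snd x)) m (i # v) \<partial>?M)"
      unfolding h_def kesten_measure_def
    proof (rule nn_integral_prod_blocks[where J="\<lambda>i. {w. \<exists>u. w = u @ i # v}"])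
      show "(\<lambda>\<omega>. ennreal s ^ vol \<omega> (b \<and> i = snd (snd x)) m (i # v)) \<in>
        borel_measurable (\<Pi>\<^sub>M v\<in>UNIV. measure_pmf (pair_pmf \<mu> (special_offspring \<mu>)))" for i
        using measurable_vol[of "b \<and> i = snd (snd x)" m "i # v" \<mu>]
        unfolding kesten_measure_def by measurable
      show "ennreal s ^ vol \<omega> (b \<and> i = snd (snd x)) m (i # v) = ennreal s ^ vol \<omega>' (b \<and> i = snd (snd x)) m (i # v)"
        if "\<And>j. j \<in> {w. \<exists>u. w = u @ i # v} \<Longrightarrow> \<omega> j = \<omega>' j" for i \<omega> \<omega>'
        using vol_dep[OF that] by simp
    qed (auto simp: disjoint_family_on_def measure_pmf.prob_space_axioms)
    also have "\<dots> = (\<Prod>i<N x. G (b \<and> i = snd (snd x)))"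
      unfolding G_def by (intro prod.cong refl Suc)
    finally show ?thesis .
  qed
  have "(\<integral>\<^sup>+\<omega>. ennreal s ^ vol \<omega> b (Suc m) v \<partial>?M) = (\<integral>\<^sup>+\<omega>. ennreal s * h (\<omega> v) \<omega> \<partial>?M)"
    by (intro nn_integral_cong) (simp add: h_def N_def power_sum)
  also have "\<dots> = ennreal s * (\<integral>\<^sup>+\<omega>. h (\<omega> v) \<omega> \<partial>?M)"
    by (rule nn_integral_cmult) (rule measurable_compose_countable[where f=h and g="\<lambda>\<omega>. \<omega> v"], measurable)
  also have "(\<integral>\<^sup>+\<omega>. h (\<omega> v) \<omega> \<partial>?M) = (\<integral>\<^sup>+x. (\<integral>\<^sup>+\<omega>. h x \<omega> \<partial>?M) \<partial>measure_pmf (pair_pmf \<mu> (special_offspring \<mu>)))"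
    unfolding kesten_measure_def
  proof (rule nn_integral_coordinate_split)
    show "h x \<in> borel_measurable (\<Pi>\<^sub>M v\<in>UNIV. measure_pmf (pair_pmf \<mu> (special_offspring \<mu>)))" for x
      using h_meas[of x] by (simp add: kesten_measure_def)
    show "h x \<omega> = h x \<omega>'" if *: "\<And>j. j \<noteq> v \<Longrightarrow> \<omega> j = \<omega>' j" for x \<omega> \<omega>'
    proof -
      have "vol \<omega> c m (i # v) = vol \<omega>' c m (i # v)" for c i
        by (rule vol_dep, rule *) auto
      then show ?thesis unfolding h_def by simp
    qed
  qed
  also have "\<dots> = (\<integral>\<^sup>+x. (\<Prod>i<N x. G (b \<and> i = snd (snd x))) \<partial>measure_pmf (pair_pmf \<mu> (special_offspring \<mu>)))"
    by (simp add: hint)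
  also have "ennreal s * \<dots> = ennreal ((if b then lap_special else lap_normal) \<mu> s (Suc m))"
  proof (cases b)
    case False
    have "(\<integral>\<^sup>+x. (\<Prod>i<N x. G (b \<and> i = snd (snd x))) \<partial>measure_pmf (pair_pmf \<mu> (special_offspring \<mu>))) =
      (\<integral>\<^sup>+x. ennreal (lap_normal \<mu> s m) ^ fst x \<partial>measure_pmf (pair_pmf \<mu> (special_offspring \<mu>)))"
      using False by (simp add: N_def G_def)
    also have "\<dots> = (\<integral>\<^sup>+n. ennreal (lap_normal \<mu> s m) ^ n \<partial>measure_pmf (map_pmf fst (pair_pmf \<mu> (special_offspring \<mu>))))"
      by simp
    also have "\<dots> = ennreal (gf \<mu> (lap_normal \<mu> s m))"
      unfolding map_fst_pair_pmf using lap_normal_bounds[OF s, of m] s by (intro nn_integral_gf) auto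
    finally show ?thesis using False s by (simp add: ennreal_mult')
  next
    case True
    let ?q = "lap_normal \<mu> s m" and ?p = "lap_special \<mu> s m"
    have q: "0 \<le> ?q" "?q \<le> 1" using lap_normal_bounds[OF s, of m] s by auto
    have "(\<integral>\<^sup>+x. (\<Prod>i<N x. G (b \<and> i = snd (snd x))) \<partial>measure_pmf (pair_pmf \<mu> (special_offspring \<mu>))) =
      (\<integral>\<^sup>+x. (\<Prod>i<fst (snd x). G (i = snd (snd x))) \<partial>measure_pmf (pair_pmf \<mu> (special_offspring \<mu>)))"
      using True by (simp add: N_def)
    also have "\<dots> = (\<integral>\<^sup>+y. (\<Prod>i<fst y. G (i = snd y)) \<partial>measure_pmf (map_pmf snd (pair_pmf \<mu> (special_offspring \<mu>))))"
      by simp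
    also have "\<dots> = (\<integral>\<^sup>+n. (\<integral>\<^sup>+k. (\<Prod>i<n. G (i = k)) \<partial>measure_pmf (pmf_of_set {..<n})) \<partial>measure_pmf (size_biased \<mu>))"
      unfolding map_snd_pair_pmf special_offspring_def by (simp add: nn_integral_bind_pmf)
    also have "\<dots> = (\<integral>\<^sup>+n. ennreal ?p * ennreal ?q ^ (n - 1) \<partial>measure_pmf (size_biased \<mu>))"
    proof (rule nn_integral_cong_AE, rule AE_pmfI)
      fix n assume "n \<in> set_pmf (size_biased \<mu>)"
      \<comment> \<open>The size-biased law does not charge 0, so {..<n} is nonempty and
        \<open>pmf_of_set\<close> is really the uniform law.\<close>
      then have n: "0 < n" by (cases n) (auto simp: set_pmf_eq pmf_size_biased)
      have "(\<integral>\<^sup>+k. (\<Prod>i<n. G (i = k)) \<partial>measure_pmf (pmf_of_set {..<n})) =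
        (\<integral>\<^sup>+k. ennreal ?p * ennreal ?q ^ (n - 1) \<partial>measure_pmf (pmf_of_set {..<n}))"
      proof (rule nn_integral_cong_AE, rule AE_pmfI)
        fix k assume "k \<in> set_pmf (pmf_of_set {..<n})"
        then have k: "k < n" using n by (subst (asm) set_pmf_of_set) auto
        then have "(\<Prod>i<n. G (i = k)) = G True * (\<Prod>i\<in>{..<n} - {k}. G (i = k))"
          by (subst prod.remove[of _ k]) auto
        also have "(\<Prod>i\<in>{..<n} - {k}. G (i = k)) = (\<Prod>i\<in>{..<n} - {k}. G False)"
          by (intro prod.cong) auto
        finally show "(\<Prod>i<n. G (i = k)) = ennreal ?p * ennreal ?q ^ (n - 1)"
          using k by (simp add: G_def)
      qed
      then show "(\<integral>\<^sup>+k. (\<Prod>i<n. G (i = k)) \<partial>measure_pmf (pmf_of_set {..<n})) = ennreal ?p * ennreal ?q ^ (n - 1)"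
        by simp
    qed
    also have "\<dots> = ennreal ?p * ennreal (1 - mdgap \<mu> (1 - ?q))"
      by (simp add: nn_integral_cmult nn_integral_size_biased[OF q, simplified])
    finally show ?thesis
      using True s lap_special_bounds[OF s, of m] mdgap_le_1[of "1 - ?q"] q
      by (simp add: ennreal_mult'[symmetric] mult.assoc)
  qed
  finally show ?case .
qed

end

context critical
begin

lemma lap_normal_le_1: "0 \<le> s \<Longrightarrow> s \<le> 1 \<Longrightarrow> lap_normal \<mu> s m \<le> 1"
  using lap_normal_bounds[of s m] by linarith

text \<open>Unrolled, \<open>lap_special\<close> is a product of m + 1 factors s and m factors 1 -
  mdgap, all in [0, 1]; the deficit of such a product is at most the sum of the deficits.\<close>

lemma one_minus_lap_special_le:
  assumes "0 \<le> s" "s \<le> 1" "0 \<le> D" "\<And>j. j < m \<Longrightarrow> mdgap \<mu> (1 - lap_normal \<mu> s j) \<le> D"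
  shows "1 - lap_special \<mu> s m \<le> (real m + 1) * (1 - s) + real m * D"
  using assms(4)
proof (induction m)
  case (Suc m)
  have IH: "1 - lap_special \<mu> s m \<le> (real m + 1) * (1 - s) + real m * D" using Suc by simp
  let ?d = "mdgap \<mu> (1 - lap_normal \<mu> s m)"
  have d: "?d \<le> D" "0 \<le> ?d" "?d \<le> 1"
    using Suc.prems[of m] lap_normal_bounds[OF assms(1,2), of m] assms(2)
    by (auto intro!: mdgap_nonneg mdgap_le_1)
  have p: "0 \<le> lap_special \<mu> s m" "lap_special \<mu> s m \<le> 1" using lap_special_bounds[OF assms(1,2)] by auto
  have mult: "x + y - 1 \<le> x * y" if "x \<le> 1" "y \<le> 1" for x y :: real
    using mult_nonneg_nonneg[of "1 - x" "1 - y"] that by (simp add: algebra_simps)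
  have "s + lap_special \<mu> s m - 1 \<le> s * lap_special \<mu> s m" using assms p by (intro mult) auto
  moreover have "s * lap_special \<mu> s m + (1 - ?d) - 1 \<le> s * lap_special \<mu> s m * (1 - ?d)"
    using assms p d by (intro mult mult_le_one) auto
  ultimately show ?case using IH d by (simp add: algebra_simps)
qed (use assms in simp)

text \<open>The factors s are bounded by 1; what remains uses 1 - mdgap <= exp (- mdgap) at each
  vertex of the spine.\<close>

lemma lap_special_le_exp:
  assumes "0 \<le> s" "s \<le> 1"
  shows "lap_special \<mu> s m \<le> exp (- (\<Sum>j<m. mdgap \<mu> (1 - lap_normal \<mu> s j)))"
proof (induction m)
  case (Suc m)
  let ?d = "mdgap \<mu> (1 - lap_normal \<mu> s m)"
  have d: "?d \<le> 1"
    using lap_normal_bounds[OF assms, of m] assms by (auto intro!: mdgap_le_1)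
  have p: "0 \<le> lap_special \<mu> s m" using lap_special_bounds[OF assms] by auto
  have "lap_special \<mu> s (Suc m) \<le> lap_special \<mu> s m * (1 - ?d)"
    using assms p d by (simp add: mult_right_mono mult_left_le_one_le)
  also have "\<dots> \<le> exp (- (\<Sum>j<m. mdgap \<mu> (1 - lap_normal \<mu> s j))) * exp (- ?d)"
    using Suc d p exp_ge_add_one_self[of "- ?d"] by (intro mult_mono) auto
  finally show ?case by (simp add: mult_exp_exp)
qed (use assms in simp)

lemma laplace_volume: 
  assumes "0 \<le> s" "s \<le> 1"
  shows "(\<integral>\<omega>. s ^ card (tree_ball \<omega> R) \<partial>kesten_measure \<mu>) = lap_special \<mu> s R"
    and "integrable (kesten_measure \<mu>) (\<lambda>\<omega>. s ^ card (tree_ball \<omega> R))"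
proof -
  have "has_bochner_integral (kesten_measure \<mu>) (\<lambda>\<omega>. s ^ vol \<omega> True R []) (lap_special \<mu> s R)"
  proof (rule has_bochner_integral_nn_integral)
    show "(\<integral>\<^sup>+ \<omega>. ennreal (s ^ vol \<omega> True R []) \<partial>kesten_measure \<mu>) = ennreal (lap_special \<mu> s R)"
      using laplace_vol[OF assms, of True R "[]"] assms by (simp add: ennreal_power)
  qed (use assms lap_special_bounds in auto)
  then show "(\<integral>\<omega>. s ^ card (tree_ball \<omega> R) \<partial>kesten_measure \<mu>) = lap_special \<mu> s R"
    and "integrable (kesten_measure \<mu>) (\<lambda>\<omega>. s ^ card (tree_ball \<omega> R))"
    by (auto simp: has_bochner_integral_iff card_tree_ball)
qed

lemma measurable_card_ball [measurable]:
  "(\<lambda>\<omega>. card (tree_ball \<omega> R)) \<in> kesten_measure \<mu> \<rightarrow>\<^sub>M count_space UNIV"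
  unfolding card_tree_ball by measurable

lemma sets_card_ball [measurable]: "{\<omega>. Q (card (tree_ball \<omega> R))} \<in> sets (kesten_measure \<mu>)"
  using measurable_sets[OF measurable_card_ball, of "Collect Q" R] by (simp add: vimage_def)

text \<open>Markov's inequality for 1 - exp (- l * volume), which is at least 1 - 1/e on the
  event.\<close>

lemma prob_volume_gt:
  assumes "0 < l"
  shows "measure (kesten_measure \<mu>) {\<omega>. 1 / l < volume \<omega> R} * (1 - exp (- 1))
    \<le> 1 - lap_special \<mu> (exp (- l)) R"
proof -
  interpret K: prob_space "kesten_measure \<mu>" by (rule prob_space_kesten)
  have [measurable]: "{\<omega>. 1 / l < volume \<omega> R} \<in> sets (kesten_measure \<mu>)"
    by (rule sets_card_ball)
  have int: "integrable (kesten_measure \<mu>) (\<lambda>\<omega>. exp (- l) ^ card (tree_ball \<omega> R))"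
    using assms by (intro laplace_volume) auto
  have "measure (kesten_measure \<mu>) {\<omega>. 1 / l < volume \<omega> R} * (1 - exp (- 1))
    = (\<integral>\<omega>. indicator {\<omega>. 1 / l < volume \<omega> R} \<omega> * (1 - exp (- 1)) \<partial>kesten_measure \<mu>)"
    by simp
  also have "\<dots> \<le> (\<integral>\<omega>. 1 - exp (- l) ^ card (tree_ball \<omega> R) \<partial>kesten_measure \<mu>)"
  proof (rule Bochner_Integration.integral_mono)
    fix \<omega>
    show "indicator {\<omega>. 1 / l < volume \<omega> R} \<omega> * (1 - exp (- 1)) \<le> 1 - exp (- l) ^ card (tree_ball \<omega> R)"
    proof (cases "1 / l < volume \<omega> R")
      case True
      then have "1 \<le> l * volume \<omega> R" using assms by (simp add: field_simps)
      then have "exp (- l) ^ card (tree_ball \<omega> R) \<le> exp (- 1)"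
        by (simp add: exp_of_nat_mult[symmetric] mult.commute)
      then show ?thesis using True by simp
    qed (use assms in \<open>simp add: power_le_one\<close>)
  qed (use int in \<open>auto simp: less_top[symmetric] K.emeasure_eq_measure\<close>)
  also have "\<dots> = 1 - lap_special \<mu> (exp (- l)) R"
    using int assms laplace_volume(1)[of "exp (- l)" R] by (simp add: K.prob_space[simplified])
  finally show ?thesis .
qed

text \<open>Markov's inequality for exp (1 - l * volume), which is at least 1 on the event.\<close>

lemma prob_volume_less:
  assumes "0 < l"
  shows "measure (kesten_measure \<mu>) {\<omega>. volume \<omega> R < 1 / l}
    \<le> exp 1 * lap_special \<mu> (exp (- l)) R"
proof -
  interpret K: prob_space "kesten_measure \<mu>" by (rule prob_space_kesten)
  have [measurable]: "{\<omega>. volume \<omega> R < 1 / l} \<in> sets (kesten_measure \<mu>)"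
    by (rule sets_card_ball)
  have int: "integrable (kesten_measure \<mu>) (\<lambda>\<omega>. exp (- l) ^ card (tree_ball \<omega> R))"
    using assms by (intro laplace_volume) auto
  have "measure (kesten_measure \<mu>) {\<omega>. volume \<omega> R < 1 / l}
    = (\<integral>\<omega>. indicator {\<omega>. volume \<omega> R < 1 / l} \<omega> \<partial>kesten_measure \<mu>)"
    by simp
  also have "\<dots> \<le> (\<integral>\<omega>. exp 1 * exp (- l) ^ card (tree_ball \<omega> R) \<partial>kesten_measure \<mu>)"
  proof (rule Bochner_Integration.integral_mono)
    fix \<omega>
    show "indicator {\<omega>. volume \<omega> R < 1 / l} \<omega> \<le> exp 1 * exp (- l) ^ card (tree_ball \<omega> R)"
    proof (cases "volume \<omega> R < 1 / l")
      case True
      then have "l * volume \<omega> R \<le> 1" using assms by (simp add: field_simps)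
      then have "1 \<le> exp 1 * exp (- l) ^ card (tree_ball \<omega> R)"
        by (simp add: exp_of_nat_mult[symmetric] mult_exp_exp mult.commute)
      then show ?thesis using True by simp
    qed simp
  qed (use int in \<open>auto simp: less_top[symmetric] K.emeasure_eq_measure\<close>)
  also have "\<dots> = exp 1 * lap_special \<mu> (exp (- l)) R"
    using int assms laplace_volume(1)[of "exp (- l)" R] by simp
  finally show ?thesis .
qed

lemma gf_mono: "0 \<le> s \<Longrightarrow> s \<le> t \<Longrightarrow> t \<le> 1 \<Longrightarrow> gf \<mu> s \<le> gf \<mu> t"
  unfolding gf_def by (intro Bochner_Integration.integral_mono) (auto intro: power_mono)

end

lemma one_minus_exp_ge: "0 \<le> l \<Longrightarrow> l \<le> 1 \<Longrightarrow> l / 2 \<le> 1 - exp (- l)" for l :: real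
proof -
  assume l: "0 \<le> l" "l \<le> 1"
  have "exp (- l) \<le> 1 / (1 + l)"
    using l exp_ge_add_one_self[of l] by (simp add: exp_minus field_simps)
  also have "\<dots> \<le> 1 - l / 2" 
  proof -
    have "l * l \<le> l * 1" using l by (intro mult_left_mono) auto
    then show ?thesis using l by (simp add: field_simps)
  qed
  finally show ?thesis by simp
qed

lemma exp_le_one_plus_double: "0 \<le> l \<Longrightarrow> l \<le> 1 \<Longrightarrow> exp l \<le> 1 + 2 * l" for l :: real
  using exp_bound[of l] mult_left_mono[of l 1 l] by (simp add: power2_eq_square)

section \<open>Tails of the ball volume\<close>

context stable_critical
begin

definition "vdim = \<beta> / (\<beta> - 1)"

lemma vdim: "2 \<le> vdim" "1 / vdim = (\<beta> - 1) / \<beta>" "0 < vdim"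
  using beta by (auto simp: vdim_def field_simps)

text \<open>The transform of a normal subtree stays above a barrier 1 - y with y of order
  l^(1/\<beta>). Each of the R spine steps then loses at most a constant times y^(\<beta> - 1),
  which is of order M^(- 1 / vdim) / R; this is the origin of the tail exponent.\<close>

lemma volume_upper:
  obtains C M0 where "0 < C" "1 \<le> M0"
    "\<And>M R. M0 \<le> M \<Longrightarrow> 1 \<le> R \<Longrightarrow>
      measure (kesten_measure \<mu>) {\<omega>. M * real R powr vdim < volume \<omega> R} \<le> C * M powr (- 1 / vdim)"
proof -
  obtain c1 x1 where c1: "0 < c1" "0 < x1" "x1 \<le> 1" "\<And>x. 0 \<le> x \<Longrightarrow> x \<le> x1 \<Longrightarrow> c1 * x powr \<beta> \<le> mgap \<mu> x"
    using mgap_lower by metis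
  obtain c2 x2 where c2: "0 < c2" "0 < x2" "x2 \<le> 1" "\<And>x. 0 \<le> x \<Longrightarrow> x \<le> x2 \<Longrightarrow> mgap \<mu> x \<le> c2 * x powr \<beta>"
    using mgap_upper by metis
  define x0 where "x0 = min x1 x2"
  have x0: "0 < x0" "x0 \<le> x1" "x0 \<le> x2" using c1 c2 by (auto simp: x0_def)
  define B where "B = 2 * c2 * (2 / c1) powr (1 / vdim)"
  define C where "C = (2 + B) / (1 - exp (- 1))"
  define M0 where "M0 = max 1 (2 / (c1 * x0 powr \<beta>))"
  have e1: "0 < 1 - exp (- 1 :: real)" by simp
  have B: "0 \<le> B" using c2 by (simp add: B_def)
  have C: "0 < C" using e1 B unfolding C_def by (intro divide_pos_pos) auto
  have M0: "1 \<le> M0" by (simp add: M0_def)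
  have "measure (kesten_measure \<mu>) {\<omega>. M * real R powr vdim < volume \<omega> R} \<le> C * M powr (- 1 / vdim)"
    if M: "M0 \<le> M" and R: "1 \<le> R" for M R
  proof -
    define l where "l = 1 / (M * real R powr vdim)"
    have M1: "1 \<le> M" using M M0 by simp
    have Rd: "real R \<le> real R powr vdim" using powr_mono[of 1 vdim "real R"] R vdim by simp
    have MR: "M \<le> M * real R powr vdim" using M1 Rd R by (simp add: mult_le_cancel_left1)
    have l: "0 < l" "l \<le> 1 / M" "l \<le> 1"
    proof -
      have MR1: "1 \<le> M * real R powr vdim" using M1 MR by linarith
      then show "0 < l" "l \<le> 1" unfolding l_def by (simp_all add: divide_le_eq_1)
      show "l \<le> 1 / M" unfolding l_def using M1 MR MR1 R by (intro divide_left_mono mult_pos_pos) auto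
    qed
    \<comment> \<open>y solves c1 y^\<beta> = 2 l, hence mgap y >= 2 l. The condition M >= M0 places
      y below x0, where both power bounds hold.\<close>
    define y where "y = (2 * l / c1) powr (1 / \<beta>)"
    have y0: "0 < y" using l c1 by (simp add: y_def)
    have yb: "y powr \<beta> = 2 * l / c1" using l c1 beta by (simp add: y_def powr_powr)
    have "2 / (c1 * x0 powr \<beta>) \<le> M" using M by (simp add: M0_def)
    then have "2 \<le> M * (c1 * x0 powr \<beta>)" using c1 x0 by (simp add: field_simps)
    then have "2 * (1 / M) / c1 \<le> x0 powr \<beta>" using M1 c1 by (simp add: field_simps)
    moreover have "2 * l / c1 \<le> 2 * (1 / M) / c1" using l c1 by (intro divide_right_mono mult_left_mono) auto
    ultimately have "y \<le> (x0 powr \<beta>) powr (1 / \<beta>)"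
      unfolding y_def using l c1 beta by (intro powr_mono2) auto
    then have yx0: "y \<le> x0" using x0 beta by (simp add: powr_powr)
    have y1: "y \<le> 1" using yx0 x0 c1 by linarith
    have fy: "2 * l \<le> mgap \<mu> y" using c1(4)[of y] yx0 x0 y0 yb c1(1) by simp
    have s: "0 \<le> exp (- l)" "exp (- l) \<le> 1" using l by auto
    \<comment> \<open>1 - y is a subsolution of the recursion F -> exp (- l) * \<phi> (F): the gap 2
      l outweighs the killing, because exp l <= 1 + 2 l.\<close>
    have step: "1 - y \<le> exp (- l) * (1 - y + mgap \<mu> y)"
    proof -
      have "exp l * (1 - y) \<le> (1 + 2 * l) * (1 - y)"
        using exp_le_one_plus_double[of l] l y1 by (intro mult_right_mono) auto
      also have "\<dots> \<le> 1 - y + 2 * l" using l y0 by (simp add: algebra_simps)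
      finally have "exp (- l) * (exp l * (1 - y)) \<le> exp (- l) * (1 - y + mgap \<mu> y)"
        using fy by (intro mult_left_mono) auto
      then show ?thesis by (simp add: mult_exp_exp mult.assoc[symmetric])
    qed
    have F: "1 - y \<le> lap_normal \<mu> (exp (- l)) j" for j
    proof (induction j)
      case 0
      have "exp (- l) * (1 - y + mgap \<mu> y) \<le> exp (- l) * 1"
        using gf_eq[of y] gf_bounds(2)[of "1 - y"] y0 y1 by (intro mult_left_mono) auto
      with step have "1 - y \<le> exp (- l)" by linarith
      then show ?case by simp
    next
      case (Suc j)
      have "exp (- l) * gf \<mu> (1 - y) \<le> exp (- l) * gf \<mu> (lap_normal \<mu> (exp (- l)) j)"
        using Suc y1 lap_normal_le_1[OF s, of j] by (intro mult_left_mono gf_mono) auto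
      moreover have "1 - y \<le> exp (- l) * gf \<mu> (1 - y)" using step gf_eq[of y] y0 y1 by simp
      ultimately show ?case unfolding lap_normal.simps by linarith
    qed
    have D: "mdgap \<mu> (1 - lap_normal \<mu> (exp (- l)) j) \<le> B * M powr (- 1 / vdim) / real R" for j
    proof -
      have "mdgap \<mu> (1 - lap_normal \<mu> (exp (- l)) j) \<le> mdgap \<mu> y"
        using F[of j] y1 lap_normal_le_1[OF s, of j] by (intro mdgap_mono) auto
      also have "\<dots> \<le> 2 * mgap \<mu> y / y"
        using mdgap_le_mgap[of y] y0 y1 by (simp add: field_simps)
      also have "\<dots> \<le> 2 * (c2 * y powr \<beta>) / y"
        using c2(4)[of y] y0 yx0 x0 by (intro divide_right_mono mult_left_mono) auto
      also have "\<dots> = 2 * c2 * y powr (\<beta> - 1)" using y0 by (simp add: powr_diff)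
      also have "y powr (\<beta> - 1) = (2 / c1 * l) powr (1 / vdim)"
        unfolding vdim(2) by (simp add: y_def powr_powr)
      also have "\<dots> = (2 / c1) powr (1 / vdim) * l powr (1 / vdim)"
        using c1 l by (simp add: powr_mult del: times_divide_eq_left)
      also have "l powr (1 / vdim) = M powr (- 1 / vdim) / real R"
        using M1 R vdim(3) unfolding l_def by (simp add: powr_divide powr_mult powr_powr powr_minus field_simps)
      finally show ?thesis by (simp add: B_def)
    qed
    have "measure (kesten_measure \<mu>) {\<omega>. 1 / l < volume \<omega> R} * (1 - exp (- 1))
      \<le> 1 - lap_special \<mu> (exp (- l)) R"
      by (rule prob_volume_gt[OF l(1)])
    also have "\<dots> \<le> (real R + 1) * (1 - exp (- l)) + real R * (B * M powr (- 1 / vdim) / real R)"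
      using D B M1 by (intro one_minus_lap_special_le s) auto
    also have "\<dots> \<le> 2 * M powr (- 1 / vdim) + B * M powr (- 1 / vdim)"
    proof (rule add_mono)
      have "(real R + 1) * (1 - exp (- l)) \<le> (2 * real R) * l"
        using R l exp_ge_add_one_self[of "- l"] by (intro mult_mono) auto
      also have "\<dots> = 2 * (real R / real R powr vdim) / M" by (simp add: l_def)
      also have "\<dots> \<le> 2 * 1 / M"
        using Rd R M1 by (intro divide_right_mono mult_left_mono) (auto simp: divide_le_eq_1)
      also have "\<dots> = 2 * M powr (-1)" using M1 by (simp add: powr_minus field_simps)
      also have "\<dots> \<le> 2 * M powr (- 1 / vdim)"
        using M1 vdim by (intro mult_left_mono powr_mono) (auto simp: field_simps)
      finally show "(real R + 1) * (1 - exp (- l)) \<le> 2 * M powr (- 1 / vdim)" .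
    qed (use R in simp)
    finally have "measure (kesten_measure \<mu>) {\<omega>. 1 / l < volume \<omega> R} * (1 - exp (- 1))
      \<le> (2 + B) * M powr (- 1 / vdim)" by (simp add: distrib_right)
    then have "measure (kesten_measure \<mu>) {\<omega>. 1 / l < volume \<omega> R} \<le> (2 + B) * M powr (- 1 / vdim) / (1 - exp (- 1))"
      using e1 by (simp only: pos_le_divide_eq)
    then show ?thesis by (simp add: l_def C_def)
  qed
  then show ?thesis using C M0 that by blast
qed

text \<open>There are two phases. Each generation raises the guaranteed lower bound for 1 - F j by
  l/8 until it reaches y, which takes at most R/2 generations; in the remaining ones each spine
  factor is at most 1 - q with q of order 1/(g R). A small g makes the total exponent large.\<close>

lemma volume_lower:
  assumes "0 < e"
  obtains h R0 where "0 < h" "h \<le> 1"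
    "\<And>R. R0 \<le> R \<Longrightarrow> measure (kesten_measure \<mu>) {\<omega>. volume \<omega> R < h * real R powr vdim} \<le> e"
proof -
  obtain c1 x1 where c1: "0 < c1" "0 < x1" "x1 \<le> 1" "\<And>x. 0 \<le> x \<Longrightarrow> x \<le> x1 \<Longrightarrow> c1 * x powr \<beta> \<le> mgap \<mu> x"
    using mgap_lower by metis
  obtain c2 x2 where c2: "0 < c2" "0 < x2" "x2 \<le> 1" "\<And>x. 0 \<le> x \<Longrightarrow> x \<le> x2 \<Longrightarrow> mgap \<mu> x \<le> c2 * x powr \<beta>"
    using mgap_upper by metis
  define x0 where "x0 = min (1 / 2) (min x1 x2)"
  have x0: "0 < x0" "x0 \<le> x1" "x0 \<le> x2" "x0 \<le> 1 / 2"
    using c1(2) c2(2) unfolding x0_def by (auto simp: min_def)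
  define A where "A = c1 * (1 / (8 * c2)) powr (1 / vdim)"
  define K where "K = 8 * (1 / (8 * c2)) powr (1 / \<beta>)"
  have A: "0 < A" using c1 c2 by (simp add: A_def)
  have K: "0 < K" using c2 by (simp add: K_def)
  \<comment> \<open>g is h^(1/vdim). The bound 1/(2 K) gives 8 y <= l R/2, so that the first phase
    ends by generation R/2. The last bound makes A/(4 g) at least 1 + ln (1/e), where the 1 cancels
    the factor exp 1 of \<open>prob_volume_less\<close>.\<close>
  define g where "g = min 1 (min (1 / (2 * K)) (A / (4 * (1 + max 0 (ln (1 / e))))))"
  define h where "h = g powr vdim"
  have "0 < A / (4 * (1 + max 0 (ln (1 / e))))" using A by (intro divide_pos_pos) auto
  then have g: "0 < g" "g \<le> 1" "g \<le> 1 / (2 * K)" "g \<le> A / (4 * (1 + max 0 (ln (1 / e))))"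
    using K unfolding g_def by (simp_all add: min.coboundedI2)
  have h: "0 < h" "h \<le> 1" using g vdim by (auto simp: h_def intro!: powr_le1)
  have hg: "h powr (1 / vdim) = g" using g(1) vdim(3) by (simp add: h_def powr_powr)
  \<comment> \<open>These lower bounds on R give, in turn, at least R/4 indices in the second phase,
    l <= 1 and y <= x0.\<close>
  define R0 where "R0 = nat \<lceil>max 4 (max (1 / h) (1 / (8 * c2 * x0 powr \<beta> * h)))\<rceil>"
  have "measure (kesten_measure \<mu>) {\<omega>. volume \<omega> R < h * real R powr vdim} \<le> e" if R: "R0 \<le> R" for R
  proof -
    have RR: "max 4 (max (1 / h) (1 / (8 * c2 * x0 powr \<beta> * h))) \<le> real R" using R unfolding R0_def by linarith
    then have R4: "4 \<le> real R" and Rh: "1 / h \<le> real R" and Rx: "1 / (8 * c2 * x0 powr \<beta> * h) \<le> real R" by auto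
    define l where "l = 1 / (h * real R powr vdim)"
    have Rd: "real R \<le> real R powr vdim" using powr_mono[of 1 vdim "real R"] R4 vdim by simp
    have "1 / l = h * real R powr vdim" by (simp add: l_def)
    have hR: "h * real R \<le> h * real R powr vdim" using h Rd by (intro mult_left_mono) auto
    have "1 \<le> h * real R" using Rh h by (simp add: field_simps)
    then have "1 \<le> h * real R powr vdim" using hR by linarith
    then have l: "0 < l" "l \<le> 1" unfolding l_def by (simp_all add: divide_le_eq_1)
    define y where "y = (l / (8 * c2)) powr (1 / \<beta>)"
    have y0: "0 < y" using l c2 by (simp add: y_def)
    have yb: "y powr \<beta> = l / (8 * c2)" using l c2 beta by (simp add: y_def powr_powr)
    have "1 \<le> 8 * c2 * x0 powr \<beta> * (h * real R)"
      using Rx h c2 x0 by (simp add: field_simps)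
    also have "\<dots> \<le> 8 * c2 * x0 powr \<beta> * (h * real R powr vdim)"
      using Rd h c2 by (intro mult_left_mono) auto
    finally have "l / (8 * c2) \<le> x0 powr \<beta>"
      using c2 h R4 by (simp add: l_def field_simps)
    then have "y \<le> (x0 powr \<beta>) powr (1 / \<beta>)"
      unfolding y_def using l c2 beta by (intro powr_mono2) auto
    then have yx0: "y \<le> x0" using x0 beta by (simp add: powr_powr)
    have y1: "y \<le> 1 / 2" using yx0 x0 by linarith
    have s: "0 \<le> exp (- l)" "exp (- l) \<le> 1" using l by auto
    define F where "F j = lap_normal \<mu> (exp (- l)) j" for j
    have F: "0 \<le> F j" "F j \<le> 1" for j using lap_normal_bounds[OF s, of j] lap_normal_le_1[OF s, of j] by (auto simp: F_def)
    \<comment> \<open>The killing factor acts on 1 - z >= 1/2 and gains l/4; the choice of y limits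
      the loss through the gap to l/8.\<close>
    have gain: "exp (- l) * gf \<mu> (1 - z) \<le> 1 - z - l / 8" if z: "0 \<le> z" "z \<le> y" for z
    proof -
      have "mgap \<mu> z \<le> c2 * z powr \<beta>" using z yx0 x0 by (intro c2) auto
      also have "\<dots> \<le> c2 * y powr \<beta>" using z c2 beta by (intro mult_left_mono powr_mono2) auto
      also have "\<dots> = l / 8" using c2 by (simp add: yb)
      finally have m: "mgap \<mu> z \<le> l / 8" .
      have "l / 2 * (1 / 2) \<le> (1 - exp (- l)) * (1 - z)"
        using one_minus_exp_ge[of l] l z y1 by (intro mult_mono) auto
      moreover have "exp (- l) * mgap \<mu> z \<le> mgap \<mu> z"
        using s mgap_nonneg[of z] z y1 by (intro mult_left_le_one_le) auto
      moreover have "(1 - exp (- l)) * (1 - z) = 1 - z - exp (- l) * (1 - z)" by (simp add: algebra_simps)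
      moreover have "exp (- l) * gf \<mu> (1 - z) = exp (- l) * (1 - z) + exp (- l) * mgap \<mu> z"
        using gf_eq[of z] z y1 by (simp add: distrib_left)
      ultimately show ?thesis using m by linarith
    qed
    have Fle: "1 - F j \<ge> min y (real j * l / 8)" for j
    proof (induction j)
      case 0 then show ?case using F[of 0] y0 by simp
    next
      case (Suc j)
      define z where "z = min y (1 - F j)"
      have z: "0 \<le> z" "z \<le> y" "z \<le> 1 - F j" using y0 F[of j] by (auto simp: z_def)
      have "F (Suc j) = exp (- l) * gf \<mu> (F j)" by (simp add: F_def)
      also have "\<dots> \<le> exp (- l) * gf \<mu> (1 - z)"
        using z F[of j] by (intro mult_left_mono gf_mono) auto
      also have "\<dots> \<le> 1 - z - l / 8" using z by (intro gain) auto
      finally have "z + l / 8 \<le> 1 - F (Suc j)" by simp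
      moreover have "min y (real (Suc j) * l / 8) \<le> z + l / 8"
        using Suc l by (auto simp: z_def min_def algebra_simps add_divide_distrib split: if_splits)
      ultimately show ?case by linarith
    qed
    have lR: "l powr (1 / vdim) = 1 / (g * real R)"
      using h R4 vdim(3) hg unfolding l_def by (simp add: powr_divide powr_mult powr_powr)
    have large: "y \<le> 1 - F j" if j: "real R / 2 \<le> real j" for j
    proof -
      have "8 * y = K * l powr (1 / \<beta>)"
        using l c2 by (simp add: y_def K_def powr_divide)
      also have "\<dots> = K * (g * real R) * l"
      proof -
        have "l powr (1 / \<beta>) = l powr (1 - 1 / vdim)" using beta unfolding vdim(2) by (simp add: field_simps)
        also have "\<dots> = l * (g * real R)" using l lR by (simp add: powr_diff)
        finally show ?thesis by simp
      qed
      also have "\<dots> \<le> (real R / 2) * l"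
      proof (rule mult_right_mono)
        have "K * g \<le> 1 / 2" using g(3) K by (simp add: field_simps)
        then have "K * g * real R \<le> 1 / 2 * real R" by (intro mult_right_mono) auto
        then show "K * (g * real R) \<le> real R / 2" by simp
      qed (use l in simp)
      also have "\<dots> \<le> real j * l" using j l by (intro mult_right_mono) auto
      finally have "y \<le> real j * l / 8" by simp
      then show ?thesis using Fle[of j] by simp
    qed
    define q where "q = A / (g * real R)"
    have q: "0 < q" using A g R4 by (simp add: q_def)
    have D: "q \<le> mdgap \<mu> (1 - F j)" if j: "real R / 2 \<le> real j" for j
    proof -
      have "q = c1 * y powr (\<beta> - 1)"
      proof -
        have "y powr (\<beta> - 1) = (1 / (8 * c2) * l) powr (1 / vdim)"
          unfolding vdim(2) by (simp add: y_def powr_powr)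
        also have "\<dots> = (1 / (8 * c2)) powr (1 / vdim) * l powr (1 / vdim)"
          using c2 l by (simp add: powr_mult del: times_divide_eq_left)
        finally show ?thesis by (simp add: q_def A_def lR)
      qed
      also have "\<dots> = c1 * y powr \<beta> / y" using y0 by (simp add: powr_diff)
      also have "\<dots> \<le> mgap \<mu> y / y" using c1(4)[of y] y0 yx0 x0 by (intro divide_right_mono) auto
      also have "\<dots> \<le> mdgap \<mu> y" using mgap_le_mdgap[of y] y0 y1 by (simp add: field_simps)
      also have "\<dots> \<le> mdgap \<mu> (1 - F j)" using large[OF j] y0 F[of j] by (intro mdgap_mono) auto
      finally show ?thesis .
    qed
    have "real R / 4 * q \<le> real (card {j. j < R \<and> real R / 2 \<le> real j}) * q"
    proof (intro mult_right_mono)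
      have "{j. j < R \<and> real R / 2 \<le> real j} = {nat \<lceil>real R / 2\<rceil>..<R}"
        by (auto simp: nat_le_iff ceiling_le_iff)
      then have "real (card {j. j < R \<and> real R / 2 \<le> real j}) = real (R - nat \<lceil>real R / 2\<rceil>)" by simp
      moreover have "real (nat \<lceil>real R / 2\<rceil>) \<le> real R / 2 + 1" by linarith
      ultimately show "real R / 4 \<le> real (card {j. j < R \<and> real R / 2 \<le> real j})" using R4 by linarith
    qed (use q in simp)
    also have "\<dots> = (\<Sum>j\<in>{j. j < R \<and> real R / 2 \<le> real j}. q)" by simp
    also have "\<dots> \<le> (\<Sum>j\<in>{j. j < R \<and> real R / 2 \<le> real j}. mdgap \<mu> (1 - F j))"
      using D by (intro sum_mono) auto
    also have "\<dots> \<le> (\<Sum>j<R. mdgap \<mu> (1 - F j))"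
      using F by (intro sum_mono2) (auto intro!: mdgap_nonneg)
    finally have sum: "real R / 4 * q \<le> (\<Sum>j<R. mdgap \<mu> (1 - F j))" .
    have "real R / 4 * q = A / (4 * g)" using R4 by (simp add: q_def)
    moreover have "1 + ln (1 / e) \<le> A / (4 * g)"
    proof -
      have pos: "0 < 1 + max 0 (ln (1 / e))" by simp
      have "g * (4 * (1 + max 0 (ln (1 / e)))) \<le> A"
        using g(4) pos by (subst (asm) pos_le_divide_eq) auto
      then have "1 + max 0 (ln (1 / e)) \<le> A / (4 * g)"
        using g(1) by (simp add: field_simps)
      then show ?thesis by linarith
    qed
    ultimately have gap_sum: "1 + ln (1 / e) \<le> (\<Sum>j<R. mdgap \<mu> (1 - F j))" using sum by linarith
    have "measure (kesten_measure \<mu>) {\<omega>. volume \<omega> R < h * real R powr vdim}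
        \<le> exp 1 * lap_special \<mu> (exp (- l)) R"
      using prob_volume_less[OF l(1), of R] unfolding \<open>1 / l = _\<close> .
    also have "\<dots> \<le> exp 1 * exp (- (\<Sum>j<R. mdgap \<mu> (1 - F j)))"
      unfolding F_def using s by (intro mult_left_mono lap_special_le_exp) auto
    also have "\<dots> \<le> exp 1 * exp (- (1 + ln (1 / e)))"
      using gap_sum by (intro mult_left_mono) auto
    also have "\<dots> = e" using assms by (simp add: mult_exp_exp ln_div)
    finally show ?thesis .
  qed
  then show ?thesis using h that by blast
qed

end

section \<open>Measurability of the total mass\<close>

lemma arg_min_on_eq_Eps: "arg_min_on f S = (SOME w. w \<in> {w \<in> S. \<forall>y\<in>S. \<not> f y < f w})"
  by (simp add: arg_min_on_def arg_min_def is_arg_min_def Ball_def)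

text \<open>Ties are broken by \<open>SOME\<close>, but the choice depends only on the set of
  minimisers, which ranges over the finitely many subsets of S.\<close>

lemma measurable_arg_min_on:
  fixes f :: "'a \<Rightarrow> 'b::countable \<Rightarrow> real"
  assumes S: "finite S" and f[measurable]: "\<And>w. (\<lambda>x. f x w) \<in> borel_measurable M"
  shows "(\<lambda>x. arg_min_on (f x) S) \<in> M \<rightarrow>\<^sub>M count_space UNIV"
proof -
  let ?A = "\<lambda>x. {w \<in> S. \<forall>y\<in>S. \<not> f x y < f x w}"
  have "?A \<in> M \<rightarrow>\<^sub>M count_space (Pow S)"
  proof (subst measurable_count_space_eq2, safe)
    fix B assume "B \<subseteq> S"
    then have "?A -` {B} \<inter> space M = {x \<in> space M. \<forall>w\<in>S. w \<in> B \<longleftrightarrow> (\<forall>y\<in>S. \<not> f x y < f x w)}"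
      by auto
    also have "\<dots> \<in> sets M" using S by measurable
    finally show "?A -` {B} \<inter> space M \<in> sets M" .
  qed (use S in auto)
  then have "(\<lambda>x. (\<lambda>B. SOME w. w \<in> B) (?A x)) \<in> M \<rightarrow>\<^sub>M count_space UNIV"
    by (rule measurable_compose) simp
  then show ?thesis by (simp add: arg_min_on_eq_Eps)
qed

text \<open>Tree and clocks are both functions on a general space N, so that the same lemmas cover a
  fixed tree with random clocks, a random tree, and joint measurability in the time
  variable.\<close>

locale random_walk_space =
  fixes N :: "'x measure" and V :: "'x \<Rightarrow> label set" and E :: "'x \<Rightarrow> clocks"
  assumes V [measurable]: "\<And>v. Measurable.pred N (\<lambda>x. v \<in> V x)"
    and fin: "\<And>x v. finite (neighbours (V x) v)"
    and E [measurable]: "\<And>i. (\<lambda>x. E x i) \<in> borel_measurable N"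
begin

lemma measurable_neighbours:
  "(\<lambda>x. neighbours (V x) v) \<in> N \<rightarrow>\<^sub>M count_space {S. finite S}"
proof (subst measurable_count_space_eq_countable, safe)
  show "countable {S :: label set. finite S}"
    by (rule countable_Collect_finite)
  fix S :: "label set"
  have "(\<lambda>x. neighbours (V x) v) -` {S} \<inter> space N =
    {x \<in> space N. \<forall>w. (w \<in> V x \<and> (\<exists>i. w = i # v \<or> v = i # w)) \<longleftrightarrow> w \<in> S}"
    by (auto simp: neighbours_def)
  also have "\<dots> \<in> sets N" by measurable
  finally show "(\<lambda>x. neighbours (V x) v) -` {S} \<inter> space N \<in> sets N" .
qed (use fin in auto)

lemma measurable_jump_chain [measurable]:
  "(\<lambda>x. jump_chain (V x) (E x) n) \<in> N \<rightarrow>\<^sub>M count_space UNIV"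
proof (induction n)
  case (Suc n)
  have "(\<lambda>x. arg_min_on (\<lambda>w. E x (n, w)) (neighbours (V x) v)) \<in> N \<rightarrow>\<^sub>M count_space UNIV" for v
  proof (rule measurable_compose_countable'[where f="\<lambda>S x. arg_min_on (\<lambda>w. E x (n, w)) S" and I="{S. finite S}"])
    show "(\<lambda>x. arg_min_on (\<lambda>w. E x (n, w)) S) \<in> N \<rightarrow>\<^sub>M count_space UNIV" if "S \<in> {S. finite S}" for S
      using that by (intro measurable_arg_min_on) auto
    show "(\<lambda>x. neighbours (V x) v) \<in> N \<rightarrow>\<^sub>M count_space {S. finite S}" by (rule measurable_neighbours)
    show "countable {S :: label set. finite S}" by (rule countable_Collect_finite)
  qed
  then show ?case unfolding jump_chain.simps
    by (rule measurable_compose_countable[where f="\<lambda>v x. arg_min_on (\<lambda>w. E x (n, w)) (neighbours (V x) v)", OF _ Suc])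
qed simp

lemma measurable_jump_time [measurable]: "(\<lambda>x. jump_time (V x) (E x) n) \<in> borel_measurable N"
proof -
  have "(\<lambda>x. E x (k, jump_chain (V x) (E x) (Suc k))) \<in> borel_measurable N" for k
    by (rule measurable_compose_countable[where f="\<lambda>w x. E x (k, w)", OF E measurable_jump_chain])
  then show ?thesis unfolding jump_time_def by (intro borel_measurable_sum) auto
qed

lemma measurable_walk:
  assumes [measurable]: "S \<in> borel_measurable N"
  shows "(\<lambda>x. walk (V x) (E x) (S x)) \<in> N \<rightarrow>\<^sub>M count_space UNIV"
proof -
  have L[measurable]: "(\<lambda>x. LEAST n. S x < jump_time (V x) (E x) (Suc n)) \<in> N \<rightarrow>\<^sub>M count_space UNIV"
    by measurable
  have "(\<lambda>x. jump_chain (V x) (E x) (LEAST n. S x < jump_time (V x) (E x) (Suc n))) \<in> N \<rightarrow>\<^sub>M count_space UNIV"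
    by (rule measurable_compose_countable[where f="\<lambda>n x. jump_chain (V x) (E x) n", OF measurable_jump_chain L])
  then have [measurable]: "(\<lambda>x. Some (jump_chain (V x) (E x) (LEAST n. S x < jump_time (V x) (E x) (Suc n)))) \<in> N \<rightarrow>\<^sub>M count_space UNIV"
    by (rule measurable_compose) simp
  show ?thesis unfolding walk_def by measurable
qed

end

lemma space_clock [simp]: "space clock_measure = UNIV"
  by (simp add: clock_measure_def space_PiM)

lemma prob_space_clock: "prob_space clock_measure"
  unfolding clock_measure_def by (intro prob_space_PiM prob_space_exponential_density) simp

lemma measurable_clock [measurable]: "(\<lambda>E. E i) \<in> borel_measurable clock_measure"
  unfolding clock_measure_def by (rule measurable_compose[OF measurable_component_singleton]) auto

lemma measurable_pam:
  fixes V :: "'x \<Rightarrow> label set" and \<xi> :: "'x \<Rightarrow> label \<Rightarrow> real"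
  assumes V [measurable]: "\<And>v. Measurable.pred N (\<lambda>x. v \<in> V x)"
    and fin: "\<And>x v. finite (neighbours (V x) v)"
    and xi [measurable]: "\<And>v. (\<lambda>x. \<xi> x v) \<in> borel_measurable N"
  shows "(\<lambda>x. pam (V x) (\<xi> x) t v) \<in> borel_measurable N"
proof -
  interpret clock: prob_space clock_measure by (rule prob_space_clock)
  interpret W: random_walk_space "N \<Otimes>\<^sub>M clock_measure" "\<lambda>x. V (fst x)" "\<lambda>x. snd x"
    by unfold_locales (use fin in auto)
  interpret WT: random_walk_space "(N \<Otimes>\<^sub>M clock_measure) \<Otimes>\<^sub>M lborel" "\<lambda>x. V (fst (fst x))" "\<lambda>x. snd (fst x)"
    by unfold_locales (use fin in auto)
  have [measurable]: "(\<lambda>x. walk (V (fst x)) (snd x) t) \<in> (N \<Otimes>\<^sub>M clock_measure) \<rightarrow>\<^sub>M count_space UNIV"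
    by (rule W.measurable_walk) simp
  have w: "(\<lambda>x. walk (V (fst (fst x))) (snd (fst x)) (snd x)) \<in> (N \<Otimes>\<^sub>M clock_measure) \<Otimes>\<^sub>M lborel \<rightarrow>\<^sub>M count_space UNIV"
    by (rule WT.measurable_walk) simp
  have [measurable]: "(\<lambda>x. \<xi> (fst (fst x)) (the (walk (V (fst (fst x))) (snd (fst x)) (snd x)))) \<in>
      borel_measurable ((N \<Otimes>\<^sub>M clock_measure) \<Otimes>\<^sub>M lborel)"
    by (rule measurable_compose_countable[where f="\<lambda>w x. \<xi> (fst (fst x)) (the w)", OF _ w]) measurable
  have [measurable]: "(\<lambda>x. LINT s:{0..t}|lborel. \<xi> (fst x) (the (walk (V (fst x)) (snd x) s))) \<in>
      borel_measurable (N \<Otimes>\<^sub>M clock_measure)"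
    unfolding set_lebesgue_integral_def
    by (rule lborel.borel_measurable_lebesgue_integral) (simp add: case_prod_beta')
  have [measurable]: "Measurable.pred (N \<Otimes>\<^sub>M clock_measure) (\<lambda>x. walk (V (fst x)) (snd x) t = Some v)"
    by measurable
  show ?thesis
    unfolding pam_def
  proof (rule clock.borel_measurable_nn_integral)
    have "(\<lambda>x. ennreal (exp (LINT s:{0..t}|lborel. \<xi> (fst x) (the (walk (V (fst x)) (snd x) s)))) *
       (if walk (V (fst x)) (snd x) t = Some v then 1 else 0)) \<in> borel_measurable (N \<Otimes>\<^sub>M clock_measure)"
      by measurable
    then show "(\<lambda>(x, E). ennreal (exp (LINT s:{0..t}|lborel. \<xi> x (the (walk (V x) E s)))) *
       indicator {E. walk (V x) E t = Some v} E) \<in> borel_measurable (N \<Otimes>\<^sub>M clock_measure)"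
      by (simp add: case_prod_beta' indicator_def)
  qed
qed

text \<open>The index set is now countable and does not depend on V, so measurability in a random
  tree reduces to that of single values of \<open>pam\<close>.\<close>

lemma total_mass_eq_SUP:
  "total_mass V \<xi> t = (SUP F\<in>{F. finite F}. if F \<subseteq> V then \<Sum>v\<in>F. pam V \<xi> t v else 0)"
proof -
  have "total_mass V \<xi> t = (SUP F\<in>{F. finite F \<and> F \<subseteq> V}. \<Sum>v\<in>F. pam V \<xi> t v)"
    unfolding total_mass_def by (rule nonneg_infsum_complete) simp
  also have "\<dots> = (SUP F\<in>{F. finite F}. if F \<subseteq> V then \<Sum>v\<in>F. pam V \<xi> t v else 0)"
  proof (rule antisym)
    show "(SUP F\<in>{F. finite F}. if F \<subseteq> V then \<Sum>v\<in>F. pam V \<xi> t v else 0)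
      \<le> (SUP F\<in>{F. finite F \<and> F \<subseteq> V}. \<Sum>v\<in>F. pam V \<xi> t v)"
      by (intro SUP_least) (auto intro: SUP_upper)
    show "(SUP F\<in>{F. finite F \<and> F \<subseteq> V}. \<Sum>v\<in>F. pam V \<xi> t v)
      \<le> (SUP F\<in>{F. finite F}. if F \<subseteq> V then \<Sum>v\<in>F. pam V \<xi> t v else 0)"
    proof (rule SUP_least)
      fix F assume "F \<in> {F. finite F \<and> F \<subseteq> V}"
      then show "(\<Sum>v\<in>F. pam V \<xi> t v) \<le> (SUP F\<in>{F. finite F}. if F \<subseteq> V then \<Sum>v\<in>F. pam V \<xi> t v else 0)"
        by (intro SUP_upper2[of F]) simp_all
    qed
  qed
  finally show ?thesis .
qed

lemma measurable_total_mass: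
  fixes V :: "'x \<Rightarrow> label set" and \<xi> :: "'x \<Rightarrow> label \<Rightarrow> real"
  assumes V [measurable]: "\<And>v. Measurable.pred N (\<lambda>x. v \<in> V x)"
    and fin: "\<And>x v. finite (neighbours (V x) v)"
    and xi [measurable]: "\<And>v. (\<lambda>x. \<xi> x v) \<in> borel_measurable N"
  shows "(\<lambda>x. total_mass (V x) (\<xi> x) t) \<in> borel_measurable N"
  unfolding total_mass_eq_SUP
proof (rule borel_measurable_SUP)
  show "countable {F :: label set. finite F}" by (rule countable_Collect_finite)
  fix F :: "label set" assume "F \<in> {F. finite F}"
  then have [measurable]: "finite F" by simp
  have [measurable]: "(\<lambda>x. pam (V x) (\<xi> x) t v) \<in> borel_measurable N" for v
    by (rule measurable_pam[OF V fin xi])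
  have "Measurable.pred N (\<lambda>x. \<forall>v\<in>F. v \<in> V x)" using \<open>finite F\<close> by measurable
  then show "(\<lambda>x. if F \<subseteq> V x then \<Sum>v\<in>F. pam (V x) (\<xi> x) t v else 0) \<in> borel_measurable N"
    unfolding subset_eq by measurable
qed

section \<open>Hitting probabilities of the random walk\<close>

abbreviation "exp_law \<equiv> density lborel (exponential_density 1)"

lemma prob_space_exp_law: "prob_space exp_law"
  by (rule prob_space_exponential_density) simp

lemma emeasure_exp_law:
  assumes "0 \<le> u"
  shows "emeasure exp_law {u..} = ennreal (exp (- u))" "emeasure exp_law {u<..} = ennreal (exp (- u))"
    "emeasure exp_law {0..u} = ennreal (1 - exp (- u))" "emeasure exp_law {0<..} = 1"
proof -
  interpret L: prob_space exp_law by (rule prob_space_exp_law)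
  have D: "distributed exp_law lborel (\<lambda>x. x) (exponential_density 1)"
    unfolding distributed_def by (auto simp: distr_id2)
  have gt: "L.prob {u<..} = exp (- u)" if "0 \<le> u" for u
    using L.exponential_distributedD_gt[OF D that] by (simp add: greaterThan_def)
  have ne: "AE x in exp_law. x \<noteq> u"
    by (subst AE_density) (auto intro: AE_mp[OF AE_lborel_singleton])
  have "L.prob {u..} = L.prob {u<..}"
  proof (rule L.finite_measure_eq_AE)
    show "AE x in exp_law. (x \<in> {u..}) = (x \<in> {u<..})" using ne by eventually_elim auto
  qed auto
  then show "emeasure exp_law {u..} = ennreal (exp (- u))" "emeasure exp_law {u<..} = ennreal (exp (- u))"
    using gt assms by (auto simp: L.emeasure_eq_measure)
  have g0: "emeasure exp_law {0<..} = 1" using gt[of 0] by (simp add: L.emeasure_eq_measure)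
  then show "emeasure exp_law {0<..} = 1" .
  have "AE x in exp_law. 0 < x" using g0 L.AE_in_set_eq_1[of "{0<..}"] by (simp add: L.emeasure_eq_measure)
  then have "L.prob {0..u} = L.prob (UNIV - {u<..})"
    by (intro L.finite_measure_eq_AE) auto
  also have "\<dots> = 1 - exp (- u)" using L.prob_compl[of "{u<..}"] gt assms by simp
  finally show "emeasure exp_law {0..u} = ennreal (1 - exp (- u))" by (simp add: L.emeasure_eq_measure)
qed

lemma AE_clock_pos: "AE E in clock_measure. \<forall>i. 0 < E i"
proof -
  interpret L: prob_space exp_law by (rule prob_space_exp_law)
  have "AE x in exp_law. 0 < x"
    using emeasure_exp_law(4)[of 0] L.AE_in_set_eq_1[of "{0<..}"] by (simp add: L.emeasure_eq_measure)
  then have "AE E in clock_measure. 0 < E i" for i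
    unfolding clock_measure_def by (intro AE_PiM_component prob_space_exp_law) auto
  then show ?thesis by (simp add: AE_all_countable)
qed

text \<open>The continuous counterpart of \<open>nn_integral_coordinate_split\<close>: replacing
  coordinate v by an independent copy preserves the product law, and \<open>h x\<close> does not see
  that coordinate.\<close>

lemma nn_integral_resample:
  fixes P :: "'b measure" and h :: "'b \<Rightarrow> ('a \<Rightarrow> 'b) \<Rightarrow> ennreal"
  assumes PS: "prob_space P" and h[measurable]: "case_prod h \<in> borel_measurable (P \<Otimes>\<^sub>M PiM UNIV (\<lambda>_. P))"
    and dep: "\<And>x \<omega> y. h x (fun_upd \<omega> v y) = h x \<omega>"
  shows "(\<integral>\<^sup>+\<omega>. h (\<omega> v) \<omega> \<partial>PiM UNIV (\<lambda>_. P)) = (\<integral>\<^sup>+x. (\<integral>\<^sup>+\<omega>. h x \<omega> \<partial>PiM UNIV (\<lambda>_. P)) \<partial>P)"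
proof -
  let ?M = "PiM (UNIV :: 'a set) (\<lambda>_. P)"
  interpret P: prob_space P by fact
  interpret M: prob_space ?M by (intro prob_space_PiM PS)
  interpret pair_sigma_finite P ?M ..
  have eq: "distr (P \<Otimes>\<^sub>M ?M) ?M (\<lambda>(x, X). fun_upd X v x) = ?M"
    using distr_pair_PiM_eq_PiM[of UNIV "\<lambda>_. P" v] PS by simp
  have upd[measurable]: "(\<lambda>(x, X). fun_upd X v x) \<in> P \<Otimes>\<^sub>M ?M \<rightarrow>\<^sub>M ?M"
    unfolding case_prod_beta' by (rule measurable_fun_upd[where J=UNIV]) auto
  have diag: "(\<lambda>\<omega>. h (\<omega> v) \<omega>) \<in> borel_measurable ?M"
    using measurable_compose[OF measurable_Pair[OF measurable_component_singleton measurable_ident_sets[OF refl]] h]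
    by simp
  have "(\<integral>\<^sup>+\<omega>. h (\<omega> v) \<omega> \<partial>?M) = (\<integral>\<^sup>+\<omega>. h (\<omega> v) \<omega> \<partial>distr (P \<Otimes>\<^sub>M ?M) ?M (\<lambda>(x, X). fun_upd X v x))"
    by (simp add: eq)
  also have "\<dots> = (\<integral>\<^sup>+z. h (fst z) (snd z) \<partial>(P \<Otimes>\<^sub>M ?M))"
    by (subst nn_integral_distr[OF upd]) (use diag in \<open>simp_all add: case_prod_beta' dep\<close>)
  also have "\<dots> = (\<integral>\<^sup>+x. (\<integral>\<^sup>+\<omega>. h x \<omega> \<partial>?M) \<partial>P)"
    by (subst M.nn_integral_fst[symmetric]) (auto simp: case_prod_beta')
  finally show ?thesis .
qed

text \<open>With n clocks, the clock of y has density exp (- u), the n - 1 others exceed u with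
  probability exp (- (n - 1) u), and the discount is exp (- b u): an exponential density of rate n +
  b up to its constant. The weak inequalities cover any choice made in a tie.\<close>

lemma jump_weight:
  assumes S: "finite S" "y \<in> S" and b: "0 \<le> b"
  shows "(\<integral>\<^sup>+E. indicator {E. \<forall>w\<in>S. E (k, y) \<le> E (k, w)} E * ennreal (exp (- b * E (k, y))) \<partial>clock_measure)
    \<le> ennreal (1 / (real (card S) + b))"
proof -
  define n where "n = card S"
  have n: "0 < n" using S by (auto simp: n_def card_gt_0_iff)
  define h where "h u E = indicator {E. \<forall>w\<in>S - {y}. u \<le> E (k, w)} E * ennreal (exp (- b * u))" for u :: real and E :: clocks
  have cong: "indicator {E. \<forall>w\<in>S. E (k, y) \<le> E (k, w)} E * ennreal (exp (- b * E (k, y))) = h (E (k, y)) E" for E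
    using S by (auto simp: h_def indicator_def)
  have meas: "case_prod h \<in> borel_measurable (exp_law \<Otimes>\<^sub>M PiM UNIV (\<lambda>_. exp_law))"
  proof -
    have [measurable]: "(\<lambda>E. E i) \<in> borel_measurable (PiM UNIV (\<lambda>_. exp_law))" for i :: "nat \<times> label"
      using measurable_clock[of i] by (simp add: clock_measure_def)
    have [measurable]: "Measurable.pred (exp_law \<Otimes>\<^sub>M PiM UNIV (\<lambda>_. exp_law)) (\<lambda>x. \<forall>w\<in>S - {y}. fst x \<le> (snd x) (k, w))"
      using S by measurable
    have "(\<lambda>x. (if \<forall>w\<in>S - {y}. fst x \<le> (snd x) (k, w) then 1 else 0) * ennreal (exp (- b * fst x)))
      \<in> borel_measurable (exp_law \<Otimes>\<^sub>M PiM UNIV (\<lambda>_. exp_law))" by measurable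
    then show ?thesis by (simp add: h_def indicator_def case_prod_beta' cong: if_cong)
  qed
  have inner: "(\<integral>\<^sup>+E. h u E \<partial>PiM UNIV (\<lambda>_. exp_law)) = ennreal (exp (- (real n - 1) * u) * exp (- b * u))" if u: "0 \<le> u" for u
  proof -
    have set: "{E. \<forall>w\<in>S - {y}. u \<le> E (k, w)} = {E. \<forall>i\<in>Pair k ` (S - {y}). E i \<in> {u..}}" by auto
    have "emeasure (PiM UNIV (\<lambda>_. exp_law)) {E. \<forall>i\<in>Pair k ` (S - {y}). E i \<in> {u..}} = (\<Prod>i\<in>Pair k ` (S - {y}). emeasure exp_law {u..})"
      using S by (intro emeasure_PiM_cylinder prob_space_exp_law) auto
    also have "\<dots> = ennreal (exp (- u)) ^ (n - 1)"
      using S u by (simp add: emeasure_exp_law card_image inj_on_def n_def)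
    also have "\<dots> = ennreal (exp (- (real n - 1) * u))"
      using n by (simp add: ennreal_power exp_of_nat_mult[symmetric] of_nat_diff algebra_simps)
    finally have em: "emeasure (PiM UNIV (\<lambda>_. exp_law)) {E. \<forall>w\<in>S - {y}. u \<le> E (k, w)} = ennreal (exp (- (real n - 1) * u))"
      unfolding set .
    have "{E. \<forall>w\<in>S - {y}. u \<le> E (k, w)} \<in> sets (PiM UNIV (\<lambda>_. exp_law))"
      using em by (intro emeasure_neq_0_sets) (simp add: ennreal_eq_0_iff)
    then show ?thesis unfolding h_def
      by (subst nn_integral_multc) (auto simp: em ennreal_mult)
  qed
  have "(\<integral>\<^sup>+E. indicator {E. \<forall>w\<in>S. E (k, y) \<le> E (k, w)} E * ennreal (exp (- b * E (k, y))) \<partial>clock_measure)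
    = (\<integral>\<^sup>+u. (\<integral>\<^sup>+E. h u E \<partial>PiM UNIV (\<lambda>_. exp_law)) \<partial>exp_law)"
    unfolding cong clock_measure_def
    by (rule nn_integral_resample[OF prob_space_exp_law meas]) (auto simp: h_def indicator_def)
  also have "\<dots> = (\<integral>\<^sup>+u. ennreal (exponential_density 1 u) * (\<integral>\<^sup>+E. h u E \<partial>PiM UNIV (\<lambda>_. exp_law)) \<partial>lborel)"
  proof (rule nn_integral_density)
    have "(\<lambda>u. \<integral>\<^sup>+E. h u E \<partial>PiM UNIV (\<lambda>_. exp_law)) \<in> borel_measurable exp_law"
      by (rule sigma_finite_measure.borel_measurable_nn_integral[OF _ meas])
         (intro prob_space_imp_sigma_finite prob_space_PiM prob_space_exp_law)
    then show "(\<lambda>u. \<integral>\<^sup>+E. h u E \<partial>PiM UNIV (\<lambda>_. exp_law)) \<in> borel_measurable lborel" by simp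
  qed simp
  also have "\<dots> = (\<integral>\<^sup>+u. ennreal (1 / (real n + b)) * ennreal (exponential_density (real n + b) u) \<partial>lborel)"
  proof (rule nn_integral_cong)
    fix u :: real
    show "ennreal (exponential_density 1 u) * (\<integral>\<^sup>+E. h u E \<partial>PiM UNIV (\<lambda>_. exp_law)) =
      ennreal (1 / (real n + b)) * ennreal (exponential_density (real n + b) u)"
    proof (cases "u < 0")
      case False
      have "exp (- u) * (exp (- (real n - 1) * u) * exp (- b * u)) = exp (- u * (real n + b))"
        by (simp add: mult_exp_exp algebra_simps)
      moreover have "(real n + b) \<noteq> 0" using n b by simp
      moreover have "0 \<le> u" using False by simp
      ultimately show ?thesis
        unfolding inner[OF \<open>0 \<le> u\<close>]
        using False n b by (simp add: exponential_density_def ennreal_mult'[symmetric])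
    qed (simp add: exponential_density_def)
  qed
  also have "\<dots> = ennreal (1 / (real n + b)) * emeasure (density lborel (exponential_density (real n + b))) UNIV"
    by (simp add: nn_integral_cmult emeasure_density)
  also have "emeasure (density lborel (exponential_density (real n + b))) UNIV = 1"
    using prob_space.emeasure_space_1[OF prob_space_exponential_density[of "real n + b"]] n b by simp
  finally show ?thesis by (simp add: n_def)
qed

section \<open>Discounted hitting times on a fixed tree\<close>

locale walk_tree =
  fixes V :: "label set"
  assumes root: "[] \<in> V"
    and closed: "\<And>i v. i # v \<in> V \<Longrightarrow> v \<in> V"
    and fin: "\<And>v. finite (neighbours V v)"
    and nonempty: "\<And>v. v \<in> V \<Longrightarrow> neighbours V v \<noteq> {}"
begin

sublocale walk_clock: random_walk_space clock_measure "\<lambda>_. V" "\<lambda>E. E"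
  by unfold_locales (use fin in auto)

sublocale clock: prob_space clock_measure
  by (rule prob_space_clock)

abbreviation "ch \<equiv> jump_chain V"
abbreviation "jt \<equiv> jump_time V"
abbreviation "nb \<equiv> neighbours V"
abbreviation "deg v \<equiv> card (nb v)"

lemma nb_subset: "nb v \<subseteq> V"
  by (auto simp: neighbours_def)

lemma deg_pos: "v \<in> V \<Longrightarrow> 0 < deg v"
  using fin nonempty by (simp add: card_gt_0_iff)

lemma chain_in: "ch E n \<in> V" and chain_step: "ch E (Suc n) \<in> nb (ch E n)"
proof (induction n)
  case 0
  { case 1 show ?case by (simp add: root) }
  { case 2 show ?case using fin nonempty[OF root] by (simp add: arg_min_if_finite) }
next
  case (Suc n)
  { case 1 show ?case using Suc nb_subset by blast }
  with Suc show "ch E (Suc (Suc n)) \<in> nb (ch E (Suc n))"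
    by (subst jump_chain.simps(2)) (rule arg_min_if_finite(1)[OF fin nonempty])
qed

lemma chain_min: "w \<in> nb (ch E n) \<Longrightarrow> E (n, ch E (Suc n)) \<le> E (n, w)"
  using arg_min_least[OF fin[of "ch E n"] nonempty[OF chain_in], of w "\<lambda>w. E (n, w)"]
  by simp

lemma jt_Suc: "jt E (Suc n) = jt E n + E (n, ch E (Suc n))"
  by (simp add: jump_time_def)

lemma jt_0 [simp]: "jt E 0 = 0"
  by (simp add: jump_time_def)

lemma jt_mono: "\<forall>i. 0 < E i \<Longrightarrow> m \<le> n \<Longrightarrow> jt E m \<le> jt E n"
  by (rule lift_Suc_mono_le[of "jt E"]) (auto simp: jt_Suc less_imp_le)

text \<open>\<open>hit_discount v b E k n\<close> is \<open>exp (- b \<tau>)\<close>, where \<open>\<tau>\<close> is the time from the \<open>n\<close>-th jump to the first visit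
  of \<open>v\<close> (and \<open>0\<close> if there is none within \<open>k\<close> further jumps); \<open>hit_weight v b k x\<close> is its expectation given
  that the walk is at \<open>x\<close>.\<close>
primrec hit_weight :: "label \<Rightarrow> real \<Rightarrow> nat \<Rightarrow> label \<Rightarrow> real" where
  "hit_weight v b 0 x = (if x = v then 1 else 0)"
| "hit_weight v b (Suc k) x = (if x = v then 1 else (\<Sum>y\<in>nb x. hit_weight v b k y) / (real (deg x) + b))"

primrec hit_discount :: "label \<Rightarrow> real \<Rightarrow> clocks \<Rightarrow> nat \<Rightarrow> nat \<Rightarrow> real" where
  "hit_discount v b E 0 n = (if ch E n = v then 1 else 0)"
| "hit_discount v b E (Suc k) n = (if ch E n = v then 1 else
     exp (- b * E (n, ch E (Suc n))) * hit_discount v b E k (Suc n))"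

lemma hit_weight_nonneg: "0 \<le> b \<Longrightarrow> 0 \<le> hit_weight v b k x"
  by (induction k arbitrary: x) (auto intro!: divide_nonneg_nonneg sum_nonneg)

lemma hit_discount_nonneg: "0 \<le> hit_discount v b E k n"
  by (induction k arbitrary: n) auto

lemma measurable_hit_discount [measurable]: "(\<lambda>E. hit_discount v b E k n) \<in> borel_measurable clock_measure"
proof (induction k arbitrary: n)
  case (Suc k)
  have [measurable]: "(\<lambda>E. hit_discount v b E k n) \<in> borel_measurable clock_measure" for n by (rule Suc)
  have [measurable]: "(\<lambda>E. E (n, ch E (Suc n))) \<in> borel_measurable clock_measure"
    by (rule measurable_compose_countable[where f="\<lambda>w E. E (n, w)"]) measurable
  show ?case unfolding hit_discount.simps by measurable
qed simp

abbreviation follows :: "nat \<Rightarrow> (nat \<Rightarrow> label) \<Rightarrow> clocks set" where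
  "follows n p \<equiv> {E. \<forall>k\<le>n. ch E k = p k}"

text \<open>Following p means that at each jump k the clock of \<open>p (Suc k)\<close> is minimal
  among the clocks (k, w). Different jumps use disjoint clocks, so the weight is a product of the
  factors from \<open>jump_weight\<close>.\<close>

lemma path_weight:
  assumes b: "0 \<le> b" and p: "\<And>k. k < n \<Longrightarrow> p (Suc k) \<in> nb (p k)" 
  shows "(\<integral>\<^sup>+E. indicator (follows n p) E * ennreal (exp (- b * jt E n)) \<partial>clock_measure)
    \<le> ennreal (\<Prod>k<n. 1 / (real (deg (p k)) + b))"
proof -
  define g where "g k E = indicator {E. \<forall>w\<in>nb (p k). E (k, p (Suc k)) \<le> E (k, w)} E * ennreal (exp (- b * E (k, p (Suc k))))"
    for k and E :: clocks
  have gm: "g k \<in> borel_measurable clock_measure" for k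
  proof -
    have le[measurable]: "Measurable.pred clock_measure (\<lambda>E. E i \<le> E j)" for i j
      using borel_measurable_le[OF measurable_clock measurable_clock] by (simp add: pred_def)
    have [measurable]: "Measurable.pred clock_measure (\<lambda>E. \<forall>w\<in>nb (p k). E (k, p (Suc k)) \<le> E (k, w))"
      by (intro pred_intros_finite fin le)
    have "(\<lambda>E. (if \<forall>w\<in>nb (p k). E (k, p (Suc k)) \<le> E (k, w) then 1 else 0) * ennreal (exp (- b * E (k, p (Suc k)))))
      \<in> borel_measurable clock_measure" by measurable
    then show ?thesis by (simp add: g_def[abs_def] indicator_def cong: if_cong)
  qed
  have "(\<integral>\<^sup>+E. indicator (follows n p) E * ennreal (exp (- b * jt E n)) \<partial>clock_measure)
    \<le> (\<integral>\<^sup>+E. (\<Prod>k<n. g k E) \<partial>clock_measure)"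
  proof (rule nn_integral_mono)
    fix E
    show "indicator (follows n p) E * ennreal (exp (- b * jt E n)) \<le> (\<Prod>k<n. g k E)"
    proof (cases "\<forall>k\<le>n. ch E k = p k")
      case True
      have "g k E = ennreal (exp (- b * E (k, p (Suc k))))" if "k < n" for k
        using chain_min[of _ E k] True that by (simp add: g_def Suc_leI less_imp_le del: jump_chain.simps)
      then have "(\<Prod>k<n. g k E) = (\<Prod>k<n. ennreal (exp (- b * E (k, p (Suc k)))))"
        by (intro prod.cong) auto
      also have "\<dots> = ennreal (exp (\<Sum>k<n. - b * E (k, p (Suc k))))"
        by (simp add: prod_ennreal exp_sum)
      also have "(\<Sum>k<n. - b * E (k, p (Suc k))) = - b * jt E n"
        using True by (simp add: jump_time_def sum_distrib_left sum_negf Suc_leI del: jump_chain.simps)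
      finally show ?thesis using True by simp
    qed simp
  qed
  also have "\<dots> = (\<Prod>k<n. \<integral>\<^sup>+E. g k E \<partial>clock_measure)"
    unfolding clock_measure_def
  proof (rule nn_integral_prod_blocks[where J="\<lambda>k. Pair k ` UNIV"])
    show "g k E = g k E'" if "\<And>j. j \<in> range (Pair k) \<Longrightarrow> E j = E' j" for k E E'
      using that by (auto simp: g_def indicator_def)
  qed (use gm prob_space_exp_law in \<open>auto simp: clock_measure_def disjoint_family_on_def\<close>)
  also have "\<dots> \<le> (\<Prod>k<n. ennreal (1 / (real (deg (p k)) + b)))"
    unfolding g_def by (intro prod_mono_ennreal jump_weight fin p b) auto
  also have "\<dots> = ennreal (\<Prod>k<n. 1 / (real (deg (p k)) + b))"
    using b by (intro prod_ennreal) auto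
  finally show ?thesis .
qed

text \<open>A Markov property without conditional expectations: the past is recorded as an explicit
  path p, and the induction on the number k of jumps still allowed extends p by one vertex, summing
  over the neighbours of its end.\<close>

lemma hit_discount_le:
  assumes b: "0 \<le> b" and p: "\<And>k. k < n \<Longrightarrow> p (Suc k) \<in> nb (p k)" "p 0 = []"
  shows "(\<integral>\<^sup>+E. indicator (follows n p) E * ennreal (exp (- b * jt E n) * hit_discount v b E k n) \<partial>clock_measure)
    \<le> ennreal ((\<Prod>k<n. 1 / (real (deg (p k)) + b)) * hit_weight v b k (p n))"
  using p
proof (induction k arbitrary: n p)
  case 0
  show ?case
  proof (cases "p n = v")
    case True
    have "(\<integral>\<^sup>+E. indicator (follows n p) E * ennreal (exp (- b * jt E n) * hit_discount v b E 0 n) \<partial>clock_measure)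
      \<le> (\<integral>\<^sup>+E. indicator (follows n p) E * ennreal (exp (- b * jt E n)) \<partial>clock_measure)"
      by (intro nn_integral_mono) (auto simp: indicator_def)
    also have "\<dots> \<le> ennreal (\<Prod>k<n. 1 / (real (deg (p k)) + b))" by (rule path_weight) (use b 0 in auto)
    finally show ?thesis using True by simp
  next
    case False
    have "(\<integral>\<^sup>+E. indicator (follows n p) E * ennreal (exp (- b * jt E n) * hit_discount v b E 0 n) \<partial>clock_measure) = (\<integral>\<^sup>+E. 0 \<partial>clock_measure)"
      using False by (intro nn_integral_cong) (auto simp: indicator_def)
    then show ?thesis by simp
  qed
next
  case (Suc k)
  show ?case
  proof (cases "p n = v")
    case True
    have "(\<integral>\<^sup>+E. indicator (follows n p) E * ennreal (exp (- b * jt E n) * hit_discount v b E (Suc k) n) \<partial>clock_measure)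
      \<le> (\<integral>\<^sup>+E. indicator (follows n p) E * ennreal (exp (- b * jt E n)) \<partial>clock_measure)"
      using True by (intro nn_integral_mono) (auto simp: indicator_def)
    also have "\<dots> \<le> ennreal (\<Prod>k<n. 1 / (real (deg (p k)) + b))" by (rule path_weight) (use b Suc.prems in auto)
    finally show ?thesis using True by simp
  next
    case False
    define P where "P y = fun_upd p (Suc n) y" for y
    let ?f = "\<lambda>y E. indicator (follows (Suc n) (P y)) E * ennreal (exp (- b * jt E (Suc n)) * hit_discount v b E k (Suc n))"
    have [measurable]: "Measurable.pred clock_measure (\<lambda>E. \<forall>k\<le>Suc n. ch E k = P y k)" for y
      by measurable
    have fm: "?f y \<in> borel_measurable clock_measure" for y
    proof -
      have "(\<lambda>E. (if \<forall>k\<le>Suc n. ch E k = P y k then 1 else 0) * ennreal (exp (- b * jt E (Suc n)) * hit_discount v b E k (Suc n)))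
         \<in> borel_measurable clock_measure" by measurable
      then show ?thesis by (simp add: indicator_def cong: if_cong del: jump_chain.simps)
    qed
    have "(\<integral>\<^sup>+E. indicator (follows n p) E * ennreal (exp (- b * jt E n) * hit_discount v b E (Suc k) n) \<partial>clock_measure)
      \<le> (\<integral>\<^sup>+E. (\<Sum>y\<in>nb (p n). ?f y E) \<partial>clock_measure)"
    proof (rule nn_integral_mono)
      fix E
      show "indicator (follows n p) E * ennreal (exp (- b * jt E n) * hit_discount v b E (Suc k) n)
        \<le> (\<Sum>y\<in>nb (p n). ?f y E)"
      proof (cases "\<forall>k\<le>n. ch E k = p k")
        case True
        define y where "y = ch E (Suc n)"
        have y: "y \<in> nb (p n)" using chain_step[of E n] True by (simp add: y_def del: jump_chain.simps)
        have "\<forall>k\<le>Suc n. ch E k = P y k"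
          using True by (auto simp: P_def y_def le_Suc_eq simp del: jump_chain.simps)
        moreover have "exp (- b * jt E n) * hit_discount v b E (Suc k) n =
          exp (- b * jt E (Suc n)) * hit_discount v b E k (Suc n)"
          using True False by (simp add: jt_Suc mult_exp_exp algebra_simps exp_add[symmetric] del: jump_chain.simps)
        ultimately have "indicator (follows n p) E * ennreal (exp (- b * jt E n) * hit_discount v b E (Suc k) n) = ?f y E"
          using True by (simp del: jump_chain.simps hit_discount.simps)
        also have "\<dots> \<le> (\<Sum>y\<in>nb (p n). ?f y E)"
          by (rule member_le_sum[OF y _ fin]) simp
        finally show ?thesis .
      qed simp
    qed
    also have "\<dots> = (\<Sum>y\<in>nb (p n). \<integral>\<^sup>+E. ?f y E \<partial>clock_measure)"
      by (rule nn_integral_sum) (rule fm)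
    also have "\<dots> \<le> (\<Sum>y\<in>nb (p n). ennreal ((\<Prod>k<Suc n. 1 / (real (deg (p k)) + b)) * hit_weight v b k y))"
    proof (rule sum_mono)
      fix y assume y: "y \<in> nb (p n)"
      have "(\<integral>\<^sup>+E. ?f y E \<partial>clock_measure) \<le> ennreal ((\<Prod>k<Suc n. 1 / (real (deg (P y k)) + b)) * hit_weight v b k (P y (Suc n)))"
        using Suc.prems y by (intro Suc.IH) (auto simp: P_def less_Suc_eq)
      also have "(\<Prod>k<Suc n. 1 / (real (deg (P y k)) + b)) = (\<Prod>k<Suc n. 1 / (real (deg (p k)) + b))"
        by (intro prod.cong) (auto simp: P_def)
      finally show "(\<integral>\<^sup>+E. ?f y E \<partial>clock_measure) \<le> ennreal ((\<Prod>k<Suc n. 1 / (real (deg (p k)) + b)) * hit_weight v b k y)"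
        by (simp add: P_def)
    qed
    also have "\<dots> = ennreal (\<Sum>y\<in>nb (p n). (\<Prod>k<Suc n. 1 / (real (deg (p k)) + b)) * hit_weight v b k y)"
      using b hit_weight_nonneg by (intro sum_ennreal mult_nonneg_nonneg prod_nonneg) auto
    also have "(\<Sum>y\<in>nb (p n). (\<Prod>k<Suc n. 1 / (real (deg (p k)) + b)) * hit_weight v b k y) =
      (\<Prod>k<n. 1 / (real (deg (p k)) + b)) * hit_weight v b (Suc k) (p n)"
      using False by (simp add: sum_distrib_left[symmetric] sum_divide_distrib[symmetric])
    finally show ?thesis .
  qed
qed

lemma card_suffix_set: "finite {u. suffix u v}" "card {u. suffix u v} = Suc (length v)"
proof -
  have "{u. suffix u v} = set (suffixes v)" by auto
  then show "finite {u. suffix u v}" "card {u. suffix u v} = Suc (length v)"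
    by (simp_all add: distinct_card distinct_suffixes)
qed

text \<open>The number of ancestors of \<open>v\<close> (including \<open>v\<close>) that are not ancestors of \<open>x\<close>: along a step of
  the walk it decreases for at most one of the neighbours, and then by one.\<close>
definition remaining :: "label \<Rightarrow> label \<Rightarrow> nat" where
  "remaining v x = card {u. suffix u v \<and> \<not> suffix u x}"

lemma remaining_self [simp]: "remaining v v = 0"
  by (simp add: remaining_def)

lemma remaining_root: "remaining v [] = length v"
proof -
  have "{u. suffix u v \<and> \<not> suffix u []} = {u. suffix u v} - {[]}" by auto
  then show ?thesis using card_suffix_set[of v] by (simp add: remaining_def)
qed

lemma remaining_step:
  assumes "y \<in> nb x"
  shows "remaining v x \<le> remaining v y \<or> (suffix y v \<and> length y = Suc (length x) \<and> remaining v x \<le> Suc (remaining v y))"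
proof -
  have fin: "finite {u. suffix u v \<and> \<not> suffix u z}" for z
    by (rule finite_subset[OF _ card_suffix_set(1)[of v]]) auto
  consider i where "y = i # x" | i where "x = i # y" using assms by (auto simp: neighbours_def)
  then show ?thesis
  proof cases
    case 1
    have "{u. suffix u v \<and> \<not> suffix u x} \<subseteq> insert y {u. suffix u v \<and> \<not> suffix u y}"
      using 1 by (auto simp: suffix_Cons)
    then have "remaining v x \<le> card (insert y {u. suffix u v \<and> \<not> suffix u y})"
      unfolding remaining_def by (intro card_mono) (use fin in auto)
    also have "\<dots> \<le> Suc (remaining v y)" unfolding remaining_def by (simp add: card_insert_if fin)
    finally have *: "remaining v x \<le> Suc (remaining v y)" .
    show ?thesis
    proof (cases "suffix y v")
      case False
      then have "{u. suffix u v \<and> \<not> suffix u x} \<subseteq> {u. suffix u v \<and> \<not> suffix u y}"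
        using 1 by (auto simp: suffix_Cons)
      then show ?thesis unfolding remaining_def using card_mono[OF fin] by blast
    qed (use * 1 in simp)
  next
    case 2
    have "{u. suffix u v \<and> \<not> suffix u x} \<subseteq> {u. suffix u v \<and> \<not> suffix u y}"
      using 2 by (auto simp: suffix_Cons)
    then show ?thesis unfolding remaining_def using card_mono[OF fin] by blast
  qed
qed

text \<open>exp (- a * remaining) is a supersolution of the recursion for \<open>hit_weight\<close>:
  at most one neighbour contributes exp a = 1 + b times the value at x and the others at most that
  value, so the sum is at most deg + b times it. This is the reason for b = exp a - 1 and for a
  bound free of degrees.\<close>

lemma hit_weight_le:
  assumes a: "0 \<le> a" and b: "b = exp a - 1" and "x \<in> V"
  shows "hit_weight v b k x \<le> exp (- a * real (remaining v x))"
  using \<open>x \<in> V\<close>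
proof (induction k arbitrary: x)
  case (Suc k)
  show ?case
  proof (cases "x = v")
    case False
    let ?e = "\<lambda>y. exp (- a * real (remaining v y))"
    \<comment> \<open>The neighbours one step closer to v, that is, children of x on the way to v.
      Two suffixes of v of equal length coincide, so there is at most one.\<close>
    define T where "T = {y \<in> nb x. suffix y v \<and> length y = Suc (length x)}"
    have T: "T \<subseteq> nb x" "finite T" using fin by (auto simp: T_def)
    have "card T \<le> 1"
    proof -
      have "y = z" if "y \<in> T" "z \<in> T" for y z
        using that suffix_order.antisym suffix_length_suffix[of y v z] suffix_length_suffix[of z v y]
        by (auto simp: T_def)
      then show ?thesis using T by (simp add: card_le_Suc0_iff_eq)
    qed
    have b0: "0 \<le> b" using a b by simp
    have d: "0 < real (deg x) + b" using deg_pos[OF Suc.prems] b0 by linarith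
    have "(\<Sum>y\<in>nb x. hit_weight v b k y) \<le> (\<Sum>y\<in>nb x. ?e x + (if y \<in> T then b * ?e x else 0))"
    proof (rule sum_mono)
      fix y assume y: "y \<in> nb x"
      then have "hit_weight v b k y \<le> ?e y" using nb_subset Suc.IH by blast
      also have "\<dots> \<le> ?e x + (if y \<in> T then b * ?e x else 0)"
      proof (cases "remaining v x \<le> remaining v y")
        case True
        then have "a * real (remaining v x) \<le> a * real (remaining v y)" using a by (intro mult_left_mono) auto
        then have "?e y \<le> ?e x" by simp
        moreover have "0 \<le> (if y \<in> T then b * ?e x else 0)" using b0 by simp
        ultimately show ?thesis by linarith
      next
        case False
        then have *: "y \<in> T" "remaining v x \<le> Suc (remaining v y)"
          using remaining_step[OF y, of v] y by (auto simp: T_def)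
        have "a * real (remaining v x) \<le> a * (real (remaining v y) + 1)"
          using * a by (intro mult_left_mono) auto
        then have "?e y \<le> exp (a + - a * real (remaining v x))" by (simp add: algebra_simps)
        also have "\<dots> = ?e x + b * ?e x" unfolding exp_add b by (simp add: algebra_simps)
        finally show ?thesis using * by simp
      qed
      finally show "hit_weight v b k y \<le> ?e x + (if y \<in> T then b * ?e x else 0)" .
    qed
    also have "\<dots> = real (deg x) * ?e x + real (card T) * (b * ?e x)"
      using T fin by (simp add: sum.distrib sum.If_cases Int_absorb1)
    also have "\<dots> \<le> real (deg x) * ?e x + 1 * (b * ?e x)"
      using \<open>card T \<le> 1\<close> b0 by (intro add_left_mono mult_right_mono) auto
    also have "\<dots> = ?e x * (real (deg x) + b)" by (simp add: algebra_simps)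
    finally show ?thesis using False d by (simp add: pos_divide_le_eq)
  qed simp
qed simp

lemma hit_discount_ge:
  assumes "\<forall>i. 0 < E i" "0 \<le> b" "ch E (n + j) = v" "jt E (n + j) \<le> t" "j \<le> k"
  shows "exp (- b * t) \<le> exp (- b * jt E n) * hit_discount v b E k n"
  using assms(3-)
proof (induction k arbitrary: n j)
  case 0
  then show ?case using assms by (simp add: mult_left_mono)
next
  case (Suc k)
  have le: "jt E n \<le> t" using jt_mono[OF assms(1), of n "n + j"] Suc.prems by simp
  show ?case
  proof (cases "ch E n = v")
    case True
    then show ?thesis using le assms by (simp add: mult_left_mono)
  next
    case False
    then obtain i where i: "j = Suc i" using Suc.prems by (cases j) auto
    have "exp (- b * t) \<le> exp (- b * jt E (Suc n)) * hit_discount v b E k (Suc n)"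
      using Suc.prems by (intro Suc.IH[of "Suc n" i]) (auto simp: i simp del: jump_chain.simps)
    also have "\<dots> = exp (- b * jt E n) * hit_discount v b E (Suc k) n"
      using False by (simp add: jt_Suc algebra_simps exp_add[symmetric] exp_diff del: jump_chain.simps)
    finally show ?thesis .
  qed
qed

definition hit_event :: "real \<Rightarrow> label \<Rightarrow> clocks set" where
  "hit_event t v = {E. \<exists>n. ch E n = v \<and> jt E n \<le> t}"

lemma hit_event_measurable [measurable]: "hit_event t v \<in> sets clock_measure"
proof -
  have "{E \<in> space clock_measure. \<exists>n. ch E n = v \<and> jt E n \<le> t} \<in> sets clock_measure" by measurable
  then show ?thesis by (simp add: hit_event_def)
qed

text \<open>A Chernoff bound: on the event the discounted hitting time is at least exp (- b t). For
  a given vertex the best a is ln (length v / t), when that is nonnegative.\<close>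

lemma prob_hit:
  assumes a: "0 \<le> a"
  shows "emeasure clock_measure (hit_event t v) \<le> ennreal (exp ((exp a - 1) * t - a * real (length v)))"
proof -
  define b where "b = exp a - 1"
  have b: "0 \<le> b" using a by (simp add: b_def)
  \<comment> \<open>\<open>hit_discount\<close> looks only k jumps ahead, so the event is first
    restricted to k jumps and then exhausted.\<close>
  define H where "H k = {E. \<exists>n\<le>k. ch E n = v \<and> jt E n \<le> t}" for k
  have Hm: "H k \<in> sets clock_measure" for k
  proof -
    have "{E \<in> space clock_measure. \<exists>n\<le>k. ch E n = v \<and> jt E n \<le> t} \<in> sets clock_measure" by measurable
    then show ?thesis by (simp add: H_def)
  qed
  have "emeasure clock_measure (H k) \<le> ennreal (exp (b * t - a * real (length v)))" for k
  proof -
    have "emeasure clock_measure (H k) = (\<integral>\<^sup>+E. indicator (H k) E \<partial>clock_measure)" using Hm by simp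
    also have "\<dots> \<le> (\<integral>\<^sup>+E. ennreal (exp (b * t)) * (indicator {E. \<forall>k\<le>0. ch E k = []} E *
       ennreal (exp (- b * jt E 0) * hit_discount v b E k 0)) \<partial>clock_measure)"
    proof (rule nn_integral_mono_AE)
      show "AE E in clock_measure. indicator (H k) E \<le> ennreal (exp (b * t)) * (indicator {E. \<forall>k\<le>0. ch E k = []} E *
       ennreal (exp (- b * jt E 0) * hit_discount v b E k 0))"
        using AE_clock_pos
      proof eventually_elim
        case (elim E)
        show ?case
        proof (cases "E \<in> H k")
          case True
          then obtain j where j: "j \<le> k" "ch E j = v" "jt E j \<le> t" by (auto simp: H_def)
          have "exp (- b * t) \<le> exp (- b * jt E 0) * hit_discount v b E k 0"
            using hit_discount_ge[OF elim b, of 0 j v t k] j by simp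
          then have "exp (b * t) * exp (- b * t) \<le> exp (b * t) * (exp (- b * jt E 0) * hit_discount v b E k 0)"
            by (intro mult_left_mono) auto
          then have "1 \<le> ennreal (exp (b * t) * (exp (- b * jt E 0) * hit_discount v b E k 0))"
            by (simp add: mult_exp_exp del: jt_0)
          then show ?thesis using True hit_discount_nonneg by (simp add: ennreal_mult')
        qed simp
      qed
    qed
    also have "\<dots> = ennreal (exp (b * t)) * (\<integral>\<^sup>+E. indicator {E. \<forall>k\<le>0. ch E k = []} E *
       ennreal (exp (- b * jt E 0) * hit_discount v b E k 0) \<partial>clock_measure)"
      by (rule nn_integral_cmult) simp
    also have "\<dots> \<le> ennreal (exp (b * t)) * ennreal ((\<Prod>k<(0::nat). 1 / (real (deg []) + b)) * hit_weight v b k [])"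
    proof (rule mult_left_mono)
      show "(\<integral>\<^sup>+E. indicator {E. \<forall>k\<le>0. ch E k = []} E * ennreal (exp (- b * jt E 0) * hit_discount v b E k 0) \<partial>clock_measure)
        \<le> ennreal ((\<Prod>k<(0::nat). 1 / (real (deg []) + b)) * hit_weight v b k [])"
        by (rule hit_discount_le[OF b, where p="\<lambda>_. []"]) simp_all
    qed simp
    also have "\<dots> \<le> ennreal (exp (b * t)) * ennreal (exp (- a * real (length v)))"
      using hit_weight_le[OF a b_def root, of v k] by (intro mult_left_mono ennreal_leI) (auto simp: remaining_root)
    also have "\<dots> = ennreal (exp (b * t - a * real (length v)))"
      by (simp add: ennreal_mult'[symmetric] mult_exp_exp)
    finally show ?thesis .
  qed
  then have "(SUP k. emeasure clock_measure (H k)) \<le> ennreal (exp (b * t - a * real (length v)))"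
    by (intro SUP_least) auto
  moreover have "(SUP k. emeasure clock_measure (H k)) = emeasure clock_measure (\<Union>k. H k)"
    using Hm by (intro SUP_emeasure_incseq) (auto simp: H_def incseq_def intro: order_trans)
  moreover have "(\<Union>k. H k) = hit_event t v" by (auto simp: H_def hit_event_def)
  ultimately show ?thesis by (simp add: b_def)
qed

end

section \<open>Bounds on the total mass for a fixed tree\<close>

context walk_tree
begin

lemma walk_SomeE:
  assumes "walk V E s = Some w"
  obtains n where "w = ch E n" "s < jt E (Suc n)" "\<And>m. m < n \<Longrightarrow> jt E (Suc m) \<le> s"
proof -
  have ex: "\<exists>n. s < jt E (Suc n)" using assms by (auto simp: walk_def split: if_splits)
  define n where "n = (LEAST n. s < jt E (Suc n))"
  have "s < jt E (Suc n)" unfolding n_def by (rule LeastI_ex[OF ex])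
  moreover have "jt E (Suc m) \<le> s" if "m < n" for m
    using not_less_Least[of m "\<lambda>n. s < jt E (Suc n)"] that by (simp add: n_def not_less)
  moreover have "w = ch E n" using assms ex by (simp add: walk_def n_def)
  ultimately show ?thesis using that by blast
qed

lemma walk_eqI:
  assumes "s < jt E (Suc n)" "\<And>m. m < n \<Longrightarrow> jt E (Suc m) \<le> s"
  shows "walk V E s = Some (ch E n)"
proof -
  have "(LEAST n. s < jt E (Suc n)) = n"
    using assms by (intro Least_equality) (auto simp: not_less[symmetric])
  then show ?thesis using assms(1) by (auto simp: walk_def)
qed

lemma walk_before:
  assumes "s < jt E (Suc n)"
  obtains k where "k \<le> n" "walk V E s = Some (ch E k)"
proof -
  have "(LEAST n. s < jt E (Suc n)) \<le> n" using assms by (rule Least_le)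
  moreover have "walk V E s = Some (ch E (LEAST n. s < jt E (Suc n)))"
    using assms by (auto simp: walk_def)
  ultimately show ?thesis using that by blast
qed

lemma measurable_walk_event [measurable]: "Measurable.pred clock_measure (\<lambda>E. walk V E t = Some v)"
proof -
  have [measurable]: "(\<lambda>E. walk V E t) \<in> clock_measure \<rightarrow>\<^sub>M count_space UNIV"
    by (rule walk_clock.measurable_walk) simp
  show ?thesis by measurable
qed

lemma measurable_walk_time [measurable]: "(\<lambda>s. f (the (walk V E s)) :: real) \<in> borel_measurable lborel"
proof -
  interpret W: random_walk_space lborel "\<lambda>_. V" "\<lambda>_. E"
    by unfold_locales (use fin in auto)
  have "(\<lambda>s. walk V E s) \<in> lborel \<rightarrow>\<^sub>M count_space UNIV" by (rule W.measurable_walk) simp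
  then show ?thesis by (rule measurable_compose) simp
qed

lemma walk_integral_le:
  assumes t: "0 \<le> t" "t < jt E (Suc n)" and M: "0 \<le> M" "\<And>k. k \<le> n \<Longrightarrow> \<xi> (ch E k) \<le> M"
  shows "(LINT s:{0..t}|lborel. \<xi> (the (walk V E s))) \<le> t * M"
proof (cases "set_integrable lborel {0..t} (\<lambda>s. \<xi> (the (walk V E s)))")
  case True
  have "(LINT s:{0..t}|lborel. \<xi> (the (walk V E s))) \<le> (LINT s:{0..t}|lborel. M)"
  proof (rule set_integral_mono[OF True])
    fix s assume "s \<in> {0..t}"
    then have "s < jt E (Suc n)" using t by simp
    then obtain k where "k \<le> n" "walk V E s = Some (ch E k)" by (rule walk_before)
    then show "\<xi> (the (walk V E s)) \<le> M" using M by simp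
  qed (use t in \<open>simp add: set_integrable_def\<close>)
  also have "\<dots> = t * M" using t by (simp add: set_lebesgue_integral_def)
  finally show ?thesis .
next
  \<comment> \<open>By convention the integral is then 0, and t * M is nonnegative.\<close>
  case False
  then have "(LINT s:{0..t}|lborel. \<xi> (the (walk V E s))) = 0"
    unfolding set_integrable_def set_lebesgue_integral_def by (rule not_integrable_integral_eq)
  then show ?thesis using t M by simp
qed

lemma walk_integral_ge:
  assumes T: "0 \<le> T" "T \<le> t" "t < jt E (Suc n)" and stay: "\<And>s. T \<le> s \<Longrightarrow> s \<le> t \<Longrightarrow> walk V E s = Some v"
    and nonneg: "\<And>w. w \<in> V \<Longrightarrow> 0 \<le> \<xi> w"
  shows "(t - T) * \<xi> v \<le> (LINT s:{0..t}|lborel. \<xi> (the (walk V E s)))"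
proof -
  define B where "B = (\<Sum>k\<le>n. \<xi> (ch E k))"
  have xi: "0 \<le> \<xi> (the (walk V E s)) \<and> \<xi> (the (walk V E s)) \<le> B" if "s \<le> t" for s
  proof -
    have "s < jt E (Suc n)" using that T by simp
    then obtain k where k: "k \<le> n" "walk V E s = Some (ch E k)" by (rule walk_before)
    have "\<xi> (ch E k) \<le> B"
      unfolding B_def using k by (intro member_le_sum) (auto intro!: nonneg chain_in)
    then show ?thesis using k nonneg[OF chain_in] by simp
  qed
  have int: "integrable lborel (\<lambda>s. indicator {0..t} s *\<^sub>R \<xi> (the (walk V E s)))"
  proof (rule integrableI_bounded_set_indicator[where B=B])
    show "AE s in lborel. s \<in> {0..t} \<longrightarrow> norm (\<xi> (the (walk V E s))) \<le> B"
      using xi by (intro AE_I2) auto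
  qed (use T in auto)
  have "(t - T) * \<xi> v = (\<integral>s. indicator {T..t} s *\<^sub>R \<xi> v \<partial>lborel)" using T by simp
  also have "\<dots> \<le> (\<integral>s. indicator {0..t} s *\<^sub>R \<xi> (the (walk V E s)) \<partial>lborel)"
    using int
  proof (rule Bochner_Integration.integral_mono[rotated])
    fix s
    show "indicator {T..t} s *\<^sub>R \<xi> v \<le> indicator {0..t} s *\<^sub>R \<xi> (the (walk V E s))"
      using stay[of s] xi[of s] T by (auto simp: indicator_def)
  qed (use T in simp)
  finally show ?thesis by (simp add: set_lebesgue_integral_def)
qed

lemma chain_hits_level:
  assumes "r \<le> length (ch E n)"
  obtains k where "k \<le> n" "length (ch E k) = r"
proof -
  define k where "k = (LEAST k. r \<le> length (ch E k))"
  have k: "r \<le> length (ch E k)" "k \<le> n"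
    unfolding k_def using assms by (auto intro: LeastI Least_le)
  have "length (ch E k) = r"
  proof (cases k)
    case 0 then show ?thesis using k by simp
  next
    case (Suc j)
    then have "length (ch E j) < r"
      using not_less_Least[of j "\<lambda>k. r \<le> length (ch E k)"] by (simp add: k_def not_le)
    moreover have "length (ch E k) \<le> Suc (length (ch E j))"
      using chain_step[of E j] unfolding Suc by (auto simp: neighbours_def simp del: jump_chain.simps)
    ultimately show ?thesis using k by simp
  qed
  then show ?thesis using that k by blast
qed

text \<open>Paths are classified by the smallest radius R J whose ball contains them up to time t.
  For J = Suc j the potential met is at most \<open>m (Suc j)\<close>, and the walk must have
  visited generation R j by time t; hence the shift of the index between m and R.\<close>

lemma total_mass_upper:
  assumes t: "0 \<le> t" and a: "0 \<le> a" and R: "strict_mono R" and m: "\<And>j. 0 \<le> m j"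
    and xi: "\<And>j v. v \<in> V \<Longrightarrow> length v \<le> R j \<Longrightarrow> \<xi> v \<le> m j"
    and fin_gen: "\<And>j. finite {v \<in> V. length v = R j}"
  shows "total_mass V \<xi> t \<le> ennreal (exp (t * m 0)) +
    (\<Sum>j. ennreal (exp (t * m (Suc j)) * (real (card {v \<in> V. length v = R j}) * exp ((exp a - 1) * t - a * real (R j)))))"
    (is "_ \<le> ?rhs")
proof -
  define gen where "gen j = {v \<in> V. length v = R j}" for j
  define H where "H j = (\<Union>v\<in>gen j. hit_event t v)" for j
  have H[measurable]: "H j \<in> sets clock_measure" for j
    unfolding H_def using fin_gen by (intro sets.finite_UN) (auto simp: gen_def)
  have PH: "emeasure clock_measure (H j) \<le> ennreal (real (card (gen j)) * exp ((exp a - 1) * t - a * real (R j)))" for j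
  proof -
    have "emeasure clock_measure (H j) \<le> (\<Sum>v\<in>gen j. emeasure clock_measure (hit_event t v))"
      unfolding H_def using fin_gen by (intro emeasure_subadditive_finite) (auto simp: gen_def)
    also have "\<dots> \<le> (\<Sum>v\<in>gen j. ennreal (exp ((exp a - 1) * t - a * real (R j))))"
    proof (rule sum_mono)
      fix v assume "v \<in> gen j"
      then have "length v = R j" by (simp add: gen_def)
      then show "emeasure clock_measure (hit_event t v) \<le> ennreal (exp ((exp a - 1) * t - a * real (R j)))"
        using prob_hit[OF a, of t v] by simp
    qed
    also have "\<dots> = ennreal (real (card (gen j)) * exp ((exp a - 1) * t - a * real (R j)))"
      by (simp add: ennreal_mult' flip: ennreal_of_nat_eq_real_of_nat)
    finally show ?thesis .
  qed
  define B where "B E = ennreal (exp (t * m 0)) + (\<Sum>j. ennreal (exp (t * m (Suc j))) * indicator (H j) E)" for E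
  have Bm[measurable]: "B \<in> borel_measurable clock_measure" unfolding B_def by measurable
  have key: "ennreal (exp (LINT s:{0..t}|lborel. \<xi> (the (walk V E s)))) \<le> B E"
    if E: "\<forall>i. 0 < E i" and w: "walk V E t = Some v" for E v
  proof -
    obtain n where n: "v = ch E n" "t < jt E (Suc n)" "\<And>m. m < n \<Longrightarrow> jt E (Suc m) \<le> t"
      using w by (rule walk_SomeE) blast
    have jn: "jt E k \<le> t" if "k \<le> n" for k
    proof (cases k)
      case 0 then show ?thesis using t by simp
    next
      case (Suc j) then show ?thesis using n(3)[of j] that by simp
    qed
    define J where "J = (LEAST j. \<forall>k\<le>n. length (ch E k) \<le> R j)"
    have ex: "\<exists>j. \<forall>k\<le>n. length (ch E k) \<le> R j"
    proof -
      \<comment> \<open>A crude common bound: the sum dominates every depth on the path, and strict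
        monotonicity gives D <= R D.\<close>
      define D where "D = (\<Sum>k\<le>n. length (ch E k))"
      have "length (ch E k) \<le> R D" if "k \<le> n" for k
      proof -
        have "length (ch E k) \<le> D" unfolding D_def using that by (intro member_le_sum) auto
        also have "\<dots> \<le> R D" using R by (rule strict_mono_imp_increasing)
        finally show ?thesis .
      qed
      then show ?thesis by blast
    qed
    have J: "\<forall>k\<le>n. length (ch E k) \<le> R J" unfolding J_def by (rule LeastI_ex[OF ex])
    have "(LINT s:{0..t}|lborel. \<xi> (the (walk V E s))) \<le> t * m J"
      using J by (intro walk_integral_le[OF t n(2) m]) (auto intro!: xi chain_in)
    then have le: "ennreal (exp (LINT s:{0..t}|lborel. \<xi> (the (walk V E s)))) \<le> ennreal (exp (t * m J))"
      by (intro ennreal_leI) simp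
    show ?thesis
    proof (cases J)
      case 0
      then show ?thesis using le unfolding B_def by (intro add_increasing2) auto
    next
      case (Suc j)
      then have "\<not> (\<forall>k\<le>n. length (ch E k) \<le> R j)"
        using not_less_Least[of j "\<lambda>j. \<forall>k\<le>n. length (ch E k) \<le> R j"] by (simp add: J_def)
      then obtain k where k: "k \<le> n" "R j \<le> length (ch E k)" by force
      obtain i where i: "i \<le> k" "length (ch E i) = R j" using k(2) by (rule chain_hits_level)
      have "E \<in> H j"
        using i k jn[of i] chain_in[of E i] unfolding H_def gen_def hit_event_def by fastforce
      then have "ennreal (exp (t * m J)) = (\<Sum>i\<in>{j}. ennreal (exp (t * m (Suc i))) * indicator (H i) E)"
        by (simp add: Suc)
      also have "\<dots> \<le> (\<Sum>i. ennreal (exp (t * m (Suc i))) * indicator (H i) E)"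
        by (rule sum_le_suminf) auto
      also have "\<dots> \<le> B E" unfolding B_def by simp
      finally have "ennreal (exp (t * m J)) \<le> B E" .
      with le show ?thesis by (rule order_trans)
    qed
  qed
  have pam_le: "pam V \<xi> t v \<le> (\<integral>\<^sup>+E. B E * indicator {E. walk V E t = Some v} E \<partial>clock_measure)" for v
    unfolding pam_def
  proof (rule nn_integral_mono_AE)
    show "AE E in clock_measure. ennreal (exp (LINT s:{0..t}|lborel. \<xi> (the (walk V E s)))) * indicator {E. walk V E t = Some v} E
      \<le> B E * indicator {E. walk V E t = Some v} E"
      using AE_clock_pos by eventually_elim (auto simp: indicator_def intro: key)
  qed
  have wm: "{E. walk V E t = Some v} \<in> sets clock_measure" for v
    using measurable_walk_event[of t v] by (simp add: pred_def)
  have BH: "(\<integral>\<^sup>+E. B E \<partial>clock_measure) \<le> ?rhs"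
  proof -
    have "(\<integral>\<^sup>+E. B E \<partial>clock_measure) = ennreal (exp (t * m 0)) +
        (\<Sum>j. \<integral>\<^sup>+E. ennreal (exp (t * m (Suc j))) * indicator (H j) E \<partial>clock_measure)"
      unfolding B_def using clock.emeasure_space_1
      by (subst nn_integral_add) (auto simp: nn_integral_suminf)
    also have "(\<Sum>j. \<integral>\<^sup>+E. ennreal (exp (t * m (Suc j))) * indicator (H j) E \<partial>clock_measure) =
        (\<Sum>j. ennreal (exp (t * m (Suc j))) * emeasure clock_measure (H j))"
      by (simp add: nn_integral_cmult)
    finally have eq: "(\<integral>\<^sup>+E. B E \<partial>clock_measure) = ennreal (exp (t * m 0)) +
        (\<Sum>j. ennreal (exp (t * m (Suc j))) * emeasure clock_measure (H j))" .
    have "(\<Sum>j. ennreal (exp (t * m (Suc j))) * emeasure clock_measure (H j)) \<le>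
        (\<Sum>j. ennreal (exp (t * m (Suc j)) * (real (card {v \<in> V. length v = R j}) * exp ((exp a - 1) * t - a * real (R j)))))"
    proof (rule suminf_le)
      show "ennreal (exp (t * m (Suc j))) * emeasure clock_measure (H j) \<le>
        ennreal (exp (t * m (Suc j)) * (real (card {v \<in> V. length v = R j}) * exp ((exp a - 1) * t - a * real (R j))))" for j
        using PH[of j] by (subst ennreal_mult') (auto simp: gen_def intro!: mult_left_mono)
    qed auto
    then show ?thesis unfolding eq by (rule add_left_mono)
  qed
  show ?thesis
    unfolding total_mass_eq_SUP
  proof (rule SUP_least)
    fix F :: "label set" assume "F \<in> {F. finite F}"
    then have F: "finite F" by simp
    have "(\<Sum>v\<in>F. pam V \<xi> t v) \<le> (\<Sum>v\<in>F. \<integral>\<^sup>+E. B E * indicator {E. walk V E t = Some v} E \<partial>clock_measure)"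
      by (intro sum_mono pam_le)
    also have "\<dots> = (\<integral>\<^sup>+E. (\<Sum>v\<in>F. B E * indicator {E. walk V E t = Some v} E) \<partial>clock_measure)"
      using wm by (intro nn_integral_sum[symmetric]) measurable
    also have "\<dots> \<le> (\<integral>\<^sup>+E. B E \<partial>clock_measure)"
    proof (rule nn_integral_mono)
      fix E
      \<comment> \<open>At time t the walk is at no more than one vertex, so the sum over the
        endpoints costs nothing.\<close>
      have "(\<Sum>v\<in>F. B E * indicator {E. walk V E t = Some v} E) = B E * (\<Sum>v\<in>F. if walk V E t = Some v then 1 else 0)"
        unfolding sum_distrib_left by (intro sum.cong) (auto simp: indicator_def)
      also have "\<dots> \<le> B E * 1"
      proof (rule mult_left_mono)
        show "(\<Sum>v\<in>F. if walk V E t = Some v then 1 else 0) \<le> (1 :: ennreal)"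
          using F by (cases "walk V E t") (auto simp: sum.delta)
      qed simp
      finally show "(\<Sum>v\<in>F. B E * indicator {E. walk V E t = Some v} E) \<le> B E" by simp
    qed
    also have "\<dots> \<le> ?rhs" by (rule BH)
    finally show "(if F \<subseteq> V then \<Sum>v\<in>F. pam V \<xi> t v else 0) \<le> ?rhs" by simp
  qed
qed

lemma suffix_in: "suffix u v \<Longrightarrow> v \<in> V \<Longrightarrow> u \<in> V"
  by (induction v) (auto simp: suffix_Cons closed)

text \<open>The expectation is restricted to an explicit event: at each step towards v the right
  clock rings within 1/B and the others later, and at v no clock rings before time t. The journey
  then lasts at most length v / B <= t/2, which leaves t/2 for the potential of v.\<close>

lemma total_mass_lower:
  assumes v: "v \<in> V" and t: "0 < t" and B: "1 \<le> B" "\<And>u. suffix u v \<Longrightarrow> u \<noteq> v \<Longrightarrow> real (deg u) \<le> B"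
    and tB: "real (length v) / B \<le> t / 2" and nonneg: "\<And>w. w \<in> V \<Longrightarrow> 0 \<le> \<xi> w"
  shows "ennreal ((1 / (2 * exp 1 * B)) ^ length v * exp (- t * real (deg v)) * exp (t / 2 * \<xi> v)) \<le> total_mass V \<xi> t"
proof -
  define r where "r = length v"
  \<comment> \<open>The ancestor of v at depth k; since the root is the right end of a label, the
    first r - k letters are dropped.\<close>
  define p where "p k = drop (r - k) v" for k
  \<comment> \<open>At most B other clocks compete, and with this \<delta> they all exceed it with
    probability at least 1/e, while the right one rings in time with probability at least
    \<delta>/2; this yields the factor 1/(2 e B) per step.\<close>
  define \<delta> where "\<delta> = 1 / B"
  have d: "0 < \<delta>" "\<delta> \<le> 1" using B by (auto simp: \<delta>_def)
  have p0: "p 0 = []" and pr: "p r = v" by (auto simp: p_def r_def)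
  have pS: "p (Suc k) = v ! (r - Suc k) # p k" if "k < r" for k
    using that Cons_nth_drop_Suc[of "r - Suc k" v, symmetric] by (simp add: p_def r_def Suc_diff_Suc)
  have psuf: "suffix (p k) v" for k by (simp add: p_def suffix_drop)
  have pV: "p k \<in> V" for k using suffix_in[OF psuf v] .
  have pnb: "p (Suc k) \<in> nb (p k)" if "k < r" for k
    using pV[of "Suc k"] pS[OF that] by (auto simp: neighbours_def)
  have plen: "length (p k) = k" if "k \<le> r" for k using that by (simp add: p_def r_def)
  have pdeg: "real (deg (p k)) \<le> B" if "k < r" for k
    using plen[of k] that psuf[of k] by (intro B(2)) (auto simp: r_def)
  define A where "A = (\<lambda>(k, w). if k = r then {t<..} else if w = p (Suc k) then {0..\<delta>} else {\<delta><..})"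
  define I where "I = (SIGMA k:{..r}. nb (p k))"
  define C where "C = {E :: clocks. \<forall>i\<in>I. E i \<in> A i}"
  have I: "finite I" unfolding I_def using fin by auto
  have A_sets: "A i \<in> sets exp_law" for i by (cases i) (simp add: A_def)
  have PC: "emeasure clock_measure C = (\<Prod>i\<in>I. emeasure exp_law (A i))"
    unfolding C_def clock_measure_def
    by (rule emeasure_PiM_cylinder) (use prob_space_exp_law I A_sets in auto)
  have prob_k: "ennreal (1 / (2 * exp 1 * B)) \<le> (\<Prod>w\<in>nb (p k). emeasure exp_law (A (k, w)))" if k: "k < r" for k
  proof -
    have "(\<Prod>w\<in>nb (p k). emeasure exp_law (A (k, w))) =
      emeasure exp_law {0..\<delta>} * (\<Prod>w\<in>nb (p k) - {p (Suc k)}. emeasure exp_law (A (k, w)))"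
      using k by (subst prod.remove[OF fin pnb[OF k]]) (simp add: A_def)
    also have "(\<Prod>w\<in>nb (p k) - {p (Suc k)}. emeasure exp_law (A (k, w))) = (\<Prod>w\<in>nb (p k) - {p (Suc k)}. emeasure exp_law {\<delta><..})"
      using k by (intro prod.cong) (auto simp: A_def)
    also have "\<dots> = ennreal (exp (- \<delta>) ^ card (nb (p k) - {p (Suc k)}))"
      using d by (simp add: emeasure_exp_law ennreal_power)
    also have "emeasure exp_law {0..\<delta>} = ennreal (1 - exp (- \<delta>))"
      using d by (simp add: emeasure_exp_law)
    finally have eq: "(\<Prod>w\<in>nb (p k). emeasure exp_law (A (k, w))) =
        ennreal ((1 - exp (- \<delta>)) * exp (- \<delta>) ^ card (nb (p k) - {p (Suc k)}))"
      using d by (simp add: ennreal_mult')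
    have "real (card (nb (p k) - {p (Suc k)})) \<le> B"
      using pdeg[OF k] card_mono[OF fin, of "nb (p k) - {p (Suc k)}" "p k"] by force
    then have "\<delta> * real (card (nb (p k) - {p (Suc k)})) \<le> 1" using B by (simp add: \<delta>_def)
    then have e: "exp (- 1) \<le> exp (- \<delta>) ^ card (nb (p k) - {p (Suc k)})"
      by (simp add: exp_of_nat_mult[symmetric] mult.commute)
    have "exp (- \<delta>) \<le> 1 / (1 + \<delta>)"
      using d exp_ge_add_one_self[of \<delta>] by (simp add: exp_minus field_simps)
    also have "\<dots> \<le> 1 - \<delta> / 2"
      using d mult_left_mono[of \<delta> 1 \<delta>] by (simp add: field_simps)
    finally have "\<delta> / 2 * exp (- 1) \<le> (1 - exp (- \<delta>)) * exp (- \<delta>) ^ card (nb (p k) - {p (Suc k)})"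
      using e d by (intro mult_mono) auto
    then show ?thesis unfolding eq by (intro ennreal_leI) (simp add: \<delta>_def exp_minus field_simps)
  qed
  have prob_r: "(\<Prod>w\<in>nb (p r). emeasure exp_law (A (r, w))) = ennreal (exp (- t * real (deg v)))"
    using t by (simp add: A_def pr emeasure_exp_law ennreal_power exp_of_nat_mult[symmetric] mult.commute)
  have "ennreal ((1 / (2 * exp 1 * B)) ^ r * exp (- t * real (deg v))) =
      (\<Prod>k<r. ennreal (1 / (2 * exp 1 * B))) * ennreal (exp (- t * real (deg v)))"
    using B by (simp add: ennreal_mult' ennreal_power)
  also have "\<dots> \<le> (\<Prod>k<r. \<Prod>w\<in>nb (p k). emeasure exp_law (A (k, w))) * (\<Prod>w\<in>nb (p r). emeasure exp_law (A (r, w)))"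
    unfolding prob_r using prob_k by (intro mult_right_mono prod_mono_ennreal) auto
  also have "\<dots> = (\<Prod>k\<le>r. \<Prod>w\<in>nb (p k). emeasure exp_law (A (k, w)))"
    by (simp add: lessThan_Suc_atMost[symmetric])
  also have "\<dots> = emeasure clock_measure C"
    unfolding PC I_def using fin by (subst prod.Sigma) auto
  finally have PC_ge: "ennreal ((1 / (2 * exp 1 * B)) ^ r * exp (- t * real (deg v))) \<le> emeasure clock_measure C" .
  have C_sets: "C \<in> sets clock_measure"
  proof -
    have "C = {E \<in> space clock_measure. \<forall>i\<in>I. E i \<in> A i}" by (simp add: C_def)
    also have "\<dots> \<in> sets clock_measure"
    proof (rule sets.sets_Collect_finite_All[OF _ I])
      show "{E \<in> space clock_measure. E i \<in> A i} \<in> sets clock_measure" for i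
        using measurable_sets[OF measurable_clock[of i], of "A i"] A_sets[of i] by (simp add: vimage_def)
    qed
    finally show ?thesis .
  qed
  have inC: "exp (t / 2 * \<xi> v) \<le> exp (LINT s:{0..t}|lborel. \<xi> (the (walk V E s))) \<and> walk V E t = Some v"
    if "E \<in> C" for E
  proof -
    have EA: "E (k, w) \<in> A (k, w)" if "k \<le> r" "w \<in> nb (p k)" for k w
      using \<open>E \<in> C\<close> that by (auto simp: C_def I_def)
    have E1: "0 \<le> E (k, p (Suc k)) \<and> E (k, p (Suc k)) \<le> \<delta>" if "k < r" for k
      using EA[of k "p (Suc k)"] pnb[OF that] that by (simp add: A_def)
    have chp: "ch E k = p k" if "k \<le> r" for k
      using that
    proof (induction k)
      case 0 then show ?case by (simp add: p0)
    next
      case (Suc k)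
      then have IH: "ch E k = p k" and k: "k < r" by auto
      have mem: "ch E (Suc k) \<in> nb (p k)" using chain_step[of E k] by (simp add: IH del: jump_chain.simps)
      have "E (k, ch E (Suc k)) \<le> E (k, p (Suc k))"
        using chain_min[of "p (Suc k)" E k] pnb[OF k] by (simp add: IH del: jump_chain.simps)
      then have "E (k, ch E (Suc k)) \<le> \<delta>" using E1[OF k] by linarith
      then show ?case using EA[OF _ mem] k by (auto simp: A_def simp del: jump_chain.simps split: if_splits)
    qed
    have jS: "jt E (Suc k) = jt E k + E (k, p (Suc k))" if "k < r" for k
      using chp[of "Suc k"] that by (simp add: jt_Suc del: jump_chain.simps)
    have j: "0 \<le> jt E k \<and> jt E k \<le> real k * \<delta>" if "k \<le> r" for k
      using that
    proof (induction k)
      case (Suc k)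
      then show ?case using jS[of k] E1[of k] by (simp add: algebra_simps)
    qed simp
    \<comment> \<open>\<open>jt_mono\<close> asks for all clocks to be positive, which membership in
      C does not provide; only the clocks of the path are used, counting back from r.\<close>
    have jmono: "jt E (r - i) \<le> jt E r" for i
    proof (induction i)
      case (Suc i)
      show ?case
      proof (cases "i < r")
        case True
        then have "jt E (r - i) = jt E (r - Suc i) + E (r - Suc i, p (r - i))"
          using jS[of "r - Suc i"] by (simp add: Suc_diff_Suc)
        moreover have "0 \<le> E (r - Suc i, p (r - i))"
          using E1[of "r - Suc i"] True by (simp add: Suc_diff_Suc)
        ultimately show ?thesis using Suc by linarith
      next
        case False
        then have "r - Suc i = r - i" by simp
        then show ?thesis using Suc by simp
      qed
    qed simp
    have jr: "jt E r \<le> t / 2"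
    proof -
      have "jt E r \<le> real r * \<delta>" using j[of r] by simp
      also have "\<dots> \<le> t / 2" using tB by (simp add: \<delta>_def r_def)
      finally show ?thesis .
    qed
    have "ch E (Suc r) \<in> nb (p r)" using chain_step[of E r] chp[of r] by (simp del: jump_chain.simps)
    then have "t < E (r, ch E (Suc r))" using EA[of r "ch E (Suc r)"] by (simp add: A_def del: jump_chain.simps)
    then have tr: "t < jt E (Suc r)" using j[of r] by (simp add: jt_Suc del: jump_chain.simps)
    have stay: "walk V E s = Some v" if "jt E r \<le> s" "s \<le> t" for s
    proof -
      have "walk V E s = Some (ch E r)"
      proof (rule walk_eqI)
        show "jt E (Suc m) \<le> s" if "m < r" for m
          using jmono[of "r - Suc m"] that \<open>jt E r \<le> s\<close> by simp
      qed (use tr that in simp)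
      then show ?thesis using chp[of r] pr by simp
    qed
    have "t / 2 * \<xi> v \<le> (t - jt E r) * \<xi> v" using jr nonneg[OF v] by (intro mult_right_mono) auto
    also have "\<dots> \<le> (LINT s:{0..t}|lborel. \<xi> (the (walk V E s)))"
      using j[of r] jr t tr stay nonneg by (intro walk_integral_ge) auto
    finally show ?thesis using stay[of t] jr t by simp
  qed
  have "ennreal ((1 / (2 * exp 1 * B)) ^ length v * exp (- t * real (deg v)) * exp (t / 2 * \<xi> v)) =
      ennreal (exp (t / 2 * \<xi> v)) * ennreal ((1 / (2 * exp 1 * B)) ^ r * exp (- t * real (deg v)))"
    using B by (simp add: ennreal_mult'[symmetric] r_def mult_ac)
  also have "\<dots> \<le> ennreal (exp (t / 2 * \<xi> v)) * emeasure clock_measure C"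
    by (intro mult_left_mono PC_ge) simp
  also have "\<dots> = (\<integral>\<^sup>+E. ennreal (exp (t / 2 * \<xi> v)) * indicator C E \<partial>clock_measure)"
    using C_sets by (simp add: nn_integral_cmult)
  also have "\<dots> \<le> pam V \<xi> t v"
    unfolding pam_def using inC by (intro nn_integral_mono) (auto simp: indicator_def intro!: ennreal_leI)
  also have "\<dots> \<le> total_mass V \<xi> t"
    unfolding total_mass_eq_SUP using v by (intro SUP_upper2[of "{v}"]) auto
  finally show ?thesis .
qed

end

section \<open>Tails of the total mass\<close>

lemma ext_log_in_iff:
  "ext_log x \<in> {ereal a..ereal b} \<longleftrightarrow> ennreal (exp a) \<le> x \<and> x \<le> ennreal (exp b)"
proof (cases x)
  case (real y)
  show ?thesis
  proof (cases "y = 0")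
    case False
    then have "0 < y" using real by simp
    moreover from this have "ln y \<le> b \<longleftrightarrow> y \<le> exp b" by (metis exp_le_cancel_iff exp_ln)
    ultimately show ?thesis using real by (auto simp: ext_log_def ln_ge_iff)
  qed (use real in \<open>simp add: ext_log_def\<close>)
qed (simp add: ext_log_def top_unique)

section \<open>Degrees, measurability and counting in Kesten's tree\<close>

lemma neighbours_kesten:
  "neighbours (kesten_tree \<omega>) v \<subseteq> (\<lambda>i. i # v) ` {..<num_children \<omega> v} \<union> {tl v}"
  by (auto simp: neighbours_def kesten_tree_def)

lemma finite_neighbours_kesten: "finite (neighbours (kesten_tree \<omega>) v)"
  by (rule finite_subset[OF neighbours_kesten]) simp

lemma degree_kesten_le: "card (neighbours (kesten_tree \<omega>) v) \<le> Suc (num_children \<omega> v)"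
proof -
  have "card (neighbours (kesten_tree \<omega>) v) \<le> card ((\<lambda>i. i # v) ` {..<num_children \<omega> v} \<union> {tl v})"
    by (intro card_mono neighbours_kesten) simp
  also have "\<dots> \<le> card ((\<lambda>i. i # v) ` {..<num_children \<omega> v}) + card {tl v}" by (rule card_Un_le)
  also have "\<dots> \<le> Suc (num_children \<omega> v)" using card_image_le[of "{..<num_children \<omega> v}" "\<lambda>i. i # v"] by simp
  finally show ?thesis .
qed

text \<open>Crude but sufficient on the way to the target, where degrees enter only through a
  logarithm in the exponent.\<close>

lemma degree_le_ball:
  assumes "length v \<le> R"
  shows "card (neighbours (kesten_tree \<omega>) v) \<le> card (tree_ball \<omega> (Suc R))"
  using assms by (intro card_mono finite_tree_ball) (auto simp: neighbours_def tree_ball_def)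

text \<open>Every vertex other than the root has its parent as a neighbour, so it is enough that the
  root has a child.\<close>

lemma walk_tree_kesten:
  assumes "0 < fst (snd (\<omega> []))"
  shows "walk_tree (kesten_tree \<omega>)"
proof
  show "neighbours (kesten_tree \<omega>) v \<noteq> {}" if "v \<in> kesten_tree \<omega>" for v
  proof (cases v)
    case Nil
    have "0 # [] \<in> neighbours (kesten_tree \<omega>) []"
      using assms by (simp add: neighbours_def kesten_tree_def num_children_def)
    then show ?thesis using Nil by auto
  next
    case (Cons i w)
    then have "w \<in> neighbours (kesten_tree \<omega>) v" using that by (auto simp: neighbours_def kesten_tree_def)
    then show ?thesis by auto
  qed
qed (auto simp: kesten_tree_def finite_neighbours_kesten[unfolded kesten_tree_def])

lemma measurable_special [measurable]: "Measurable.pred (kesten_measure \<mu>) (\<lambda>\<omega>. special \<omega> v)"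
proof (induction v)
  case (Cons i v)
  have [measurable]: "Measurable.pred (kesten_measure \<mu>) (\<lambda>\<omega>. special \<omega> v)" by (rule Cons)
  have [measurable]: "(\<lambda>\<omega>. snd (snd (\<omega> v))) \<in> kesten_measure \<mu> \<rightarrow>\<^sub>M count_space UNIV"
    by (rule measurable_compose[OF measurable_mark]) simp
  show ?case by simp
qed simp

lemma measurable_num_children [measurable]:
  "(\<lambda>\<omega>. num_children \<omega> v) \<in> kesten_measure \<mu> \<rightarrow>\<^sub>M count_space UNIV"
proof -
  have [measurable]: "(\<lambda>\<omega>. fst (snd (\<omega> v))) \<in> kesten_measure \<mu> \<rightarrow>\<^sub>M count_space UNIV"
      "(\<lambda>\<omega>. fst (\<omega> v)) \<in> kesten_measure \<mu> \<rightarrow>\<^sub>M count_space UNIV"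
    by (rule measurable_compose[OF measurable_mark], simp)+
  show ?thesis unfolding num_children_def by measurable
qed

lemma measurable_in_tree [measurable]: "Measurable.pred (kesten_measure \<mu>) (\<lambda>\<omega>. v \<in> kesten_tree \<omega>)"
proof (induction v)
  case (Cons i v)
  have [measurable]: "Measurable.pred (kesten_measure \<mu>) (\<lambda>\<omega>. v \<in> kesten_tree \<omega>)" by (rule Cons)
  have "Measurable.pred (kesten_measure \<mu>) (\<lambda>\<omega>. v \<in> kesten_tree \<omega> \<and> i < num_children \<omega> v)" by measurable
  then show ?case by (simp add: kesten_tree_def)
qed (simp add: kesten_tree_def)

text \<open>Distinct vertices of the ball have distinct children, all in the next ball; by counting,
  at most volume (R + 1) / K vertices have more than K children.\<close>

lemma card_few_children:
  assumes K: "0 < K"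
  shows "volume \<omega> R - volume \<omega> (Suc R) / K
    \<le> real (card {v \<in> tree_ball \<omega> R. real (num_children \<omega> v) \<le> K})"
proof -
  let ?B = "tree_ball \<omega> R"
  let ?C = "\<lambda>v. (\<lambda>i. i # v) ` {..<num_children \<omega> v}"
  let ?many = "{v \<in> ?B. \<not> real (num_children \<omega> v) \<le> K}"
  have "(\<Sum>v\<in>?B. num_children \<omega> v) = (\<Sum>v\<in>?B. card (?C v))"
    by (intro sum.cong refl) (simp add: card_image inj_on_def)
  also have "\<dots> = card (\<Union>v\<in>?B. ?C v)"
    by (rule card_UN_disjoint[symmetric]) (auto simp: finite_tree_ball)
  also have "\<dots> \<le> card (tree_ball \<omega> (Suc R))"
    by (intro card_mono finite_tree_ball) (auto simp: tree_ball_def kesten_tree_def)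
  finally have total: "(\<Sum>v\<in>?B. real (num_children \<omega> v)) \<le> volume \<omega> (Suc R)"
    by (simp flip: of_nat_sum)
  have "K * real (card ?many) = (\<Sum>v\<in>?many. K)" by simp
  also have "\<dots> \<le> (\<Sum>v\<in>?many. real (num_children \<omega> v))" by (intro sum_mono) auto
  also have "\<dots> \<le> (\<Sum>v\<in>?B. real (num_children \<omega> v))"
    by (intro sum_mono2) (auto simp: finite_tree_ball)
  finally have many: "real (card ?many) \<le> volume \<omega> (Suc R) / K"
    using total K by (simp add: field_simps)
  have "card ?B = card {v \<in> ?B. real (num_children \<omega> v) \<le> K} + card ?many"
    by (subst card_Un_disjoint[symmetric]) (auto simp: finite_tree_ball intro!: arg_cong[of _ _ card])
  then show ?thesis using many by linarith
qed

text \<open>Separates the two sources of failure: a bad tree, and a bad potential on almost every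
  good tree.\<close>

lemma emeasure_pair_bound:
  assumes K: "prob_space K" and X: "prob_space X" and A: "A \<in> sets (K \<Otimes>\<^sub>M X)" and G: "G \<in> sets K"
    and e1: "emeasure K (space K - G) \<le> e1"
    and e2: "AE \<omega> in K. \<omega> \<in> G \<longrightarrow> emeasure X (Pair \<omega> -` A) \<le> e2"
  shows "emeasure (K \<Otimes>\<^sub>M X) A \<le> e1 + e2"
proof -
  interpret K: prob_space K by fact
  interpret X: prob_space X by fact
  have "emeasure (K \<Otimes>\<^sub>M X) A = (\<integral>\<^sup>+\<omega>. emeasure X (Pair \<omega> -` A) \<partial>K)"
    by (rule X.emeasure_pair_measure_alt[OF A])
  also have "\<dots> \<le> (\<integral>\<^sup>+\<omega>. indicator (space K - G) \<omega> + e2 \<partial>K)"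
  proof (rule nn_integral_mono_AE)
    show "AE \<omega> in K. emeasure X (Pair \<omega> -` A) \<le> indicator (space K - G) \<omega> + e2"
      using e2 AE_space
    proof eventually_elim
      case (elim \<omega>)
      then show ?case using X.emeasure_le_1[of "Pair \<omega> -` A"]
        by (cases "\<omega> \<in> G") (auto intro: order_trans[of _ 1] add_increasing2)
    qed
  qed
  also have "\<dots> = emeasure K (space K - G) + e2"
    using G by (subst nn_integral_add) (auto simp: K.emeasure_space_1)
  also have "\<dots> \<le> e1 + e2" using e1 by (rule add_right_mono)
  finally show ?thesis .
qed

section \<open>The Pareto field\<close>

locale pam_setting = stable_critical +
  fixes \<alpha> :: real and \<rho> :: "real measure"
  assumes alpha: "vdim < \<alpha>" and rho: "pareto_law \<alpha> \<rho>"
begin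

abbreviation "K \<equiv> kesten_measure \<mu>"
abbreviation "X \<equiv> PiM (UNIV :: label set) (\<lambda>_. \<rho>)"

sublocale K: prob_space K by (rule prob_space_kesten)

sublocale rho: real_distribution \<rho>
  using rho by (simp add: pareto_law_def)

sublocale X: prob_space X
  by (intro prob_space_PiM rho.prob_space_axioms)

lemma space_rho [simp]: "space \<rho> = UNIV"
  using rho.space_eq_univ .

lemma space_X [simp]: "space X = UNIV"
  by (simp add: space_PiM)

lemma measurable_field [measurable]: "(\<lambda>\<xi>. \<xi> v) \<in> borel_measurable X"
proof -
  have "(\<lambda>\<xi>. \<xi> v) \<in> X \<rightarrow>\<^sub>M \<rho>" by (rule measurable_component_singleton) simp
  then show ?thesis by (simp cong: measurable_cong_sets)
qed

lemma pareto_tail: "1 \<le> x \<Longrightarrow> rho.prob {x..} = x powr (- \<alpha>)"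
  using rho by (simp add: pareto_law_def)

lemma pareto_gt: "1 \<le> x \<Longrightarrow> emeasure \<rho> {x<..} \<le> ennreal (x powr (- \<alpha>))"
proof -
  assume "1 \<le> x"
  have "rho.prob {x<..} \<le> rho.prob {x..}"
    by (intro rho.finite_measure_mono) auto
  also have "\<dots> = x powr (- \<alpha>)" using \<open>1 \<le> x\<close> by (rule pareto_tail)
  finally have "rho.prob {x<..} \<le> x powr (- \<alpha>)" .
  then show ?thesis by (simp add: rho.emeasure_eq_measure ennreal_leI)
qed

lemma pareto_less: "1 \<le> x \<Longrightarrow> emeasure \<rho> {..<x} = ennreal (1 - x powr (- \<alpha>))"
proof -
  assume "1 \<le> x"
  have "rho.prob {..<x} = 1 - rho.prob {x..}"
    using rho.prob_compl[of "{x..}"] by (simp add: Compl_eq_Diff_UNIV[symmetric])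
  then show ?thesis using pareto_tail[OF \<open>1 \<le> x\<close>] by (simp add: rho.emeasure_eq_measure)
qed

lemma AE_field_ge_1: "AE \<xi> in X. \<forall>v. 1 \<le> \<xi> v"
proof -
  have "AE x in \<rho>. x \<in> {1..}"
    using pareto_tail[of 1] by (subst rho.AE_in_set_eq_1) auto
  then have "AE \<xi> in X. \<xi> v \<in> {1..}" for v
    by (intro AE_PiM_component rho.prob_space_axioms) auto
  then show ?thesis by (simp add: AE_all_countable)
qed

lemma emeasure_field_exceeds:
  assumes S: "\<And>k. finite (S k)" and x: "\<And>k. 1 \<le> x k"
  shows "emeasure X {\<xi>. \<exists>k::nat. \<exists>v\<in>S k. x k < \<xi> v} \<le> (\<Sum>k. ennreal (real (card (S k)) * x k powr (- \<alpha>)))"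
proof -
  have sets: "{\<xi>. x k < \<xi> v} \<in> sets X" for k v
  proof -
    have "{\<xi> \<in> space X. x k < \<xi> v} \<in> sets X" by measurable
    then show ?thesis by simp
  qed
  have setsU: "(\<Union>v\<in>S k. {\<xi>. x k < \<xi> v}) \<in> sets X" for k
    using S sets by (intro sets.finite_UN) auto
  have "{\<xi>. \<exists>k. \<exists>v\<in>S k. x k < \<xi> v} = (\<Union>k. \<Union>v\<in>S k. {\<xi>. x k < \<xi> v})" by auto
  then have "emeasure X {\<xi>. \<exists>k. \<exists>v\<in>S k. x k < \<xi> v} \<le> (\<Sum>k. emeasure X (\<Union>v\<in>S k. {\<xi>. x k < \<xi> v}))"
    using setsU by (auto intro!: emeasure_subadditive_countably)
  also have "\<dots> \<le> (\<Sum>k. ennreal (real (card (S k)) * x k powr (- \<alpha>)))"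
  proof (rule suminf_le)
    fix k
    have "emeasure X (\<Union>v\<in>S k. {\<xi>. x k < \<xi> v}) \<le> (\<Sum>v\<in>S k. emeasure X {\<xi>. x k < \<xi> v})"
      using S sets by (intro emeasure_subadditive_finite) auto
    also have "\<dots> \<le> (\<Sum>v\<in>S k. ennreal (x k powr (- \<alpha>)))"
    proof (rule sum_mono)
      fix v
      have "emeasure X {\<xi>. x k < \<xi> v} = emeasure X {\<xi>. \<forall>i\<in>{v}. \<xi> i \<in> {x k<..}}" by simp
      also have "\<dots> = (\<Prod>i\<in>{v}. emeasure \<rho> {x k<..})"
        by (intro emeasure_PiM_cylinder rho.prob_space_axioms) auto
      also have "\<dots> \<le> ennreal (x k powr (- \<alpha>))" using pareto_gt[OF x] by simp
      finally show "emeasure X {\<xi>. x k < \<xi> v} \<le> ennreal (x k powr (- \<alpha>))" .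
    qed
    also have "\<dots> = ennreal (real (card (S k)) * x k powr (- \<alpha>))"
      by (simp add: ennreal_mult' flip: ennreal_of_nat_eq_real_of_nat)
    finally show "emeasure X (\<Union>v\<in>S k. {\<xi>. x k < \<xi> v}) \<le> ennreal (real (card (S k)) * x k powr (- \<alpha>))" .
  qed auto
  finally show ?thesis .
qed

lemma emeasure_field_below:
  assumes "finite S" "1 \<le> x"
  shows "emeasure X {\<xi>. \<forall>v\<in>S. \<xi> v < x} \<le> ennreal (exp (- (x powr (- \<alpha>) * real (card S))))"
proof -
  have p: "x powr (- \<alpha>) \<le> 1" using powr_mono[of "- \<alpha>" 0 x] assms alpha vdim by simp
  have "emeasure X {\<xi>. \<forall>v\<in>S. \<xi> v < x} = emeasure X {\<xi>. \<forall>v\<in>S. \<xi> v \<in> {..<x}}" by simp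
  also have "\<dots> = (\<Prod>v\<in>S. emeasure \<rho> {..<x})"
    using assms by (intro emeasure_PiM_cylinder rho.prob_space_axioms) auto
  also have "\<dots> = ennreal ((1 - x powr (- \<alpha>)) ^ card S)"
    using p by (simp add: pareto_less[OF assms(2)] ennreal_power)
  also have "\<dots> \<le> ennreal (exp (- (x powr (- \<alpha>))) ^ card S)"
    using p exp_ge_add_one_self[of "- (x powr (- \<alpha>))"] by (intro ennreal_leI power_mono) auto
  also have "\<dots> = ennreal (exp (- (x powr (- \<alpha>) * real (card S))))"
    by (simp add: exp_of_nat_mult[symmetric] mult.commute)
  finally show ?thesis .
qed

lemma AE_walk_tree: "AE \<omega> in K. walk_tree (kesten_tree \<omega>)"
proof -
  have "AE m in measure_pmf (pair_pmf \<mu> (special_offspring \<mu>)). 0 < fst (snd m)"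
  proof (rule AE_pmfI)
    fix m assume "m \<in> set_pmf (pair_pmf \<mu> (special_offspring \<mu>))"
    then obtain s where "fst (snd m) = s" "s \<in> set_pmf (size_biased \<mu>)"
      by (auto simp: special_offspring_def)
    then show "0 < fst (snd m)" by (cases s) (auto simp: set_pmf_eq pmf_size_biased)
  qed
  then have "AE \<omega> in K. 0 < fst (snd (\<omega> []))"
    unfolding kesten_measure_def by (intro AE_PiM_component measure_pmf.prob_space_axioms) auto
  then show ?thesis by eventually_elim (rule walk_tree_kesten)
qed

lemma measurable_joint_mass [measurable]:
  "(\<lambda>x. total_mass (kesten_tree (fst x)) (snd x) t) \<in> borel_measurable (K \<Otimes>\<^sub>M X)"
  by (rule measurable_total_mass) (use finite_neighbours_kesten in auto)

section \<open>The scales and their asymptotics\<close>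

definition "q = scale_q vdim \<alpha>"
text \<open>The radius at which t R^(vdim/\<alpha>) = R ln t; there the typical maximum of the
  potential, R^(vdim/\<alpha>), is a(t).\<close>

definition "rad t = (t / ln t) powr (q + 1)"

lemma q: "0 < q" "q + 1 = \<alpha> / (\<alpha> - vdim)" "q * \<alpha> = (q + 1) * vdim"
  using alpha vdim by (auto simp: q_def scale_q_def field_simps)

lemma scale_a_eq: "scale_a vdim \<alpha> t = (t / ln t) powr q"
  by (simp add: scale_a_def q_def)

lemma scale_a_powr: "scale_a vdim \<alpha> t powr \<alpha> = rad t powr vdim"
  by (simp add: scale_a_eq rad_def powr_powr q(3))

lemma rad_powr: "rad t powr (vdim / \<alpha>) = scale_a vdim \<alpha> t"
proof -
  have "(q + 1) * (vdim / \<alpha>) = q" using q(3) alpha vdim by (simp add: field_simps)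
  then show ?thesis by (simp add: scale_a_eq rad_def powr_powr)
qed

lemma t_scale_a: "1 < t \<Longrightarrow> t * scale_a vdim \<alpha> t = rad t * ln t"
proof -
  assume "1 < t"
  then have "0 < t / ln t" "0 < ln t" by auto
  then show ?thesis using \<open>1 < t\<close> by (simp add: scale_a_eq rad_def powr_add)
qed

lemma filterlim_base: "filterlim (\<lambda>t::real. t / ln t) at_top at_top"
  by real_asymp

lemma rad_at_top: "filterlim rad at_top at_top"
  unfolding rad_def using q(1) by (intro filterlim_compose[OF real_powr_at_top filterlim_base]) auto

lemma scale_a_at_top: "filterlim (scale_a vdim \<alpha>) at_top at_top"
  unfolding scale_a_eq[abs_def] using q(1) by (intro filterlim_compose[OF real_powr_at_top filterlim_base]) auto

lemma ln_rad: "1 < t \<Longrightarrow> ln (rad t) = (q + 1) * (ln t - ln (ln t))"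
proof -
  assume t: "1 < t"
  then have "0 < t / ln t" "0 < ln t" by auto
  then show ?thesis using t by (simp add: rad_def ln_powr ln_div)
qed

text \<open>rad t / t is t^q up to a power of ln t, and half of the exponent q is given away to
  absorb it. The parameter a = ln (rad t / t) of the hitting bound is thus at least of order ln
  t.\<close>

lemma ln_rad_over_t: "eventually (\<lambda>t. q / 2 * ln t \<le> ln (rad t / t)) at_top"
proof -
  have "((\<lambda>t::real. ln (ln t) / ln t) \<longlongrightarrow> 0) at_top" by real_asymp
  then have "eventually (\<lambda>t::real. ln (ln t) / ln t < q / (2 * (q + 1))) at_top"
    using q(1) by (intro order_tendstoD) auto
  then show ?thesis using eventually_gt_at_top[of 1]
  proof eventually_elim
    case (elim t)
    then have pos: "0 < ln t" "0 < t / ln t" by auto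
    have "ln (ln t) < q / (2 * (q + 1)) * ln t" using elim pos by (simp add: divide_less_eq)
    then have "(q + 1) * ln (ln t) \<le> (q + 1) * (q / (2 * (q + 1)) * ln t)"
      using q(1) by (intro mult_left_mono) auto
    also have "\<dots> = q / 2 * ln t" using q(1) by (simp add: field_simps)
    finally have "(q + 1) * ln (ln t) \<le> q / 2 * ln t" .
    moreover have "ln (rad t / t) = ln (rad t) - ln t"
      using pos elim by (intro ln_divide_pos) (auto simp: rad_def)
    ultimately show ?case using ln_rad[OF elim(2)] by (simp add: algebra_simps)
  qed
qed

text \<open>The margin \<alpha> - vdim is cut into three equal parts. One allows the volumes to
  exceed their order by 2^(k slack) at level k, one makes the exceedances of the thresholds summable
  in k, and one keeps gam < 1, so that the thresholds grow more slowly than the radii.\<close>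

definition "slack = (\<alpha> - vdim) / 3"
definition "gam = (vdim + 2 * slack) / \<alpha>"
definition level :: "real \<Rightarrow> nat \<Rightarrow> nat" where "level t k = nat \<lceil>rad t\<rceil> * 2 ^ k"
definition threshold :: "real \<Rightarrow> real \<Rightarrow> nat \<Rightarrow> real" where
  "threshold b t k = b * scale_a vdim \<alpha> t * 2 powr (real k * gam)"

abbreviation vbound :: "real \<Rightarrow> nat \<Rightarrow> nat \<Rightarrow> real" where
  "vbound M k n \<equiv> M * 2 powr (real k * slack) * real n powr vdim"

lemma slack: "0 < slack" "0 < gam" "gam < 1" "gam * \<alpha> = vdim + 2 * slack"
  using alpha vdim by (auto simp: slack_def gam_def field_simps)

lemma level_bounds:
  assumes "1 \<le> rad t"
  shows "rad t * 2 ^ k \<le> real (level t k)" "real (level t k) \<le> 2 * (rad t * 2 ^ k)"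
proof -
  have "rad t \<le> real (nat \<lceil>rad t\<rceil>)" "real (nat \<lceil>rad t\<rceil>) \<le> 2 * rad t"
    using assms by linarith+
  then show "rad t * 2 ^ k \<le> real (level t k)" "real (level t k) \<le> 2 * (rad t * 2 ^ k)"
    by (auto simp: level_def mult_right_mono mult.assoc[symmetric])
qed

lemma poly_le_exp:
  assumes "0 < M" "0 < p"
  shows "eventually (\<lambda>z::real. M * (2 * z) powr p \<le> exp z) at_top"
proof -
  have "((\<lambda>z::real. ln (2 * z) / z) \<longlongrightarrow> 0) at_top" by real_asymp
  then have "eventually (\<lambda>z::real. ln (2 * z) / z < 1 / (2 * p)) at_top"
    using assms by (intro order_tendstoD) auto
  then show ?thesis using eventually_ge_at_top[of "2 * ln M"] eventually_gt_at_top[of 0]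
  proof eventually_elim
    case (elim z)
    then have "p * ln (2 * z) < p * (1 / (2 * p) * z)" using assms by (intro mult_strict_left_mono) (auto simp: divide_less_eq)
    then have "ln M + p * ln (2 * z) \<le> z" using elim assms by simp
    then have "exp (ln M + p * ln (2 * z)) \<le> exp z" by simp
    then show ?case using elim assms by (simp add: exp_add powr_def)
  qed
qed

text \<open>Put z = rad t * 2^k. For k >= k0 the potential, the number of vertices and the term exp
  a * t of the hitting bound each contribute at most q/8 ln t * z to the exponent, while the
  distance contributes at least q/2 ln t * z with the opposite sign. A decay of q/8 ln t * z is
  left.\<close>

lemma level_terms_small:
  assumes b: "0 < b" and M: "0 < M"
  obtains k0 where "eventually (\<lambda>t. \<forall>k\<ge>k0. exp (t * threshold b t (Suc k)) *
    (vbound M k (level t k) *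
      exp ((rad t / t - 1) * t - ln (rad t / t) * real (level t k))) \<le> exp (- (real k + 1))) at_top"
proof -
  \<comment> \<open>k0 is the level beyond which 2^k beats the growth 2^(k gam) of the thresholds
    with its constants; it does not depend on t.\<close>
  have "filterlim (\<lambda>k::nat. 2 powr (real k * (1 - gam))) at_top at_top"
    using slack(3) by real_asymp
  then have "eventually (\<lambda>k. 8 * b * 2 powr gam / q \<le> 2 powr (real k * (1 - gam))) sequentially"
    by (simp add: filterlim_at_top)
  then obtain k0 where k0: "\<And>k. k \<ge> k0 \<Longrightarrow> 8 * b * 2 powr gam / q \<le> 2 powr (real k * (1 - gam))"
    by (auto simp: eventually_sequentially)
  have growth: "b * 2 powr gam * 2 powr (real k * gam) \<le> q / 8 * 2 ^ k" if "k \<ge> k0" for k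
  proof -
    have "8 * b * 2 powr gam / q * 2 powr (real k * gam) \<le> 2 powr (real k * (1 - gam)) * 2 powr (real k * gam)"
      using k0[OF that] by (intro mult_right_mono) auto
    also have "\<dots> = 2 powr (real k)" by (simp add: powr_add[symmetric] algebra_simps)
    also have "\<dots> = 2 ^ k" by (simp add: powr_realpow)
    finally show ?thesis using q(1) by (simp add: field_simps)
  qed
  obtain z0 where z0: "\<And>z. z \<ge> z0 \<Longrightarrow> M * (2 * z) powr (vdim + slack) \<le> exp z"
    using poly_le_exp[OF M, of "vdim + slack"] vdim slack(1) by (auto simp: eventually_at_top_linorder)
  have "eventually (\<lambda>t. max z0 1 \<le> rad t) at_top"
    using rad_at_top by (simp only: filterlim_at_top)
  moreover have "eventually (\<lambda>t::real. 8 / q \<le> ln t) at_top"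
    using ln_at_top by (simp only: filterlim_at_top)
  ultimately have "eventually (\<lambda>t. \<forall>k\<ge>k0. exp (t * threshold b t (Suc k)) *
    (vbound M k (level t k) *
      exp ((rad t / t - 1) * t - ln (rad t / t) * real (level t k))) \<le> exp (- (real k + 1))) at_top"
    using ln_rad_over_t eventually_gt_at_top[of 1]
  proof (eventually_elim, intro allI impI)
    fix t k assume t: "max z0 1 \<le> rad t" "8 / q \<le> ln t" "q / 2 * ln t \<le> ln (rad t / t)" "1 < t" and k: "k0 \<le> k"
    define z where "z = rad t * 2 ^ k"
    have r1: "1 \<le> rad t" "z0 \<le> rad t" using t by auto
    have zr: "rad t \<le> z" unfolding z_def using r1 by (simp add: mult_le_cancel_left1)
    have z2: "2 ^ k \<le> z" unfolding z_def using r1 by (simp add: mult_le_cancel_right1)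
    have lev: "z \<le> real (level t k)" "real (level t k) \<le> 2 * z"
      using level_bounds[OF r1(1), of k] by (auto simp: z_def)
    have qL: "1 \<le> q / 8 * ln t" using t(2) q(1) by (simp add: field_simps)
    have z1: "1 \<le> z" using zr r1 by linarith
    have zL: "z \<le> q / 8 * ln t * z" using mult_right_mono[OF qL, of z] z1 by simp
    have e1: "t * threshold b t (Suc k) \<le> q / 8 * ln t * z"
    proof -
      have "t * threshold b t (Suc k) = (t * scale_a vdim \<alpha> t) * (b * 2 powr gam * 2 powr (real k * gam))"
        by (simp add: threshold_def powr_add[symmetric] algebra_simps)
      also have "\<dots> \<le> (rad t * ln t) * (q / 8 * 2 ^ k)"
        unfolding t_scale_a[OF t(4)] using growth[OF k] r1 t by (intro mult_left_mono) auto
      finally show ?thesis by (simp add: z_def algebra_simps)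
    qed
    have e2: "vbound M k (level t k) \<le> exp (q / 8 * ln t * z)"
    proof -
      have "2 powr (real k * slack) = (2 ^ k) powr slack" by (simp add: powr_powr[symmetric] powr_realpow)
      also have "\<dots> \<le> (2 * z) powr slack" using z2 z1 slack by (intro powr_mono2) auto
      finally have "2 powr (real k * slack) \<le> (2 * z) powr slack" .
      moreover have "real (level t k) powr vdim \<le> (2 * z) powr vdim" using lev vdim by (intro powr_mono2) auto
      ultimately have "vbound M k (level t k) \<le> M * (2 * z) powr slack * (2 * z) powr vdim"
        using M by (intro mult_mono) auto
      also have "\<dots> = M * (2 * z) powr (vdim + slack)" by (simp add: powr_add)
      also have "\<dots> \<le> exp z" using z0[of z] zr r1 by linarith
      also have "\<dots> \<le> exp (q / 8 * ln t * z)" using zL by simp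
      finally show ?thesis .
    qed
    have e3: "(rad t / t - 1) * t \<le> q / 8 * ln t * z"
    proof -
      have "(rad t / t - 1) * t = rad t - t" using t by (simp add: field_simps)
      then show ?thesis using zr zL t by linarith
    qed
    have e4: "q / 2 * ln t * z \<le> ln (rad t / t) * real (level t k)"
    proof (rule mult_mono)
      have "0 \<le> q / 2 * ln t" using q(1) t by simp
      then show "0 \<le> ln (rad t / t)" using t by linarith
    qed (use lev t z1 in auto)
    have "exp (t * threshold b t (Suc k)) * (vbound M k (level t k) *
      exp ((rad t / t - 1) * t - ln (rad t / t) * real (level t k)))
      \<le> exp (q / 8 * ln t * z) * (exp (q / 8 * ln t * z) * exp (q / 8 * ln t * z - q / 2 * ln t * z))"
    proof (intro mult_mono e2)
      show "exp (t * threshold b t (Suc k)) \<le> exp (q / 8 * ln t * z)"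
        using e1 unfolding exp_le_cancel_iff .
      show "exp ((rad t / t - 1) * t - ln (rad t / t) * real (level t k)) \<le> exp (q / 8 * ln t * z - q / 2 * ln t * z)"
        using e3 e4 unfolding exp_le_cancel_iff by linarith
    qed (use M in auto)
    also have "\<dots> = exp (- (q / 8 * ln t * z))"
      by (simp add: exp_add[symmetric] exp_diff[symmetric] algebra_simps)
    also have "\<dots> \<le> exp (- (real k + 1))"
    proof -
      have "real (Suc k) \<le> real (2 ^ k)" by (rule of_nat_mono) (simp add: Suc_leI)
      then have "real k + 1 \<le> 2 ^ k" by simp
      then have "real k + 1 \<le> q / 8 * ln t * z" using zL z2 by linarith
      then show ?thesis unfolding exp_le_cancel_iff neg_le_iff_le .
    qed
    finally show "exp (t * threshold b t (Suc k)) * (vbound M k (level t k) *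
      exp ((rad t / t - 1) * t - ln (rad t / t) * real (level t k))) \<le> exp (- (real k + 1))" .
  qed
  then show ?thesis by (rule that)
qed

text \<open>With R about e1 * rad t and p = vdim/\<alpha>, the gain is of order e1^p times t a(t),
  and the travel cost is at most w e1 times t a(t). Since p < 1, a small e1 lets the gain win; the
  term t * K0 is of lower order.\<close>

lemma lower_exponent:
  assumes kap: "0 < kap" and K0: "0 \<le> K0" and B0: "1 \<le> B0"
  obtains e1 th where "0 < e1" "0 < th" "eventually (\<lambda>t. 2 \<le> t \<and> R0 \<le> nat \<lfloor>e1 * rad t\<rfloor> \<and> 1 \<le> nat \<lfloor>e1 * rad t\<rfloor> \<and>
     1 \<le> kap * real (nat \<lfloor>e1 * rad t\<rfloor>) powr (vdim / \<alpha>) \<and>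
     th * (t * scale_a vdim \<alpha> t) \<le> t / 2 * (kap * real (nat \<lfloor>e1 * rad t\<rfloor>) powr (vdim / \<alpha>)) - t * K0
       - real (nat \<lfloor>e1 * rad t\<rfloor>) * ln (B0 * real (nat \<lfloor>e1 * rad t\<rfloor>) powr vdim)) at_top"
proof -
  define p where "p = vdim / \<alpha>"
  have p: "0 < p" "p < 1" using alpha vdim by (auto simp: p_def)
  \<comment> \<open>The factors 1/8 and (1/2)^p leave a gain of four times th t a(t) although R is
    only known to exceed e1/2 * rad t; the two costs take at most one th t a(t) each. The constant w
    bounds the logarithm of B0 R^vdim by w ln t.\<close>
  define c where "c = kap / 8 * (1 / 2) powr p"
  define w where "w = 2 * vdim * (q + 1)"
  have c: "0 < c" using kap by (simp add: c_def)
  have w: "0 < w" using vdim(3) q(1) by (simp add: w_def)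
  \<comment> \<open>The largest e1 with w e1 <= c e1^p, capped at 1.\<close>
  define e1 where "e1 = min 1 ((c / w) powr (1 / (1 - p)))"
  have e1: "0 < e1" "e1 \<le> 1" using c w by (auto simp: e1_def)
  have "e1 powr (1 - p) \<le> ((c / w) powr (1 / (1 - p))) powr (1 - p)"
    using e1 p by (intro powr_mono2) (auto simp: e1_def)
  also have "\<dots> = c / w" using c w p by (simp add: powr_powr)
  finally have "e1 powr (1 - p) * e1 powr p \<le> c / w * e1 powr p" by (intro mult_right_mono) auto
  then have "e1 \<le> c / w * e1 powr p" using e1 by (simp add: powr_add[symmetric])
  then have we: "w * e1 \<le> c * e1 powr p" using w by (simp add: field_simps)
  define th where "th = c * e1 powr p"
  have th: "0 < th" using c e1 by (simp add: th_def)
  have kth: "kap * (e1 / 2) powr p = 8 * th"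
    using e1 by (simp add: th_def c_def powr_divide)
  have ev1: "eventually (\<lambda>t. max 1 ((2 + real R0 + 2) / e1) \<le> rad t) at_top"
    using rad_at_top by (simp only: filterlim_at_top)
  have ev2: "eventually (\<lambda>t. max (K0 / th) (1 / th) \<le> scale_a vdim \<alpha> t) at_top"
    using scale_a_at_top by (simp only: filterlim_at_top)
  have ev3: "eventually (\<lambda>t. max 1 (ln B0 / (vdim * (q + 1))) \<le> ln t) at_top"
    using ln_at_top by (simp only: filterlim_at_top)
  have "eventually (\<lambda>t. 2 \<le> t \<and> R0 \<le> nat \<lfloor>e1 * rad t\<rfloor> \<and> 1 \<le> nat \<lfloor>e1 * rad t\<rfloor> \<and>
     1 \<le> kap * real (nat \<lfloor>e1 * rad t\<rfloor>) powr (vdim / \<alpha>) \<and>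
     th * (t * scale_a vdim \<alpha> t) \<le> t / 2 * (kap * real (nat \<lfloor>e1 * rad t\<rfloor>) powr (vdim / \<alpha>)) - t * K0
       - real (nat \<lfloor>e1 * rad t\<rfloor>) * ln (B0 * real (nat \<lfloor>e1 * rad t\<rfloor>) powr vdim)) at_top"
    using ev1 ev2 ev3 eventually_ge_at_top[of 2]
  proof eventually_elim
    case (elim t)
    define R where "R = nat \<lfloor>e1 * rad t\<rfloor>"
    let ?a = "scale_a vdim \<alpha> t"
    have r1: "1 \<le> rad t" using elim by simp
    have "(2 + real R0 + 2) / e1 \<le> rad t" using elim by simp
    then have big: "2 + real R0 + 2 \<le> e1 * rad t" using e1 by (simp add: field_simps)
    have Rr: "real R \<le> e1 * rad t" "e1 * rad t - 1 \<le> real R" using big unfolding R_def by linarith+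
    then have R: "real R0 \<le> real R" "1 \<le> real R" "e1 / 2 * rad t \<le> real R" using big by linarith+
    have a: "K0 \<le> th * ?a" "1 \<le> th * ?a" using elim th by (auto simp: field_simps)
    have a0: "0 < ?a" using a(2) th by (metis less_le_trans zero_less_mult_pos zero_less_one)
    have ta: "t * ?a = rad t * ln t" using elim by (intro t_scale_a) auto
    have L: "1 \<le> ln t" "ln B0 \<le> vdim * (q + 1) * ln t"
    proof -
      show "1 \<le> ln t" using elim by simp
      have "ln B0 / (vdim * (q + 1)) \<le> ln t" using elim by simp
      moreover have "0 < vdim * (q + 1)" using vdim(3) q(1) by simp
      ultimately have "ln B0 \<le> ln t * (vdim * (q + 1))" by (simp only: pos_divide_le_eq)
      then show "ln B0 \<le> vdim * (q + 1) * ln t" by (simp only: mult.commute[of "ln t"])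
    qed
    have "(e1 / 2 * rad t) powr p \<le> real R powr p" using R e1 r1 p by (intro powr_mono2) auto
    moreover have "(e1 / 2 * rad t) powr p = (e1 / 2) powr p * ?a"
      using e1 r1 rad_powr[of t] by (simp add: powr_mult p_def del: times_divide_eq_left)
    ultimately have "kap * ((e1 / 2) powr p * ?a) \<le> kap * real R powr p" using kap by simp
    then have x: "8 * th * ?a \<le> kap * real R powr p" unfolding kth[symmetric] by (simp add: mult.assoc)
    have "t / 2 * (8 * th * ?a) \<le> t / 2 * (kap * real R powr p)"
      using x elim by (intro mult_left_mono) auto
    then have t1: "4 * (th * (t * ?a)) \<le> t / 2 * (kap * real R powr p)" by (simp add: algebra_simps)
    have "t * K0 \<le> t * (th * ?a)" using a elim by (intro mult_left_mono) auto
    then have t2: "t * K0 \<le> th * (t * ?a)" by (simp add: algebra_simps)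
    have lnr: "0 \<le> ln (rad t)" "ln (rad t) \<le> (q + 1) * ln t"
    proof -
      show "0 \<le> ln (rad t)" using r1 by simp
      have "ln (rad t) = (q + 1) * (ln t - ln (ln t))" using elim by (intro ln_rad) auto
      also have "\<dots> \<le> (q + 1) * ln t" using L q(1) by (intro mult_left_mono) auto
      finally show "ln (rad t) \<le> (q + 1) * ln t" .
    qed
    have "real R \<le> rad t" using Rr e1 r1 mult_right_mono[of e1 1 "rad t"] by linarith
    then have "ln (B0 * real R powr vdim) \<le> ln (B0 * rad t powr vdim)"
      using B0 R vdim r1 by (subst ln_le_cancel_iff) (auto intro!: mult_left_mono powr_mono2)
    also have "\<dots> = ln B0 + vdim * ln (rad t)" using B0 r1 by (simp add: ln_mult ln_powr)
    also have "\<dots> \<le> vdim * (q + 1) * ln t + vdim * ((q + 1) * ln t)"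
      using L lnr vdim by (intro add_mono mult_left_mono) auto
    also have "\<dots> = w * ln t" by (simp add: w_def algebra_simps)
    finally have "real R * ln (B0 * real R powr vdim) \<le> real R * (w * ln t)" by (intro mult_left_mono) auto
    also have "\<dots> \<le> (e1 * rad t) * (w * ln t)" using Rr w L by (intro mult_right_mono) auto
    also have "\<dots> = (w * e1) * (rad t * ln t)" by (simp add: algebra_simps)
    also have "\<dots> \<le> th * (rad t * ln t)" unfolding th_def using we r1 L by (intro mult_right_mono) auto
    finally have t3: "real R * ln (B0 * real R powr vdim) \<le> th * (t * ?a)" unfolding ta .
    have pos: "0 \<le> th * (t * ?a)" using th a0 elim by simp
    have "1 \<le> kap * real R powr p" using x a by linarith
    moreover have "th * (t * ?a) \<le> t / 2 * (kap * real R powr p) - t * K0 - real R * ln (B0 * real R powr vdim)"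
      using t1 t2 t3 pos by linarith
    ultimately show ?case using R elim unfolding R_def[symmetric] p_def[symmetric] by auto
  qed
  then show ?thesis using e1 th by (intro that) auto
qed

section \<open>Good trees, good fields and the two tails\<close>

lemma sets_field_events:
  assumes "\<And>k. finite (S k)"
  shows "{\<xi>. \<exists>k::nat. \<exists>v\<in>S k. x k < \<xi> v} \<in> sets X" "finite F \<Longrightarrow> {\<xi>. \<forall>v\<in>F. \<xi> v < y} \<in> sets X"
proof -
  have "{\<xi> \<in> space X. \<exists>k::nat. \<exists>v\<in>S k. x k < \<xi> v} \<in> sets X" using assms by measurable
  then show "{\<xi>. \<exists>k::nat. \<exists>v\<in>S k. x k < \<xi> v} \<in> sets X" by simp
  assume "finite F"
  then have "{\<xi> \<in> space X. \<forall>v\<in>F. \<xi> v < y} \<in> sets X" by measurable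
  then show "{\<xi>. \<forall>v\<in>F. \<xi> v < y} \<in> sets X" by simp
qed

text \<open>With M 2^(k slack) in place of M, \<open>volume_upper\<close> bounds the failure at
  scale k by C M^(- 1 / vdim) u^k, a geometric series; its sum does not involve the base radius
  n.\<close>

lemma volume_all_scales:
  assumes "0 < e"
  obtains M where "1 \<le> M" "\<And>n::nat. 1 \<le> n \<Longrightarrow>
    emeasure K (UNIV - {\<omega>. \<forall>k. volume \<omega> (n * 2 ^ k) \<le> vbound M k (n * 2 ^ k)}) \<le> ennreal e"
proof -
  obtain C M0 where C: "0 < C" "1 \<le> M0" and V: "\<And>M R. M0 \<le> M \<Longrightarrow> 1 \<le> R \<Longrightarrow>
      K.prob {\<omega>. M * real R powr vdim < volume \<omega> R} \<le> C * M powr (- 1 / vdim)"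
    using volume_upper by metis
  define u where "u = 2 powr (- slack / vdim)"
  have u: "0 < u" "u < 1" using slack vdim by (auto simp: u_def powr_less_one)
  have "((\<lambda>M. C / (1 - u) * M powr (- 1 / vdim)) \<longlongrightarrow> C / (1 - u) * 0) at_top"
    using vdim(3) by (intro tendsto_mult tendsto_const tendsto_neg_powr filterlim_ident) auto
  then have "eventually (\<lambda>M. C / (1 - u) * M powr (- 1 / vdim) < e) at_top"
    using assms by (intro order_tendstoD) auto
  then have "eventually (\<lambda>M. C / (1 - u) * M powr (- 1 / vdim) < e \<and> M0 \<le> M) at_top"
    using eventually_ge_at_top[of M0] by eventually_elim auto
  then obtain M where M: "C / (1 - u) * M powr (- 1 / vdim) < e" "M0 \<le> M"
    by (auto simp: eventually_at_top_linorder)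
  have "emeasure K (UNIV - {\<omega>. \<forall>k. volume \<omega> (n * 2 ^ k) \<le> vbound M k (n * 2 ^ k)}) \<le> ennreal e"
    if n: "1 \<le> n" for n :: nat
  proof -
    let ?B = "\<lambda>k. {\<omega>. vbound M k (n * 2 ^ k) < volume \<omega> (n * 2 ^ k)}"
    have "UNIV - {\<omega>. \<forall>k. volume \<omega> (n * 2 ^ k) \<le> vbound M k (n * 2 ^ k)} = (\<Union>k. ?B k)"
      unfolding not_le[symmetric] by blast
    then have "emeasure K (UNIV - {\<omega>. \<forall>k. volume \<omega> (n * 2 ^ k) \<le> vbound M k (n * 2 ^ k)})
      \<le> (\<Sum>k. emeasure K (?B k))"
      by (simp only:, intro emeasure_subadditive_countably) (auto intro: sets_card_ball)
    also have "\<dots> \<le> (\<Sum>k. ennreal (C * M powr (- 1 / vdim) * u ^ k))"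
    proof (rule suminf_le)
      fix k
      have "1 \<le> 2 powr (real k * slack)" using slack by (intro ge_one_powr_ge_zero) auto
      then have "M * 1 \<le> M * 2 powr (real k * slack)" using M C by (intro mult_left_mono) auto
      then have "K.prob (?B k) \<le> C * (M * 2 powr (real k * slack)) powr (- 1 / vdim)"
        using M(2) n by (intro V) auto
      also have "\<dots> = C * M powr (- 1 / vdim) * u ^ k"
        using M C by (simp add: powr_mult powr_powr u_def powr_realpow[symmetric] mult.commute)
      finally show "emeasure K (?B k) \<le> ennreal (C * M powr (- 1 / vdim) * u ^ k)"
        by (simp add: K.emeasure_eq_measure ennreal_leI)
    qed auto
    also have "\<dots> = ennreal (C * M powr (- 1 / vdim) * (1 / (1 - u)))"
      using u C by (intro suminf_ennreal_eq sums_mult geometric_sums) auto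
    also have "\<dots> \<le> ennreal e" using M by (intro ennreal_leI) simp
    finally show ?thesis .
  qed
  then show ?thesis using M C by (intro that[of M]) auto
qed

abbreviation exceeding :: "real \<Rightarrow> real \<Rightarrow> marks \<Rightarrow> (label \<Rightarrow> real) set" where
  "exceeding b t \<omega> \<equiv> {\<xi>. \<exists>k. \<exists>v\<in>tree_ball \<omega> (level t k). threshold b t k < \<xi> v}"

text \<open>A union bound over each ball. The powers of rad t cancel because a(t)^\<alpha> = rad
  t^vdim, and the exponent of 2^k is slack + vdim - (vdim + 2 slack) = - slack.\<close>

lemma field_all_scales:
  assumes "0 < e" "1 \<le> M"
  obtains b where "1 \<le> b" "\<And>t \<omega>. 1 \<le> rad t \<Longrightarrow> 1 \<le> scale_a vdim \<alpha> t \<Longrightarrow>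
     (\<forall>k. volume \<omega> (level t k) \<le> vbound M k (level t k)) \<Longrightarrow>
     emeasure X (exceeding b t \<omega>) \<le> ennreal e"
proof -
  define u where "u = 2 powr (- slack)"
  have u: "0 < u" "u < 1" using slack by (auto simp: u_def powr_less_one)
  define C where "C = M * 2 powr vdim"
  have C: "0 < C" using assms by (simp add: C_def)
  have "((\<lambda>b. C / (1 - u) * b powr (- \<alpha>)) \<longlongrightarrow> C / (1 - u) * 0) at_top"
    using vdim(3) alpha by (intro tendsto_mult tendsto_const tendsto_neg_powr filterlim_ident) auto
  then have "eventually (\<lambda>b. C / (1 - u) * b powr (- \<alpha>) < e) at_top"
    using assms by (intro order_tendstoD) auto
  then have "eventually (\<lambda>b. C / (1 - u) * b powr (- \<alpha>) < e \<and> 1 \<le> b) at_top"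
    using eventually_ge_at_top[of 1] by eventually_elim auto
  then obtain b where b: "C / (1 - u) * b powr (- \<alpha>) < e" "1 \<le> b"
    by (auto simp: eventually_at_top_linorder)
  have "emeasure X (exceeding b t \<omega>) \<le> ennreal e"
    if r: "1 \<le> rad t" and a: "1 \<le> scale_a vdim \<alpha> t"
      and vol': "\<forall>k. volume \<omega> (level t k) \<le> vbound M k (level t k)" for t \<omega>
  proof -
    have vol: "volume \<omega> (level t k) \<le> vbound M k (level t k)" for k
      using vol' by blast
    have thr: "1 \<le> threshold b t k" for k
    proof -
      have "1 \<le> 2 powr (real k * gam)" using slack by (intro ge_one_powr_ge_zero) auto
      moreover have "1 \<le> b * scale_a vdim \<alpha> t" using a b mult_mono[of 1 b 1 "scale_a vdim \<alpha> t"] by simp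
      ultimately show ?thesis
        using mult_mono[of 1 "b * scale_a vdim \<alpha> t" 1 "2 powr (real k * gam)"] by (simp add: threshold_def)
    qed
    have "emeasure X (exceeding b t \<omega>)
      \<le> (\<Sum>k. ennreal (volume \<omega> (level t k) * threshold b t k powr (- \<alpha>)))"
      by (intro emeasure_field_exceeds finite_tree_ball thr)
    also have "\<dots> \<le> (\<Sum>k. ennreal (C * b powr (- \<alpha>) * u ^ k))"
    proof (intro suminf_le ennreal_leI)
      fix k
      have "real (level t k) powr vdim \<le> (2 * (rad t * 2 ^ k)) powr vdim"
        using level_bounds[OF r, of k] vdim by (intro powr_mono2) auto
      also have "\<dots> = 2 powr vdim * rad t powr vdim * 2 powr (real k * vdim)"
        using r by (simp add: powr_mult powr_powr[symmetric] powr_realpow)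
      finally have lev: "real (level t k) powr vdim \<le> 2 powr vdim * rad t powr vdim * 2 powr (real k * vdim)" .
      have "volume \<omega> (level t k) \<le> vbound M k (level t k)"
        by (rule vol)
      also have "\<dots> \<le> M * 2 powr (real k * slack) * (2 powr vdim * rad t powr vdim * 2 powr (real k * vdim))"
        using assms by (intro mult_left_mono lev) auto
      finally have "volume \<omega> (level t k) \<le> M * 2 powr (real k * slack) * (2 powr vdim * rad t powr vdim * 2 powr (real k * vdim))" .
      then have le: "volume \<omega> (level t k) * threshold b t k powr (- \<alpha>) \<le>
        M * 2 powr (real k * slack) * (2 powr vdim * rad t powr vdim * 2 powr (real k * vdim)) * threshold b t k powr (- \<alpha>)"
        by (intro mult_right_mono) auto
      have thr_eq: "threshold b t k powr (- \<alpha>) = b powr (- \<alpha>) * (1 / rad t powr vdim) * 2 powr (- (real k * (vdim + 2 * slack)))"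
      proof -
        have "real k * gam * - \<alpha> = - (real k * (gam * \<alpha>))" by simp
        then have "real k * gam * - \<alpha> = - (real k * (vdim + 2 * slack))" unfolding slack(4) .
        then have p2: "(2 powr (real k * gam)) powr (- \<alpha>) = 2 powr (- (real k * (vdim + 2 * slack)))"
          by (simp only: powr_powr)
        have a_eq: "scale_a vdim \<alpha> t powr (- \<alpha>) = 1 / rad t powr vdim"
          by (simp add: powr_minus scale_a_powr divide_inverse)
        have "threshold b t k powr (- \<alpha>) = b powr (- \<alpha>) * scale_a vdim \<alpha> t powr (- \<alpha>) * (2 powr (real k * gam)) powr (- \<alpha>)"
          unfolding threshold_def using a b by (simp only: powr_mult mult_nonneg_nonneg zero_le_one order_trans[of 0 1])
        then show ?thesis unfolding p2 a_eq .
      qed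
      have u_eq: "2 powr (real k * slack) * 2 powr (real k * vdim) * 2 powr (- (real k * (vdim + 2 * slack))) = u ^ k"
        by (simp add: u_def powr_add[symmetric] powr_realpow[symmetric] powr_powr algebra_simps)
      note le
      also have "M * 2 powr (real k * slack) * (2 powr vdim * rad t powr vdim * 2 powr (real k * vdim)) * threshold b t k powr (- \<alpha>) =
        C * b powr (- \<alpha>) * (2 powr (real k * slack) * 2 powr (real k * vdim) * 2 powr (- (real k * (vdim + 2 * slack))))"
        unfolding thr_eq using r by (simp add: C_def)
      also have "\<dots> = C * b powr (- \<alpha>) * u ^ k" unfolding u_eq ..
      finally show "volume \<omega> (level t k) * threshold b t k powr (- \<alpha>) \<le> C * b powr (- \<alpha>) * u ^ k" .
    qed auto
    also have "\<dots> = ennreal (C * b powr (- \<alpha>) * (1 / (1 - u)))"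
      using u C by (intro suminf_ennreal_eq sums_mult geometric_sums) auto
    also have "\<dots> \<le> ennreal e" using b by (intro ennreal_leI) simp
    finally show ?thesis .
  qed
  then show ?thesis using b that by blast
qed

text \<open>Once the volumes are bounded at all dyadic scales and the field lies below its
  thresholds, the estimate is deterministic: \<open>total_mass_upper\<close> applies with a = ln
  (rad t / t).\<close>

lemma upper_tail:
  assumes e: "0 < e"
  obtains l where "0 < l" "eventually (\<lambda>t. emeasure (K \<Otimes>\<^sub>M X)
    {x \<in> space (K \<Otimes>\<^sub>M X). ennreal (exp (l * t * scale_a vdim \<alpha> t)) < total_mass (kesten_tree (fst x)) (snd x) t} \<le> ennreal e) at_top"
proof -
  have e2: "0 < e / 2" using e by simp
  obtain M where M: "1 \<le> M" and volM: "\<And>n::nat. 1 \<le> n \<Longrightarrow>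
    emeasure K (UNIV - {\<omega>. \<forall>k. volume \<omega> (n * 2 ^ k) \<le> vbound M k (n * 2 ^ k)}) \<le> ennreal (e / 2)"
    by (rule volume_all_scales[OF e2]) (rule that)
  obtain b where b: "1 \<le> b" and field: "\<And>t \<omega>. 1 \<le> rad t \<Longrightarrow> 1 \<le> scale_a vdim \<alpha> t \<Longrightarrow>
     (\<forall>k. volume \<omega> (level t k) \<le> vbound M k (level t k)) \<Longrightarrow>
     emeasure X (exceeding b t \<omega>) \<le> ennreal (e / 2)"
    by (rule field_all_scales[OF e2 M]) (rule that)
  have b0: "0 < b" and M0: "0 < M" using b M by auto
  obtain k0 where k0: "eventually (\<lambda>t. \<forall>k\<ge>k0. exp (t * threshold b t (Suc k)) *
    (vbound M k (level t k) *
      exp ((rad t / t - 1) * t - ln (rad t / t) * real (level t k))) \<le> exp (- (real k + 1))) at_top"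
    by (rule level_terms_small[OF b0 M0]) (rule that)
  \<comment> \<open>The leading term is exp ((l - 1) t a(t)), and the added 1 absorbs the rest of
    the series, which is at most 1.\<close>
  define l where "l = b * 2 powr (real k0 * gam) + 1"
  have "eventually (\<lambda>t. 1 \<le> rad t) at_top" "eventually (\<lambda>t. 1 \<le> scale_a vdim \<alpha> t) at_top"
    using rad_at_top scale_a_at_top by (simp_all only: filterlim_at_top)
  then have "eventually (\<lambda>t. emeasure (K \<Otimes>\<^sub>M X)
    {x \<in> space (K \<Otimes>\<^sub>M X). ennreal (exp (l * t * scale_a vdim \<alpha> t)) < total_mass (kesten_tree (fst x)) (snd x) t} \<le> ennreal e) at_top"
    using k0 ln_rad_over_t eventually_gt_at_top[of 1]
  proof eventually_elim
    case (elim t)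
    let ?a = "scale_a vdim \<alpha> t"
    let ?A = "{x \<in> space (K \<Otimes>\<^sub>M X). ennreal (exp (l * t * ?a)) < total_mass (kesten_tree (fst x)) (snd x) t}"
    define G where "G = {\<omega>. \<forall>k. volume \<omega> (level t k) \<le> vbound M k (level t k)}"
    have t: "1 < t" and r: "1 \<le> rad t" and a: "1 \<le> ?a" using elim by auto
    have n1: "1 \<le> nat \<lceil>rad t\<rceil>" using r by linarith
    have Am: "?A \<in> sets (K \<Otimes>\<^sub>M X)" by measurable
    have Gm: "G \<in> sets K"
    proof -
      have "{\<omega> \<in> space K. \<forall>k. \<omega> \<in> {\<omega>. volume \<omega> (level t k) \<le> vbound M k (level t k)}} \<in> sets K"
        by (intro sets.sets_Collect_countable_All) (auto intro: sets_card_ball)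
      then show ?thesis by (simp add: G_def)
    qed
    have lnA: "0 \<le> ln (rad t / t)" 
    proof -
      have "0 \<le> q / 2 * ln t" using q(1) t by simp
      then show ?thesis using elim by linarith
    qed
    have expA: "exp (ln (rad t / t)) = rad t / t" using r t by simp
    have "emeasure (K \<Otimes>\<^sub>M X) ?A \<le> ennreal (e / 2) + ennreal (e / 2)"
    proof (rule emeasure_pair_bound[OF K.prob_space_axioms X.prob_space_axioms Am Gm])
      show "emeasure K (space K - G) \<le> ennreal (e / 2)"
        using volM[OF n1] by (simp add: G_def level_def)
      show "AE \<omega> in K. \<omega> \<in> G \<longrightarrow> emeasure X (Pair \<omega> -` ?A) \<le> ennreal (e / 2)"
        using AE_walk_tree
      proof (eventually_elim, intro impI)
        fix \<omega> assume wt: "walk_tree (kesten_tree \<omega>)" and \<omega>: "\<omega> \<in> G"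
        interpret walk_tree "kesten_tree \<omega>" by (rule wt)
        have vol: "volume \<omega> (level t k) \<le> vbound M k (level t k)" for k
          using \<omega> by (simp add: G_def)
        have "Pair \<omega> -` ?A \<subseteq> (exceeding b t \<omega>)"
        proof (rule ccontr)
          assume "\<not> ?thesis"
          then obtain \<xi> where \<xi>: "\<xi> \<in> Pair \<omega> -` ?A"
            "\<xi> \<notin> (exceeding b t \<omega>)" by blast
          have U: "ennreal (exp (l * t * ?a)) < total_mass (kesten_tree \<omega>) \<xi> t" using \<xi>(1) by simp
          have xi: "\<xi> v \<le> threshold b t k" if "v \<in> tree_ball \<omega> (level t k)" for k v
          proof (rule ccontr)
            assume "\<not> ?thesis"
            then have "threshold b t k < \<xi> v" by simp
            then show False using \<xi>(2) that by blast
          qed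
          \<comment> \<open>The decomposition starts at level k0: paths that stay inside that ball
            are controlled by its maximum, and \<open>level_terms_small\<close> covers all
            others.\<close>
          define R where "R j = level t (k0 + j)" for j
          define m where "m j = threshold b t (k0 + j)" for j
          have gen: "{v \<in> kesten_tree \<omega>. length v = R j} \<subseteq> tree_ball \<omega> (R j)" for j
            by (auto simp: tree_ball_def)
          have "total_mass (kesten_tree \<omega>) \<xi> t \<le> ennreal (exp (t * m 0)) + (\<Sum>j. ennreal (exp (t * m (Suc j)) *
             (real (card {v \<in> kesten_tree \<omega>. length v = R j}) * exp ((exp (ln (rad t / t)) - 1) * t - ln (rad t / t) * real (R j)))))"
          proof (rule total_mass_upper)
            show "strict_mono R" using r by (auto simp: strict_mono_def R_def level_def)
            show "0 \<le> m j" for j using a b by (simp add: m_def threshold_def)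
            show "\<xi> v \<le> m j" if "v \<in> kesten_tree \<omega>" "length v \<le> R j" for j v
              using xi[of v "k0 + j"] that by (simp add: m_def R_def tree_ball_def)
            show "finite {v \<in> kesten_tree \<omega>. length v = R j}" for j
              by (rule finite_subset[OF gen finite_tree_ball])
          qed (use t lnA in auto)
          also have "\<dots> \<le> ennreal (exp (t * m 0)) + ennreal 1"
          proof (rule add_left_mono)
            have "(\<Sum>j. ennreal (exp (t * m (Suc j)) *
               (real (card {v \<in> kesten_tree \<omega>. length v = R j}) * exp ((exp (ln (rad t / t)) - 1) * t - ln (rad t / t) * real (R j)))))
               \<le> (\<Sum>j. ennreal ((1 / 2) ^ Suc j))"
            proof (intro suminf_le ennreal_leI)
              fix j
              have "real (card {v \<in> kesten_tree \<omega>. length v = R j}) \<le> volume \<omega> (R j)"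
                using card_mono[OF finite_tree_ball gen] by simp
              also have "\<dots> \<le> vbound M (k0 + j) (R j)"
                using vol[of "k0 + j"] by (simp add: R_def)
              finally have "exp (t * m (Suc j)) * (real (card {v \<in> kesten_tree \<omega>. length v = R j}) * exp ((exp (ln (rad t / t)) - 1) * t - ln (rad t / t) * real (R j)))
                \<le> exp (t * m (Suc j)) * (vbound M (k0 + j) (R j) * exp ((rad t / t - 1) * t - ln (rad t / t) * real (R j)))"
                unfolding expA by (intro mult_left_mono mult_right_mono) auto
              also have "\<dots> \<le> exp (- (real (k0 + j) + 1))"
              proof -
                have "exp (t * threshold b t (Suc (k0 + j))) *
                  (vbound M (k0 + j) (level t (k0 + j)) *
                  exp ((rad t / t - 1) * t - ln (rad t / t) * real (level t (k0 + j)))) \<le> exp (- (real (k0 + j) + 1))"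
                  using elim(3) le_add1 by blast
                then show ?thesis by (simp add: m_def R_def)
              qed
              also have "\<dots> \<le> exp (- real (Suc j))" by simp
              also have "\<dots> = exp (- 1) ^ Suc j" by (simp only: exp_of_nat_mult[symmetric]) simp
              also have "\<dots> \<le> (1 / 2) ^ Suc j"
                using exp_ge_add_one_self[of "1::real"] by (intro power_mono) (auto simp: exp_minus field_simps)
              finally show "exp (t * m (Suc j)) * (real (card {v \<in> kesten_tree \<omega>. length v = R j}) * exp ((exp (ln (rad t / t)) - 1) * t - ln (rad t / t) * real (R j)))
                \<le> (1 / 2) ^ Suc j" .
            qed auto
            also have "(\<Sum>j. ennreal ((1 / 2) ^ Suc j)) = ennreal 1"
              by (rule suminf_ennreal_eq) (use power_half_series in auto)
            finally show "(\<Sum>j. ennreal (exp (t * m (Suc j)) *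
               (real (card {v \<in> kesten_tree \<omega>. length v = R j}) * exp ((exp (ln (rad t / t)) - 1) * t - ln (rad t / t) * real (R j))))) \<le> ennreal 1" .
          qed
          also have "ennreal (exp (t * m 0)) + ennreal 1 = ennreal (exp (t * m 0) + 1)" by simp
          also have "\<dots> \<le> ennreal (exp (l * t * ?a))"
          proof (rule ennreal_leI)
            have m0: "t * m 0 = b * 2 powr (real k0 * gam) * (t * ?a)" by (simp add: m_def threshold_def)
            have ta: "1 \<le> t * ?a" using mult_mono[of 1 t 1 ?a] t a by simp
            have "0 \<le> t * m 0" unfolding m0 using ta b by simp
            then have "exp (t * m 0) + 1 \<le> 2 * exp (t * m 0)" by simp
            also have "\<dots> \<le> exp 1 * exp (t * m 0)"
              using exp_ge_add_one_self[of "1::real"] by (intro mult_right_mono) auto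
            also have "\<dots> = exp (1 + t * m 0)" by (simp add: exp_add)
            also have "\<dots> \<le> exp (l * t * ?a)" using ta by (simp add: m0 l_def algebra_simps)
            finally show "exp (t * m 0) + 1 \<le> exp (l * t * ?a)" .
          qed
          finally show False using U by (simp add: add_left_mono not_le[symmetric])
        qed
        then have "emeasure X (Pair \<omega> -` ?A) \<le> emeasure X (exceeding b t \<omega>)"
          by (rule emeasure_mono) (rule sets_field_events(1)[OF finite_tree_ball])
        also have "\<dots> \<le> ennreal (e / 2)" using r a \<omega> unfolding G_def by (intro field) auto
        finally show "emeasure X (Pair \<omega> -` ?A) \<le> ennreal (e / 2)" .
      qed
    qed
    also have "\<dots> = ennreal e" using e by (simp flip: ennreal_plus)
    finally show ?case .
  qed
  moreover have "0 < l" using b by (simp add: l_def add_nonneg_pos)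
  ultimately show ?thesis by (intro that)
qed

text \<open>Half of e pays for the tree (the volume of radius R from below and of radius R + 1 from
  above), the other half for the field on the vertices with few children.\<close>

lemma lower_tail:
  assumes e: "0 < e"
  obtains th where "0 < th" "eventually (\<lambda>t. emeasure (K \<Otimes>\<^sub>M X)
    {x \<in> space (K \<Otimes>\<^sub>M X). total_mass (kesten_tree (fst x)) (snd x) t < ennreal (exp (th * t * scale_a vdim \<alpha> t))} \<le> ennreal e) at_top"
proof -
  have e4: "0 < e / 4" using e by simp
  obtain h R0 where h: "0 < h" "h \<le> 1" and low: "\<And>R. R0 \<le> R \<Longrightarrow> K.prob {\<omega>. volume \<omega> R < h * real R powr vdim} \<le> e / 4"
    by (rule volume_lower[OF e4]) (rule that)
  obtain C M0 where C: "0 < C" "1 \<le> M0" and V: "\<And>M R. M0 \<le> M \<Longrightarrow> 1 \<le> R \<Longrightarrow>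
      K.prob {\<omega>. M * real R powr vdim < volume \<omega> R} \<le> C * M powr (- 1 / vdim)"
    using volume_upper by metis
  have "((\<lambda>M. C * M powr (- 1 / vdim)) \<longlongrightarrow> C * 0) at_top"
    using vdim(3) by (intro tendsto_mult tendsto_const tendsto_neg_powr filterlim_ident) auto
  then have "eventually (\<lambda>M. C * M powr (- 1 / vdim) < e / 4) at_top"
    using e by (intro order_tendstoD) auto
  then have "eventually (\<lambda>M. C * M powr (- 1 / vdim) < e / 4 \<and> M0 \<le> M) at_top"
    using eventually_ge_at_top[of M0] by eventually_elim auto
  then obtain M where M: "C * M powr (- 1 / vdim) < e / 4" "M0 \<le> M"
    by (auto simp: eventually_at_top_linorder)
  \<comment> \<open>The factor 2^vdim passes from radius R + 1 <= 2 R back to R.\<close>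
  define N where "N = M * 2 powr vdim"
  have "1 \<le> 2 powr vdim" using vdim by (intro ge_one_powr_ge_zero) auto
  then have N: "1 \<le> N" using M C mult_mono[of 1 M 1 "2 powr vdim"] by (simp add: N_def)
  \<comment> \<open>With this K0, at most h R^vdim / 2 vertices have more than K0 children, half of
    the guaranteed volume.\<close>
  define K0 where "K0 = 2 * N / h"
  have K0: "0 < K0" using N h by (simp add: K0_def)
  define T where "T = max 1 (ln (2 / e))"
  \<comment> \<open>Chosen so that x = kap R^(vdim/\<alpha>) has tail probability x^(- \<alpha>)
    equal to T divided by h R^vdim / 2: all candidates stay below x with probability at most exp (-
    T).\<close>
  define kap where "kap = (h / (2 * T)) powr (1 / \<alpha>)"
  have T: "1 \<le> T" "exp (- T) \<le> e / 2"
  proof -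
    show "1 \<le> T" by (simp add: T_def)
    have "exp (- T) \<le> exp (- ln (2 / e))" by (simp add: T_def)
    also have "\<dots> = e / 2" using e by (simp add: exp_minus)
    finally show "exp (- T) \<le> e / 2" .
  qed
  have kap: "0 < kap" "kap powr (- \<alpha>) = 2 * T / h"
    using h T alpha vdim by (auto simp: kap_def powr_powr powr_minus)
  obtain e1 th where e1: "0 < e1" and th: "0 < th" and ev: "eventually (\<lambda>t. 2 \<le> t \<and> R0 \<le> nat \<lfloor>e1 * rad t\<rfloor> \<and> 1 \<le> nat \<lfloor>e1 * rad t\<rfloor> \<and>
     1 \<le> kap * real (nat \<lfloor>e1 * rad t\<rfloor>) powr (vdim / \<alpha>) \<and>
     th * (t * scale_a vdim \<alpha> t) \<le> t / 2 * (kap * real (nat \<lfloor>e1 * rad t\<rfloor>) powr (vdim / \<alpha>)) - t * (K0 + 1)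
       - real (nat \<lfloor>e1 * rad t\<rfloor>) * ln (2 * exp 1 * N * real (nat \<lfloor>e1 * rad t\<rfloor>) powr vdim)) at_top"
  \<comment> \<open>K0 + 1 bounds the degree of the target, which counts its children and its
    parent; the other constant comes from the factor 1/(2 e B) per step, with B = N R^vdim.\<close>
  proof (rule lower_exponent[of kap "K0 + 1" "2 * exp 1 * N" R0])
    show "1 \<le> 2 * exp 1 * N"
      using N exp_ge_add_one_self[of "1::real"] mult_mono[of 1 "2 * exp 1" 1 N] by simp
  qed (use kap K0 in auto)
  have "eventually (\<lambda>t. emeasure (K \<Otimes>\<^sub>M X)
    {x \<in> space (K \<Otimes>\<^sub>M X). total_mass (kesten_tree (fst x)) (snd x) t < ennreal (exp (th * t * scale_a vdim \<alpha> t))} \<le> ennreal e) at_top"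
    using ev
  proof eventually_elim
    case (elim t)
    let ?a = "scale_a vdim \<alpha> t"
    let ?A = "{x \<in> space (K \<Otimes>\<^sub>M X). total_mass (kesten_tree (fst x)) (snd x) t < ennreal (exp (th * t * ?a))}"
    define R where "R = nat \<lfloor>e1 * rad t\<rfloor>"
    define x where "x = kap * real R powr (vdim / \<alpha>)"
    have t: "2 \<le> t" and R: "R0 \<le> R" "1 \<le> R" and x1: "1 \<le> x"
      and expo: "th * (t * ?a) \<le> t / 2 * x - t * (K0 + 1) - real R * ln (2 * exp 1 * N * real R powr vdim)"
      using elim unfolding R_def[symmetric] x_def by auto
    define G where "G = {\<omega>. \<not> volume \<omega> R < h * real R powr vdim} \<inter>
      {\<omega>. \<not> M * real (Suc R) powr vdim < volume \<omega> (Suc R)}"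
    have Am: "?A \<in> sets (K \<Otimes>\<^sub>M X)" by measurable
    have Gm: "G \<in> sets K" unfolding G_def by (intro sets.Int sets_card_ball)
    have "emeasure (K \<Otimes>\<^sub>M X) ?A \<le> ennreal (e / 2) + ennreal (e / 2)"
    proof (rule emeasure_pair_bound[OF K.prob_space_axioms X.prob_space_axioms Am Gm])
      have "space K - G = {\<omega>. volume \<omega> R < h * real R powr vdim} \<union>
        {\<omega>. M * real (Suc R) powr vdim < volume \<omega> (Suc R)}" (is "_ = ?B1 \<union> ?B2")
        by (auto simp: G_def)
      then have "emeasure K (space K - G) \<le> emeasure K ?B1 + emeasure K ?B2"
        by (simp only:) (intro emeasure_subadditive sets_card_ball)
      also have "\<dots> \<le> ennreal (e / 4) + ennreal (e / 4)"
        using low[OF R(1)] V[OF M(2), of "Suc R"] M(1)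
        by (intro add_mono) (auto simp: K.emeasure_eq_measure intro!: ennreal_leI)
      also have "\<dots> = ennreal (e / 2)" using e by (simp flip: ennreal_plus)
      finally show "emeasure K (space K - G) \<le> ennreal (e / 2)" .
      show "AE \<omega> in K. \<omega> \<in> G \<longrightarrow> emeasure X (Pair \<omega> -` ?A) \<le> ennreal (e / 2)"
        using AE_walk_tree
      proof (eventually_elim, intro impI)
        fix \<omega> assume wt: "walk_tree (kesten_tree \<omega>)" and \<omega>: "\<omega> \<in> G"
        interpret walk_tree "kesten_tree \<omega>" by (rule wt)
        define S where "S = {v \<in> tree_ball \<omega> R. real (num_children \<omega> v) \<le> K0}"
        have S_fin: "finite S" using finite_tree_ball by (simp add: S_def)
        define B where "B = N * real R powr vdim"
        have Rd: "real R \<le> real R powr vdim" using powr_mono[of 1 vdim "real R"] R vdim by simp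
        have BR: "real R \<le> B" using mult_mono[of 1 N "real R" "real R powr vdim"] N Rd by (simp add: B_def)
        have B1: "1 \<le> B" using BR R by linarith
        have outer: "volume \<omega> (Suc R) \<le> B"
        proof -
          have "volume \<omega> (Suc R) \<le> M * real (Suc R) powr vdim" using \<omega> by (auto simp: G_def)
          also have "\<dots> \<le> M * (2 * real R) powr vdim"
            using R vdim M C by (intro mult_left_mono powr_mono2) auto
          also have "\<dots> = B" by (simp add: B_def N_def powr_mult)
          finally show ?thesis .
        qed
        have card_S: "h * real R powr vdim / 2 \<le> real (card S)"
        proof -
          have "h * real R powr vdim \<le> volume \<omega> R" using \<omega> by (auto simp: G_def)
          moreover have "volume \<omega> (Suc R) / K0 \<le> B / K0"
            using outer K0 by (intro divide_right_mono) auto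
          moreover have "B / K0 = h * real R powr vdim / 2" using N h by (simp add: B_def K0_def)
          ultimately show ?thesis using card_few_children[OF K0, of \<omega> R] unfolding S_def by linarith
        qed
        have sub: "\<exists>v\<in>S. \<not> \<xi> v < x \<Longrightarrow> (\<forall>v. 1 \<le> \<xi> v) \<Longrightarrow> ennreal (exp (th * t * ?a)) \<le> total_mass (kesten_tree \<omega>) \<xi> t" for \<xi>
        proof -
          assume "\<exists>v\<in>S. \<not> \<xi> v < x" and pos: "\<forall>v. 1 \<le> \<xi> v"
          then obtain v where v: "v \<in> S" "x \<le> \<xi> v" by (auto simp: not_less)
          have vR: "length v \<le> R" "v \<in> kesten_tree \<omega>" "real (num_children \<omega> v) \<le> K0"
            using v by (auto simp: S_def tree_ball_def)
          have degv: "real (deg v) \<le> K0 + 1" using degree_kesten_le[of \<omega> v] vR by linarith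
          have "ennreal ((1 / (2 * exp 1 * B)) ^ length v * exp (- t * real (deg v)) * exp (t / 2 * \<xi> v)) \<le> total_mass (kesten_tree \<omega>) \<xi> t"
          proof (rule total_mass_lower[OF vR(2)])
            show "real (deg u) \<le> B" if "suffix u v" for u
            proof -
              have "length u \<le> R" using suffix_length_le[OF that] vR by simp
              then show ?thesis using degree_le_ball[of u R \<omega>] outer by linarith
            qed
            have "real (length v) / B \<le> 1" using vR BR B1 by (simp add: divide_le_eq_1)
            then show "real (length v) / B \<le> t / 2" using t by linarith
            show "0 \<le> \<xi> w" for w using pos[rule_format, of w] by linarith
          qed (use t B1 in auto)
          moreover have "exp (th * t * ?a) \<le> (1 / (2 * exp 1 * B)) ^ length v * exp (- t * real (deg v)) * exp (t / 2 * \<xi> v)"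
          proof -
            define W where "W = 2 * exp 1 * B"
            have W: "1 \<le> W" using B1 exp_ge_add_one_self[of "1::real"] mult_mono[of 1 "2 * exp 1" 1 B] by (simp add: W_def)
            have "(1 / W) ^ length v = exp (- (real (length v) * ln W))"
              using W by (simp add: exp_minus exp_of_nat_mult power_inverse divide_inverse)
            then have "(1 / W) ^ length v * exp (- t * real (deg v)) * exp (t / 2 * \<xi> v) =
              exp (- (real (length v) * ln W) - t * real (deg v) + t / 2 * \<xi> v)"
              by (simp add: mult_exp_exp)
            moreover have "th * (t * ?a) \<le> - (real (length v) * ln W) - t * real (deg v) + t / 2 * \<xi> v"
            proof -
              have "real (length v) * ln W \<le> real R * ln W" using vR W by (intro mult_right_mono) auto
              moreover have "W = 2 * exp 1 * N * real R powr vdim" by (simp add: W_def B_def)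
              moreover have "t * real (deg v) \<le> t * (K0 + 1)" using degv t by (intro mult_left_mono) auto
              moreover have "t / 2 * x \<le> t / 2 * \<xi> v" using v t by (intro mult_left_mono) auto
              ultimately show ?thesis using expo by simp
            qed
            ultimately show ?thesis by (simp add: W_def mult.assoc)
          qed
          ultimately show ?thesis by (meson ennreal_leI order_trans)
        qed
        have "emeasure X (Pair \<omega> -` ?A) \<le> emeasure X {\<xi>. \<forall>v\<in>S. \<xi> v < x}"
        proof (rule emeasure_mono_AE)
          show "AE \<xi> in X. \<xi> \<in> Pair \<omega> -` ?A \<longrightarrow> \<xi> \<in> {\<xi>. \<forall>v\<in>S. \<xi> v < x}"
            using AE_field_ge_1 by eventually_elim (use sub in \<open>force simp: not_le[symmetric]\<close>)
          show "{\<xi>. \<forall>v\<in>S. \<xi> v < x} \<in> sets X"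
            using sets_field_events(2)[of "\<lambda>_. {}" S x] S_fin by simp
        qed
        also have "\<dots> \<le> ennreal (exp (- (x powr (- \<alpha>) * real (card S))))"
          by (rule emeasure_field_below[OF S_fin x1])
        also have "\<dots> \<le> ennreal (e / 2)"
        proof (rule ennreal_leI)
          have "x powr (- \<alpha>) = 2 * T / h * real R powr (- vdim)"
            using kap R alpha vdim by (simp add: x_def powr_mult powr_powr)
          then have "T = x powr (- \<alpha>) * (h * real R powr vdim / 2)"
            using h R by (simp add: powr_minus field_simps)
          also have "\<dots> \<le> x powr (- \<alpha>) * real (card S)" using card_S by (intro mult_left_mono) auto
          finally have "exp (- (x powr (- \<alpha>) * real (card S))) \<le> exp (- T)" by simp
          then show "exp (- (x powr (- \<alpha>) * real (card S))) \<le> e / 2" using T by linarith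
        qed
        finally show "emeasure X (Pair \<omega> -` ?A) \<le> ennreal (e / 2)" .
      qed
    qed
    also have "\<dots> = ennreal e" using e by (simp flip: ennreal_plus)
    finally show ?case .
  qed
  then show ?thesis using th by (intro that)
qed

end

section \<open>From the two tails to the limit\<close>

theorem theorem1p2:
  fixes \<mu> :: "nat pmf" and \<beta> c d \<alpha> :: real and \<nu> \<rho> :: "real measure"
  assumes "critical_offspring \<mu>"
    and "1 < \<beta>" and "\<beta> \<le> 2" and "c > 0"
    and "stable_limit_law \<beta> \<nu>"
    and "weak_conv_m (normalised_sum_law \<mu> \<beta> c) \<nu>"
    and "d = \<beta> / (\<beta> - 1)" and "\<alpha> > d"
    and "pareto_law \<alpha> \<rho>"
  shows "((\<lambda>l::real. Liminf at_top (\<lambda>t::real. ereal (measure (joint_law \<mu> \<rho>)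
            {(\<omega>, \<xi>) \<in> space (joint_law \<mu> \<rho>).
               ext_log (total_mass (kesten_tree \<omega>) \<xi> t)
                 \<in> {ereal (inverse l * t * scale_a d \<alpha> t) .. ereal (l * t * scale_a d \<alpha> t)}})))
          \<longlongrightarrow> 1) at_top"
proof -
  interpret stable_critical \<mu> \<beta> c \<nu>
    using assms by unfold_locales auto
  have d: "d = vdim" using assms by (simp add: vdim_def)
  interpret pam_setting \<mu> \<beta> c \<nu> \<alpha> \<rho>
    using assms d by unfold_locales auto
  let ?J = "K \<Otimes>\<^sub>M X"
  let ?U = "\<lambda>x t. total_mass (kesten_tree (fst x)) (snd x) t"
  interpret J: pair_prob_space K X ..
  have J: "joint_law \<mu> \<rho> = ?J" by (simp add: joint_law_def)
  define A where "A l t = {x \<in> space ?J. ennreal (exp (inverse l * t * scale_a vdim \<alpha> t)) \<le> ?U x t \<and>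
    ?U x t \<le> ennreal (exp (l * t * scale_a vdim \<alpha> t))}" for l t
  have A: "{(\<omega>, \<xi>) \<in> space (joint_law \<mu> \<rho>).
               ext_log (total_mass (kesten_tree \<omega>) \<xi> t)
                 \<in> {ereal (inverse l * t * scale_a d \<alpha> t) .. ereal (l * t * scale_a d \<alpha> t)}} = A l t" for l t
    unfolding ext_log_in_iff A_def J d by auto
  define f where "f l = Liminf at_top (\<lambda>t. ereal (measure ?J (A l t)))" for l
  have Am: "A l t \<in> sets ?J" for l t unfolding A_def by measurable
  have f_le: "f l \<le> 1" for l
  proof -
    have "f l \<le> Liminf at_top (\<lambda>t::real. 1)"
      unfolding f_def by (intro Liminf_mono always_eventually allI) (simp add: J.P.prob_le_1)
    then show ?thesis by (simp add: Liminf_const)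
  qed
  have f_ge: "eventually (\<lambda>l. ereal (1 - 2 * e) \<le> f l) at_top" if e: "0 < e" for e
  proof -
    obtain l0 where l0: "0 < l0" and up: "eventually (\<lambda>t. emeasure ?J
      {x \<in> space ?J. ennreal (exp (l0 * t * scale_a vdim \<alpha> t)) < ?U x t} \<le> ennreal e) at_top"
      by (rule upper_tail[OF e]) (rule that)
    obtain th where th: "0 < th" and lo: "eventually (\<lambda>t. emeasure ?J
      {x \<in> space ?J. ?U x t < ennreal (exp (th * t * scale_a vdim \<alpha> t))} \<le> ennreal e) at_top"
      by (rule lower_tail[OF e]) (rule that)
    \<comment> \<open>Once l >= l0 and 1/l <= th, leaving the window forces one of the two tail
      events; the bound on their probabilities does not depend on l.\<close>
    have "eventually (\<lambda>l. max l0 (inverse th) \<le> l) at_top" by (rule eventually_ge_at_top)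
    then show ?thesis
    proof eventually_elim
      case (elim l)
      then have l: "l0 \<le> l" "inverse th \<le> l" by auto
      have il: "inverse l \<le> th" using le_imp_inverse_le[OF l(2)] th by simp
      have "eventually (\<lambda>t. 1 - 2 * e \<le> measure ?J (A l t)) at_top"
        using up lo eventually_ge_at_top[of 0]
      proof eventually_elim
        case (elim t)
        let ?H = "{x \<in> space ?J. ennreal (exp (l0 * t * scale_a vdim \<alpha> t)) < ?U x t}"
        let ?L = "{x \<in> space ?J. ?U x t < ennreal (exp (th * t * scale_a vdim \<alpha> t))}"
        have ta: "0 \<le> t * scale_a vdim \<alpha> t" using elim by (simp add: scale_a_eq)
        have Hm: "?H \<in> sets ?J" and Lm: "?L \<in> sets ?J" by measurable
        have exps: "exp (l0 * t * scale_a vdim \<alpha> t) \<le> exp (l * t * scale_a vdim \<alpha> t)"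
          "exp (inverse l * t * scale_a vdim \<alpha> t) \<le> exp (th * t * scale_a vdim \<alpha> t)"
          using mult_right_mono[OF l(1) ta] mult_right_mono[OF il ta] by (auto simp: mult.assoc)
        have "space ?J - A l t \<subseteq> ?H \<union> ?L"
        proof (rule subsetI, rule ccontr)
          fix x assume x: "x \<in> space ?J - A l t" "x \<notin> ?H \<union> ?L"
          then have "?U x t \<le> ennreal (exp (l0 * t * scale_a vdim \<alpha> t))"
            "ennreal (exp (th * t * scale_a vdim \<alpha> t)) \<le> ?U x t" by (simp_all add: not_less)
          then have "x \<in> A l t"
            using x exps[THEN ennreal_leI] order_trans unfolding A_def by blast
          then show False using x by blast
        qed
        then have "measure ?J (space ?J - A l t) \<le> measure ?J (?H \<union> ?L)"
          using Hm Lm by (intro J.P.finite_measure_mono) auto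
        also have "\<dots> \<le> measure ?J ?H + measure ?J ?L"
          by (rule measure_Un_le[OF Hm Lm])
        also have "\<dots> \<le> e + e"
          using elim e by (intro add_mono) (auto simp: J.P.emeasure_eq_measure)
        finally show ?case using J.P.prob_compl[OF Am, of l t] by simp
      qed
      then have "Liminf at_top (\<lambda>t::real. ereal (1 - 2 * e)) \<le> f l"
        unfolding f_def by (intro Liminf_mono) (auto elim: eventually_mono)
      then show ?case by (simp add: Liminf_const)
    qed
  qed
  have "(f \<longlongrightarrow> 1) at_top"
  proof (rule order_tendstoI)
    fix y :: ereal assume "y < 1"
    then obtain z where z: "y < ereal z" "ereal z < 1" using ereal_dense2 by blast
    then have "0 < (1 - z) / 2" by simp
    from f_ge[OF this] have "eventually (\<lambda>l. ereal z \<le> f l) at_top" by (simp add: field_simps)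
    then show "eventually (\<lambda>l. y < f l) at_top"
      by eventually_elim (use z in \<open>auto intro: less_le_trans\<close>)
  next
    fix y :: ereal assume "1 < y"
    then have "f l < y" for l by (rule le_less_trans[OF f_le])
    then show "eventually (\<lambda>l. f l < y) at_top" by (rule always_eventually[OF allI])
  qed
  then show ?thesis unfolding f_def A[symmetric] J d .
qed

end
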